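(* Let $f$ be a weakly holomorphic modular function for $\mathrm{SL}(2,\mathbb{Z})$ that is real and non-negative on the geodesic arc $\{e^{it}:\pi/3\le t\le 2\pi/3\}$, and assume that $t\mapsto f(e^{it})$ is increasing for $t\in[\pi/3,\pi/2]$. Let $w\in\mathcal{M}$ be a Markov irrationality. Then $$\mathrm{val}_f(\phi)\leq \mathrm{Re}(\mathrm{val}_f(w))\leq \mathrm{val}_f(\psi),\qquad \phi=\tfrac{1+\sqrt5}{2},\ \psi=1+\sqrt2.$$
   Context: A weakly holomorphic modular function for $\mathrm{SL}(2,\mathbb{Z})$ is a holomorphic $\mathrm{SL}(2,\mathbb{Z})$-invariant function on $\mathbb{H}$ whose $q$-expansion has only finitely many negative powers of $q$. For hyperbolic $A\in\mathrm{SL}(2,\mathbb{Z})$ with attracting fixed point $\tilde w$ and repelling fixed point $w$, let $Q(x,y)=ax^2+bxy+cy^2$ be the integral primitive indefinite quadratic form with $Q(w,1)=Q(\tilde w,1)=0$ and $\mathrm{sgn}(a)=\mathrm{sgn}(w-\tilde w)$, $D=b^2-4ac$. Define $I_f(A)=\int_{\tau_0}^{A\tau_0}\frac{f(\tau)\sqrt D}{Q(\tau,1)}d\tau$ (any $\tau_0\in\mathbb{H}$); $I_1(A)=2\log\varepsilon$ with $\varepsilon>1$ the largest eigenvalue of $A$. For a real quadratic irrationality $w$, $\mathrm{val}_f(w)=I_f(A)/I_1(A)$ for any hyperbolic $A\in\mathrm{SL}(2,\mathbb{Z})$ fixing $w$. The values $\mathrm{val}_f(\phi),\mathrm{val}_f(\psi)$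 are real. Markov irrationalities: with $[\overline{a_1;\ldots,a_r}]$ denoting a purely periodic continued fraction, define $[\overline{a_1;\ldots,a_r}]\odot[\overline{b_1;\ldots,b_s}]=[\overline{a_1;\ldots,a_r,b_1,\ldots,b_s}]$. The Markov tree starts from $\phi=[\overline{1;1}]$ and $\psi=[\overline{2;2}]$, whose child is $\psi\odot\phi$; recursively a vertex $w=w_2\odot w_1$ (with $w_1,w_2$ its generating neighbours) has children $w\odot w_1$ and $w_2\odot w$. $\mathcal{M}$ is the set of all numbers appearing in this tree (including $\phi,\psi$). *)

theory Defs
  imports "HOL-Complex_Analysis.Complex_Analysis"
begin

no_notation fps_nth (infixl "$" 75)

definition upper_half_plane :: "complex set" where
  "upper_half_plane = {\<tau>. Im \<tau> > 0}"

definition moebius_map :: "int^2^2 \<Rightarrow> 'a::field \<Rightarrow> 'a" where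
  "moebius_map A z = (of_int (A$1$1) * z + of_int (A$1$2)) / (of_int (A$2$1) * z + of_int (A$2$2))"

definition weakly_holomorphic_modular_function :: "(complex \<Rightarrow> complex) \<Rightarrow> bool" where
  "weakly_holomorphic_modular_function f \<longleftrightarrow>
     f holomorphic_on upper_half_plane \<and>
     (\<forall>A::int^2^2. det A = 1 \<longrightarrow> (\<forall>\<tau>\<in>upper_half_plane. f (moebius_map A \<tau>) = f \<tau>)) \<and>
     (\<exists>(N::nat) (c::int \<Rightarrow> complex). \<forall>\<tau>\<in>upper_half_plane.
        ((\<lambda>n. c n * exp (2 * of_real pi * \<i> * \<tau>) powi n) has_sum f \<tau>) {- int N..})"

definition hyperbolic :: "int^2^2 \<Rightarrow> bool" where
  "hyperbolic A \<longleftrightarrow> det A = 1 \<and> \<bar>trace A\<bar> > 2"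

text \<open>The condition on the denominator excludes spurious fixed points caused by \<open>x / 0 = 0\<close>.
  A hyperbolic integral matrix does not fix \<open>\<infinity>\<close>, so real fixed points suffice.\<close>

definition fixes_point :: "int^2^2 \<Rightarrow> real \<Rightarrow> bool" where
  "fixes_point A x \<longleftrightarrow> of_int (A$2$1) * x + of_int (A$2$2) \<noteq> 0 \<and> moebius_map A x = x"

definition attracting_fixed_point :: "int^2^2 \<Rightarrow> real \<Rightarrow> bool" where
  "attracting_fixed_point A x \<longleftrightarrow> fixes_point A x \<and> \<bar>deriv (moebius_map A) x\<bar> < 1"

definition repelling_fixed_point :: "int^2^2 \<Rightarrow> real \<Rightarrow> bool" where
  "repelling_fixed_point A x \<longleftrightarrow> fixes_point A x \<and> \<bar>deriv (moebius_map A) x\<bar> > 1"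

type_synonym binary_form = "int \<times> int \<times> int"

fun eval_form :: "binary_form \<Rightarrow> 'a::comm_ring_1 \<Rightarrow> 'a \<Rightarrow> 'a" where
  "eval_form (a, b, c) x y = of_int a * x\<^sup>2 + of_int b * x * y + of_int c * y\<^sup>2"

fun discr_form :: "binary_form \<Rightarrow> int" where
  "discr_form (a, b, c) = b\<^sup>2 - 4 * a * c"

fun primitive_form :: "binary_form \<Rightarrow> bool" where
  "primitive_form (a, b, c) \<longleftrightarrow> Gcd {a, b, c} = 1"

definition is_form_of :: "int^2^2 \<Rightarrow> binary_form \<Rightarrow> bool" where
  "is_form_of A Q \<longleftrightarrow> primitive_form Q \<and> discr_form Q > 0 \<and>
     (\<exists>w w'. repelling_fixed_point A w \<and> attracting_fixed_point A w' \<and>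
        eval_form Q w 1 = 0 \<and> eval_form Q w' 1 = 0 \<and> sgn (of_int (fst Q)) = sgn (w - w'))"

definition form_of :: "int^2^2 \<Rightarrow> binary_form" where
  "form_of A = (THE Q. is_form_of A Q)"

definition cycle_integrand :: "(complex \<Rightarrow> complex) \<Rightarrow> int^2^2 \<Rightarrow> complex \<Rightarrow> complex" where
  "cycle_integrand f A \<tau> =
     f \<tau> * of_real (sqrt (of_int (discr_form (form_of A)))) / eval_form (form_of A) \<tau> 1"

text \<open>The base point is fixed to be \<open>\<i>\<close>; see \<open>cycle_integral_base_point\<close> below for the
  independence of this choice.\<close>

definition cycle_integral :: "(complex \<Rightarrow> complex) \<Rightarrow> int^2^2 \<Rightarrow> complex" where
  "cycle_integral f A = contour_integral (linepath \<i> (moebius_map A \<i>)) (cycle_integrand f A)"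

definition val :: "(complex \<Rightarrow> complex) \<Rightarrow> real \<Rightarrow> complex" where
  "val f w = (let A = (SOME A. hyperbolic A \<and> fixes_point A w)
              in cycle_integral f A / cycle_integral (\<lambda>_. 1) A)"

fun cf_convergent :: "(nat \<Rightarrow> nat) \<Rightarrow> nat \<Rightarrow> real" where
  "cf_convergent a 0 = real (a 0)"
| "cf_convergent a (Suc n) = real (a 0) + 1 / cf_convergent (\<lambda>k. a (Suc k)) n"

definition periodic_cf :: "nat list \<Rightarrow> real" where
  "periodic_cf xs = lim (cf_convergent (\<lambda>k. xs ! (k mod length xs)))"

text \<open>The operation \<open>\<odot>\<close> depends on the chosen period and not only on the number, so the Markov
  tree is built from period words. A pair \<open>(u, v)\<close> stands for the vertex \<open>u \<odot> v\<close> together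
  with its generating neighbours \<open>u = w\<^sub>2\<close> and \<open>v = w\<^sub>1\<close>.\<close>

inductive markov_vertex :: "nat list \<Rightarrow> nat list \<Rightarrow> bool" where
  root: "markov_vertex [2, 2] [1, 1]"
| left: "markov_vertex u v \<Longrightarrow> markov_vertex (u @ v) v"
| right: "markov_vertex u v \<Longrightarrow> markov_vertex u (u @ v)"

definition markov_irrationalities :: "real set" where
  "markov_irrationalities =
     {periodic_cf [1, 1], periodic_cf [2, 2]} \<union> {periodic_cf (u @ v) | u v. markov_vertex u v}"

subsection \<open>Well-definedness of the notions above\<close>

lemma det_2_of_int:
  assumes "det (A :: int^2^2) = 1"
  shows "of_int (A$1$1) * of_int (A$2$2) - of_int (A$1$2) * of_int (A$2$1) = (1 :: 'a::ring_1)"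
proof -
  have "A$1$1 * A$2$2 - A$1$2 * A$2$1 = 1" using assms by (simp add: det_2)
  then have "of_int (A$1$1 * A$2$2 - A$1$2 * A$2$1) = (of_int 1 :: 'a)" by (rule arg_cong)
  then show ?thesis by (simp only: of_int_diff of_int_mult of_int_1)
qed

lemma hyperbolic_det: "hyperbolic A \<Longrightarrow> det A = 1"
  by (simp add: hyperbolic_def)

lemma hyperbolic_lower_left_nonzero:
  assumes "hyperbolic A" shows "A$2$1 \<noteq> 0"
proof
  assume "A$2$1 = 0"
  with assms have "A$1$1 * A$2$2 = 1" and t: "\<bar>A$1$1 + A$2$2\<bar> > 2"
    by (auto simp: hyperbolic_def det_2 trace_def sum_2)
  then have "(A$1$1 = 1 \<and> A$2$2 = 1) \<or> (A$1$1 = -1 \<and> A$2$2 = -1)"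
    by (simp add: zmult_eq_1_iff)
  with t show False by auto
qed

lemma fixes_point_iff:
  assumes "hyperbolic A"
  defines "t \<equiv> real_of_int (A$1$1 + A$2$2)"
  defines "u \<equiv> \<lambda>x. of_int (A$2$1) * x + of_int (A$2$2) :: real"
  shows "fixes_point A x \<longleftrightarrow> (u x)\<^sup>2 - t * u x + 1 = 0"
proof -
  let ?a = "real_of_int (A$1$1)" and ?b = "real_of_int (A$1$2)"
  let ?c = "real_of_int (A$2$1)" and ?d = "real_of_int (A$2$2)"
  have c: "?c \<noteq> 0" using hyperbolic_lower_left_nonzero[OF assms(1)] by simp
  have d: "?a * ?d - ?b * ?c = 1"
    by (rule det_2_of_int[OF hyperbolic_det[OF assms(1)]])
  have e: "(u x)\<^sup>2 - t * u x + 1 = ?c * (x * u x - (?a * x + ?b))"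
    using d unfolding u_def t_def by (simp add: power2_eq_square) algebra
  have "u x \<noteq> 0" if "(u x)\<^sup>2 - t * u x + 1 = 0" using that by auto
  moreover have "moebius_map A x = x \<longleftrightarrow> x * u x - (?a * x + ?b) = 0" if "u x \<noteq> 0"
    using that by (auto simp: moebius_map_def u_def divide_simps)
  ultimately show ?thesis
    unfolding fixes_point_def using e c by (auto simp: u_def)
qed

lemma moebius_map_has_field_derivative:
  fixes x :: "'a::real_normed_field"
  assumes "det A = 1" "of_int (A$2$1) * x + of_int (A$2$2) \<noteq> 0"
  shows "(moebius_map A has_field_derivative 1 / (of_int (A$2$1) * x + of_int (A$2$2))\<^sup>2) (at x)"
proof -
  have d: "of_int (A$1$1) * of_int (A$2$2) - of_int (A$1$2) * of_int (A$2$1) = (1::'a)"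
    by (rule det_2_of_int[OF assms(1)])
  show ?thesis
    unfolding moebius_map_def [abs_def]
    by (rule derivative_eq_intros refl assms)+
      (use d in \<open>simp add: power2_eq_square algebra_simps\<close>)
qed

lemma hyperbolic_fixed_points:
  assumes "hyperbolic A"
  obtains w w' where "repelling_fixed_point A w" "attracting_fixed_point A w'" "w \<noteq> w'"
    "\<And>x. repelling_fixed_point A x \<longleftrightarrow> x = w" "\<And>x. attracting_fixed_point A x \<longleftrightarrow> x = w'"
    "of_int (A$2$1) * (w + w') = real_of_int (A$1$1 - A$2$2)"
    "of_int (A$2$1) * (w * w') = - real_of_int (A$1$2)"
proof -
  define t where "t = real_of_int (A$1$1 + A$2$2)"
  define u where "u = (\<lambda>x. of_int (A$2$1) * x + of_int (A$2$2) :: real)"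
  let ?c = "real_of_int (A$2$1)" and ?d = "real_of_int (A$2$2)"
  have c: "?c \<noteq> 0" using hyperbolic_lower_left_nonzero[OF assms] by simp
  have "\<bar>A$1$1 + A$2$2\<bar> > 2" using assms by (simp add: hyperbolic_def trace_def sum_2)
  then have t: "\<bar>t\<bar> > 2" unfolding t_def by linarith
  define s where "s = sqrt (t\<^sup>2 - 4)"
  have "2\<^sup>2 < \<bar>t\<bar>\<^sup>2" by (rule power_strict_mono) (use t in auto)
  then have s: "s > 0" "s\<^sup>2 = t\<^sup>2 - 4" by (auto simp: s_def)
  define L where "L = (if t > 0 then (t + s) / 2 else (t - s) / 2)"
  have L1: "\<bar>L\<bar> > 1" using t s(1) by (auto simp: L_def)
  have L0: "L\<^sup>2 - t * L + 1 = 0"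
    using s(2) by (auto simp: L_def power2_eq_square field_simps)
  have Ln: "L \<noteq> 0" using L1 by auto
  have Lt: "L + 1 / L = t" using L0 Ln by (simp add: field_simps power2_eq_square)
  have roots: "v\<^sup>2 - t * v + 1 = 0 \<longleftrightarrow> v = L \<or> v = 1 / L" for v
  proof -
    have "v\<^sup>2 - t * v + 1 = (v - L) * (v - 1 / L)"
      unfolding Lt[symmetric] using Ln by (simp add: field_simps power2_eq_square)
    then show ?thesis by simp
  qed
  have fp: "fixes_point A x \<longleftrightarrow> u x = L \<or> u x = 1 / L" for x
    using fixes_point_iff[OF assms, of x] roots[of "u x"] by (simp add: t_def u_def)
  have der: "deriv (moebius_map A) x = 1 / (u x)\<^sup>2" if "fixes_point A x" for x
    using that moebius_map_has_field_derivative[of A x] assms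
    by (auto intro!: DERIV_imp_deriv simp: fixes_point_def hyperbolic_def u_def)
  have Lsq: "L\<^sup>2 > 1" using L1 by (simp add: abs_square_less_1 flip: abs_square_le_1 not_le)
  then have Linv: "1 / L\<^sup>2 < 1" by (simp add: divide_less_eq)
  have att: "attracting_fixed_point A x \<longleftrightarrow> u x = L" for x
  proof -
    have "\<bar>deriv (moebius_map A) x\<bar> < 1" if "u x = L"
      using that der[of x] fp[of x] Linv by simp
    moreover have "\<not> \<bar>deriv (moebius_map A) x\<bar> < 1" if "u x = 1 / L"
      using that der[of x] fp[of x] Lsq by (simp add: power_divide)
    ultimately show ?thesis by (auto simp: attracting_fixed_point_def fp)
  qed
  have rep: "repelling_fixed_point A x \<longleftrightarrow> u x = 1 / L" for x
  proof -
    have "\<not> \<bar>deriv (moebius_map A) x\<bar> > 1" if "u x = L"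
      using that der[of x] fp[of x] Linv by simp
    moreover have "\<bar>deriv (moebius_map A) x\<bar> > 1" if "u x = 1 / L"
      using that der[of x] fp[of x] Lsq by (simp add: power_divide)
    ultimately show ?thesis by (auto simp: repelling_fixed_point_def fp)
  qed
  define w w' where "w = (1 / L - ?d) / ?c" and "w' = (L - ?d) / ?c"
  have u: "u x = v \<longleftrightarrow> x = (v - ?d) / ?c" for x v
    using c by (auto simp: u_def field_simps)
  have 1: "repelling_fixed_point A x \<longleftrightarrow> x = w" for x unfolding rep u w_def by simp
  have 2: "attracting_fixed_point A x \<longleftrightarrow> x = w'" for x unfolding att u w'_def by simp
  have "L \<noteq> 1 / L" using Lsq Ln by (auto simp: field_simps power2_eq_square)
  then have 3: "w \<noteq> w'" using c by (auto simp: w_def w'_def)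
  have 4: "?c * (w + w') = real_of_int (A$1$1 - A$2$2)"
  proof -
    have "?c * (w + w') = (L + 1 / L) - 2 * ?d" using c by (simp add: w_def w'_def distrib_left)
    then show ?thesis unfolding Lt t_def by simp
  qed
  have d: "real_of_int (A$1$1) * ?d - real_of_int (A$1$2) * ?c = 1"
    by (rule det_2_of_int[OF hyperbolic_det[OF assms(1)]])
  have "?c * (?c * (w * w')) = (1 / L - ?d) * (L - ?d)"
    using c by (simp add: w_def w'_def)
  also have "\<dots> = 1 - ?d * (L + 1 / L) + ?d * ?d" using Ln by (simp add: field_simps)
  also have "\<dots> = ?c * (- real_of_int (A$1$2))"
    unfolding Lt t_def using d by (simp add: algebra_simps)
  finally have 5: "?c * (w * w') = - real_of_int (A$1$2)" using c by (simp only: mult_cancel_left) simp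
  show ?thesis by (rule that[of w w']) (use 1 2 3 4 5 in auto)
qed

lemma quadratic_coeffs_from_roots:
  fixes a b c w w' :: real
  assumes "a * w\<^sup>2 + b * w + c = 0" "a * w'\<^sup>2 + b * w' + c = 0" "w \<noteq> w'"
  shows "b = - a * (w + w')" "c = a * (w * w')"
proof -
  have "(w - w') * (a * (w + w') + b) = 0" using assms by algebra
  with assms(3) show b: "b = - a * (w + w')" by simp
  show "c = a * (w * w')" using assms(1) unfolding b by algebra
qed

lemma Gcd3_mult_left: "Gcd {k * a, k * b, k * c} = \<bar>k\<bar> * Gcd {a, b, c :: int}"
proof -
  have "gcd (k * b) (k * c) = \<bar>k * gcd b c\<bar>"
    by (simp add: gcd_mult_distrib_int[symmetric] abs_mult)
  then have "gcd (k * a) (gcd (k * b) (k * c)) = gcd (k * a) (k * gcd b c)"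
    by (simp only: gcd_abs2_int)
  also have "\<dots> = \<bar>k\<bar> * gcd a (gcd b c)" by (rule gcd_mult_distrib_int[symmetric])
  finally show ?thesis by simp
qed

lemma primitive_form_dvd:
  assumes "Gcd {a', b', c'} = 1" "b * a' = b' * a" "c * a' = c' * (a::int)"
  shows "a' dvd a"
proof -
  have "a' dvd a * a'" "a' dvd a * b'" "a' dvd a * c'"
    using assms(2,3) by (simp, metis dvd_triv_right mult.commute, metis dvd_triv_right mult.commute)
  then have "a' dvd Gcd {a * a', a * b', a * c'}" by (auto intro: Gcd_greatest)
  then show ?thesis unfolding Gcd3_mult_left assms(1) by simp
qed

lemma ex1_form_of:
  assumes "hyperbolic A"
  shows "\<exists>!Q. is_form_of A Q"
proof -
  obtain w w' where w: "w \<noteq> w'"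
    "\<And>x. repelling_fixed_point A x \<longleftrightarrow> x = w" "\<And>x. attracting_fixed_point A x \<longleftrightarrow> x = w'"
    "of_int (A$2$1) * (w + w') = real_of_int (A$1$1 - A$2$2)"
    "of_int (A$2$1) * (w * w') = - real_of_int (A$1$2)"
    by (rule hyperbolic_fixed_points[OF assms]) blast
  have iff: "is_form_of A (a, b, c) \<longleftrightarrow> Gcd {a, b, c} = 1 \<and> b\<^sup>2 - 4 * a * c > 0 \<and>
     of_int a * w\<^sup>2 + of_int b * w + of_int c = 0 \<and> of_int a * w'\<^sup>2 + of_int b * w' + of_int c = 0 \<and>
     sgn (of_int a) = sgn (w - w')" for a b c
    by (simp add: is_form_of_def w(2,3))
  have c: "A$2$1 \<noteq> 0" by (rule hyperbolic_lower_left_nonzero[OF assms])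
  show ?thesis
  proof (rule ex_ex1I)
    let ?g = "Gcd {A$2$1, A$2$2 - A$1$1, - A$1$2}"
    define k where "k = (if sgn (of_int (A$2$1)) = sgn (w - w') then ?g else - ?g)"
    have g: "?g > 0" using c by (simp add: gcd_pos_int)
    have kabs: "\<bar>k\<bar> = ?g" using g by (auto simp: k_def)
    have "k dvd A$2$1" "k dvd A$2$2 - A$1$1" "k dvd - A$1$2"
      by (auto simp: k_def intro: Gcd_dvd simp del: dvd_minus_iff Gcd_insert)
    then obtain a b e where abe: "A$2$1 = k * a" "A$2$2 - A$1$1 = k * b" "- A$1$2 = k * e"
      by (metis dvdE)
    have k: "k \<noteq> 0" using kabs g by auto
    have "?g = \<bar>k\<bar> * Gcd {a, b, e}" unfolding abe by (rule Gcd3_mult_left)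
    then have prim: "Gcd {a, b, e} = 1" using kabs k c by simp
    have ra: "of_int a * (w + w') = - real_of_int b"
    proof -
      have "of_int k * (of_int a * (w + w')) = of_int k * (- real_of_int b)"
        using w(4) abe by (metis minus_diff_eq minus_mult_right mult.assoc of_int_minus of_int_mult)
      then show ?thesis using k by (simp only: mult_cancel_left of_int_eq_0_iff) simp
    qed
    have re: "of_int a * (w * w') = real_of_int e"
    proof -
      have "of_int k * (of_int a * (w * w')) = of_int k * real_of_int e"
        using w(5) abe by (metis mult.assoc of_int_minus of_int_mult)
      then show ?thesis using k by simp
    qed
    have a0: "a \<noteq> 0" using c abe by auto
    have "real_of_int (b\<^sup>2 - 4 * a * e) = (of_int a * (w - w'))\<^sup>2"
      using ra re by (simp add: power2_eq_square) algebra
    also have "\<dots> > 0" using a0 w(1) by simp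
    finally have disc: "b\<^sup>2 - 4 * a * e > 0" by (simp only: of_int_0_less_iff)
    have "of_int a * w\<^sup>2 + of_int b * w + of_int e = 0" "of_int a * w'\<^sup>2 + of_int b * w' + of_int e = 0"
      using ra re by algebra+
    moreover have "sgn (of_int a) = sgn (w - w')"
    proof -
      have "sgn (real_of_int (A$2$1)) = sgn (of_int k) * sgn (of_int a)"
        unfolding abe by (simp add: sgn_mult)
      moreover have "sgn (real_of_int k) = (if sgn (real_of_int (A$2$1)) = sgn (w - w') then 1 else -1)"
        using g unfolding k_def by (simp del: Gcd_insert)
      moreover have "sgn (real_of_int (A$2$1)) \<in> {1, -1}" "sgn (w - w') \<in> {1, -1}"
        using c w(1) by (auto simp: sgn_if)
      ultimately show ?thesis by (auto split: if_splits)
    qed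
    ultimately show "\<exists>Q. is_form_of A Q" using iff[of a b e] prim disc by blast
  next
    fix P Q assume PQ: "is_form_of A P" "is_form_of A Q"
    obtain a b e a' b' e' where eq: "P = (a, b, e)" "Q = (a', b', e')" by (metis prod_cases3)
    note 1 = PQ(1)[unfolded eq iff] and 2 = PQ(2)[unfolded eq iff]
    note r1 = quadratic_coeffs_from_roots[of "of_int a" w "of_int b" "of_int e" w']
    note r2 = quadratic_coeffs_from_roots[of "of_int a'" w "of_int b'" "of_int e'" w']
    have "real_of_int (b * a') = of_int (b' * a)" "real_of_int (e * a') = of_int (e' * a)"
      using r1 r2 1 2 w(1) by simp_all
    then have m: "b * a' = b' * a" "e * a' = e' * a" by (simp_all only: of_int_eq_iff)
    have "a' dvd a" "a dvd a'"
      using primitive_form_dvd[of a' b' e' b a e] primitive_form_dvd[of a b e b' a' e'] m 1 2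
      by simp_all
    then have "\<bar>a\<bar> = \<bar>a'\<bar>" using zdvd_antisym_abs by blast
    moreover have "sgn (real_of_int a) = sgn (of_int a')" using 1 2 by simp
    moreover have a0: "a \<noteq> 0" using 1 w(1) by (auto simp: sgn_zero_iff)
    ultimately have "a = a'" by (auto simp: sgn_if split: if_splits)
    then show "P = Q" using m a0 eq by simp
  qed
qed

lemma is_form_of_form_of: "hyperbolic A \<Longrightarrow> is_form_of A (form_of A)"
  unfolding form_of_def by (rule theI') (rule ex1_form_of)

lemma form_of_coeffs:
  assumes "hyperbolic A" "form_of A = (a, b, c)"
  shows "A$2$1 * b = a * (A$2$2 - A$1$1)" "A$2$1 * c = - a * A$1$2" "b\<^sup>2 - 4 * a * c > 0" "a \<noteq> 0"
proof -
  obtain w w' where w: "w \<noteq> w'"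
    "\<And>x. repelling_fixed_point A x \<longleftrightarrow> x = w" "\<And>x. attracting_fixed_point A x \<longleftrightarrow> x = w'"
    "of_int (A$2$1) * (w + w') = real_of_int (A$1$1 - A$2$2)"
    "of_int (A$2$1) * (w * w') = - real_of_int (A$1$2)"
    by (rule hyperbolic_fixed_points[OF assms(1)]) blast
  have Q: "b\<^sup>2 - 4 * a * c > 0"
     "of_int a * w\<^sup>2 + of_int b * w + of_int c = 0" "of_int a * w'\<^sup>2 + of_int b * w' + of_int c = 0"
     "sgn (of_int a) = sgn (w - w')"
    using is_form_of_form_of[OF assms(1)] unfolding assms(2) by (simp_all add: is_form_of_def w(2,3))
  note r = quadratic_coeffs_from_roots[OF Q(2,3) w(1)]
  have "real_of_int (A$2$1 * b) = - of_int a * (of_int (A$2$1) * (w + w'))"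
    using r(1) by simp
  also have "\<dots> = of_int (a * (A$2$2 - A$1$1))" unfolding w(4) by (simp add: algebra_simps)
  finally show "A$2$1 * b = a * (A$2$2 - A$1$1)" by (simp only: of_int_eq_iff)
  have "real_of_int (A$2$1 * c) = of_int a * (of_int (A$2$1) * (w * w'))"
    using r(2) by simp
  also have "\<dots> = of_int (- a * A$1$2)" unfolding w(5) by simp
  finally show "A$2$1 * c = - a * A$1$2" by (simp only: of_int_eq_iff)
  show "b\<^sup>2 - 4 * a * c > 0" "a \<noteq> 0" using Q w(1) by (auto simp: sgn_zero_iff)
qed

lemma moebius_denominator_nonzero:
  fixes A :: "int^2^2"
  assumes "det A = 1" "\<tau> \<in> upper_half_plane"
  shows "of_int (A$2$1) * \<tau> + of_int (A$2$2) \<noteq> (0::complex)"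
proof
  assume 0: "of_int (A$2$1) * \<tau> + of_int (A$2$2) = (0::complex)"
  then have "Im (of_int (A$2$1) * \<tau> + of_int (A$2$2)) = 0" by simp
  then have "A$2$1 = 0" using assms(2) by (simp add: upper_half_plane_def)
  with 0 have "A$2$2 = 0" by simp
  with \<open>A$2$1 = 0\<close> assms(1) show False by (simp add: det_2)
qed

lemma moebius_in_upper_half_plane:
  assumes "det A = 1" "\<tau> \<in> upper_half_plane"
  shows "moebius_map A \<tau> \<in> upper_half_plane"
proof -
  let ?d = "of_int (A$2$1) * \<tau> + of_int (A$2$2) :: complex"
  have d: "real_of_int (A$1$1) * real_of_int (A$2$2) - real_of_int (A$1$2) * real_of_int (A$2$1) = 1"
    by (rule det_2_of_int[OF assms(1)])
  have pos: "(Re ?d)\<^sup>2 + (Im ?d)\<^sup>2 > 0"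
    using moebius_denominator_nonzero[OF assms] complex_neq_0 by blast
  have "Im (moebius_map A \<tau>) = Im \<tau> * (real_of_int (A$1$1) * real_of_int (A$2$2) -
          real_of_int (A$1$2) * real_of_int (A$2$1)) / ((Re ?d)\<^sup>2 + (Im ?d)\<^sup>2)"
    by (simp add: moebius_map_def Im_divide algebra_simps)
  then show ?thesis using pos assms(2) by (simp add: d upper_half_plane_def)
qed

lemma eval_form_of_nonzero:
  assumes "hyperbolic A" "\<tau> \<in> upper_half_plane"
  shows "eval_form (form_of A) \<tau> 1 \<noteq> 0"
proof -
  obtain a b c where Q: "form_of A = (a, b, c)" by (metis prod_cases3)
  note q = form_of_coeffs[OF assms(1) Q]
  show ?thesis
  proof
    assume "eval_form (form_of A) \<tau> 1 = 0"
    then have 0: "of_int a * \<tau>\<^sup>2 + of_int b * \<tau> + of_int c = 0" by (simp add: Q)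
    have im: "Im \<tau> > 0" using assms(2) by (simp add: upper_half_plane_def)
    have "Im (of_int a * \<tau>\<^sup>2 + of_int b * \<tau> + of_int c) = Im \<tau> * (2 * of_int a * Re \<tau> + of_int b)"
      by (simp add: power2_eq_square algebra_simps)
    with 0 im have 1: "2 * of_int a * Re \<tau> + of_int b = 0" by simp
    have "Re (of_int a * \<tau>\<^sup>2 + of_int b * \<tau> + of_int c) =
        of_int a * ((Re \<tau>)\<^sup>2 - (Im \<tau>)\<^sup>2) + of_int b * Re \<tau> + of_int c"
      by (simp add: power2_eq_square algebra_simps)
    with 0 have 2: "of_int a * ((Re \<tau>)\<^sup>2 - (Im \<tau>)\<^sup>2) + of_int b * Re \<tau> + of_int c = 0" by simp
    have "real_of_int (b\<^sup>2 - 4 * a * c) = - (2 * of_int a * Im \<tau>)\<^sup>2"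
      using 1 2 by (simp add: power2_eq_square) algebra
    also have "\<dots> \<le> 0" by simp
    finally show False using q(3) by linarith
  qed
qed

lemma cycle_integrand_holomorphic:
  assumes "hyperbolic A" "f holomorphic_on upper_half_plane"
  shows "cycle_integrand f A holomorphic_on upper_half_plane"
proof -
  obtain a b c where Q: "form_of A = (a, b, c)" by (metis prod_cases3)
  show ?thesis
    unfolding cycle_integrand_def [abs_def]
    by (intro holomorphic_intros assms(2) eval_form_of_nonzero[OF assms(1)])
      (auto simp: Q intro!: holomorphic_intros)
qed

lemma cycle_integrand_moebius:
  assumes "hyperbolic A" "\<tau> \<in> upper_half_plane" "f (moebius_map A \<tau>) = f \<tau>"
  shows "cycle_integrand f A (moebius_map A \<tau>) / (of_int (A$2$1) * \<tau> + of_int (A$2$2))\<^sup>2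
           = cycle_integrand f A \<tau>"
proof -
  obtain a b c where Q: "form_of A = (a, b, c)" by (metis prod_cases3)
  note q = form_of_coeffs[OF assms(1) Q]
  have det: "det A = 1" using assms(1) by (simp add: hyperbolic_def)
  define \<alpha> \<beta> \<gamma> \<delta> :: complex where "\<alpha> = of_int (A$1$1)" and "\<beta> = of_int (A$1$2)"
    and "\<gamma> = of_int (A$2$1)" and "\<delta> = of_int (A$2$2)"
  let ?d = "\<gamma> * \<tau> + \<delta>" and ?n = "\<alpha> * \<tau> + \<beta>"
  have d: "\<alpha> * \<delta> - \<beta> * \<gamma> = 1"
    unfolding \<alpha>_def \<beta>_def \<gamma>_def \<delta>_def by (rule det_2_of_int[OF det])
  have b: "\<gamma> * of_int b = of_int a * (\<delta> - \<alpha>)" and c: "\<gamma> * of_int c = - of_int a * \<beta>"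
    using q(1,2) unfolding \<alpha>_def \<beta>_def \<gamma>_def \<delta>_def
    by (metis of_int_diff of_int_mult, metis of_int_minus of_int_mult)
  have \<gamma>: "\<gamma> \<noteq> 0" using hyperbolic_lower_left_nonzero[OF assms(1)] by (simp add: \<gamma>_def)
  have dn: "?d \<noteq> 0" using moebius_denominator_nonzero[OF det assms(2)] by (simp add: \<gamma>_def \<delta>_def)
  have m: "moebius_map A \<tau> = ?n / ?d" by (simp add: moebius_map_def \<alpha>_def \<beta>_def \<gamma>_def \<delta>_def)
  have "\<gamma> * (of_int a * ?n\<^sup>2 + of_int b * ?n * ?d + of_int c * ?d\<^sup>2) =
        of_int a * (\<gamma> * ?n\<^sup>2 + (\<delta> - \<alpha>) * ?n * ?d - \<beta> * ?d\<^sup>2)"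
    using b c by algebra
  also have "\<dots> = of_int a * ((\<alpha> * \<delta> - \<beta> * \<gamma>) * (\<gamma> * \<tau>\<^sup>2 + (\<delta> - \<alpha>) * \<tau> - \<beta>))" by algebra
  also have "\<dots> = \<gamma> * (of_int a * \<tau>\<^sup>2 + of_int b * \<tau> + of_int c)"
    unfolding d using b c by algebra
  finally have e: "of_int a * ?n\<^sup>2 + of_int b * ?n * ?d + of_int c * ?d\<^sup>2 =
      of_int a * \<tau>\<^sup>2 + of_int b * \<tau> + of_int c" using \<gamma> by simp
  have "eval_form (form_of A) (moebius_map A \<tau>) 1 * ?d\<^sup>2 = eval_form (form_of A) \<tau> 1"
  proof -
    have "(of_int a * (n / d)\<^sup>2 + of_int b * (n / d) * 1 + of_int c * 1\<^sup>2) * d\<^sup>2 =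
        of_int a * n\<^sup>2 + of_int b * n * d + of_int c * d\<^sup>2" if "d \<noteq> 0" for n d :: complex
      using that by (simp add: field_simps power2_eq_square)
    from this[OF dn, of ?n] show ?thesis by (simp add: Q m e)
  qed
  then show ?thesis
    unfolding cycle_integrand_def assms(3) \<gamma>_def[symmetric] \<delta>_def[symmetric] by simp
qed

lemma cycle_integral_base_point:
  assumes "hyperbolic A" "weakly_holomorphic_modular_function f" "\<tau> \<in> upper_half_plane"
  shows "cycle_integral f A = contour_integral (linepath \<tau> (moebius_map A \<tau>)) (cycle_integrand f A)"
proof -
  let ?F = "cycle_integrand f A" and ?H = upper_half_plane
  have det: "det A = 1" using assms(1) by (simp add: hyperbolic_def)
  have cvx: "convex ?H" and opn: "open ?H"
    unfolding upper_half_plane_def by (auto simp: convex_halfspace_Im_gt open_halfspace_Im_gt)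
  have F: "?F holomorphic_on ?H"
    using assms by (intro cycle_integrand_holomorphic) (auto simp: weakly_holomorphic_modular_function_def)
  obtain G where G: "\<And>x. x \<in> ?H \<Longrightarrow> (G has_field_derivative ?F x) (at x)"
    using holomorphic_convex_primitive'[OF cvx opn F] opn by (metis at_within_open)
  have int: "contour_integral (linepath x y) ?F = G y - G x" if "x \<in> ?H" "y \<in> ?H" for x y
  proof -
    have "closed_segment x y \<subseteq> ?H" using that cvx by (simp add: closed_segment_subset)
    then have "(?F has_contour_integral (G (pathfinish (linepath x y)) - G (pathstart (linepath x y)))) (linepath x y)"
      by (intro contour_integral_primitive[of ?H])
        (auto intro: G has_field_derivative_at_within)
    then show ?thesis by (simp add: contour_integral_unique)
  qed
  have inH: "moebius_map A x \<in> ?H" if "x \<in> ?H" for x :: complex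
    using moebius_in_upper_half_plane[OF det that] .
  have "((\<lambda>x. G (moebius_map A x) - G x) has_field_derivative 0) (at x within ?H)" if x: "x \<in> ?H" for x
  proof -
    have "f (moebius_map A x) = f x"
      using assms(2) det x by (auto simp: weakly_holomorphic_modular_function_def)
    from cycle_integrand_moebius[OF assms(1) x this]
    have e: "?F (moebius_map A x) * (1 / (of_int (A$2$1) * x + of_int (A$2$2))\<^sup>2) = ?F x" by simp
    have "((\<lambda>x. G (moebius_map A x)) has_field_derivative ?F x) (at x)"
      using DERIV_chain2[OF G[OF inH[OF x]]
          moebius_map_has_field_derivative[OF det moebius_denominator_nonzero[OF det x]]] e by simp
    from DERIV_diff[OF this G[OF x]] show ?thesis by (simp add: has_field_derivative_at_within)
  qed
  from has_field_derivative_zero_constant[OF cvx this]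
  obtain k where k: "\<And>x. x \<in> ?H \<Longrightarrow> G (moebius_map A x) - G x = k" by blast
  have "\<i> \<in> ?H" by (simp add: upper_half_plane_def)
  then show ?thesis
    unfolding cycle_integral_def using int inH k assms(3) by simp
qed

lemma cf_convergent_const_tendsto:
  fixes m :: nat and x :: real
  assumes "m \<ge> 1" "x > 1" "x = m + 1 / x"
  shows "cf_convergent (\<lambda>_. m) \<longlonglongrightarrow> x"
proof -
  have ge: "cf_convergent (\<lambda>_. m) n \<ge> 1" for n
  proof (induction n)
    case (Suc n)
    then show ?case using assms(1) by (simp add: add_increasing2)
  qed (use assms in auto)
  have bd: "\<bar>cf_convergent (\<lambda>_. m) n - x\<bar> \<le> \<bar>m - x\<bar> * (1 / x) ^ n" for n
  proof (induction n)
    case (Suc n)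
    let ?y = "cf_convergent (\<lambda>_. m) n"
    have "cf_convergent (\<lambda>_. m) (Suc n) - x = 1 / ?y - 1 / x" using assms(3) by simp
    also have "\<dots> = (x - ?y) / (?y * x)" using ge[of n] assms(2) by (simp add: field_simps)
    finally have "\<bar>cf_convergent (\<lambda>_. m) (Suc n) - x\<bar> = \<bar>?y - x\<bar> / (?y * x)"
      using ge[of n] assms(2) by (simp add: abs_mult abs_minus_commute)
    also have "\<dots> \<le> \<bar>?y - x\<bar> / x"
      using ge[of n] assms(2) by (intro divide_left_mono) auto
    also have "\<dots> \<le> \<bar>m - x\<bar> * (1 / x) ^ n / x"
      using Suc assms(2) by (intro divide_right_mono) auto
    finally show ?case by simp
  qed simp
  have "(\<lambda>n. \<bar>m - x\<bar> * (1 / x) ^ n) \<longlonglongrightarrow> 0"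
    using assms(2) by (intro tendsto_mult_right_zero LIMSEQ_power_zero) simp
  then have "(\<lambda>n. cf_convergent (\<lambda>_. m) n - x) \<longlonglongrightarrow> 0"
    by (rule Lim_null_comparison[rotated]) (use bd in auto)
  then show ?thesis by (simp add: LIM_zero_iff)
qed

lemma periodic_cf_phi: "periodic_cf [1, 1] = (1 + sqrt 5) / 2"
proof -
  have per: "(\<lambda>k. [1, 1] ! (k mod length [1, 1 :: nat])) = (\<lambda>_. 1 :: nat)"
    by (rule ext) (simp add: nth_Cons')
  have "1 + sqrt 5 \<noteq> 0" by (smt (verit) real_sqrt_ge_zero)
  then have "(1 + sqrt 5) / 2 = real 1 + 1 / ((1 + sqrt 5) / 2)"
    by (simp add: field_simps)
  then have "cf_convergent (\<lambda>_. 1) \<longlonglongrightarrow> (1 + sqrt 5) / 2"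
    by (intro cf_convergent_const_tendsto) simp_all
  then show ?thesis unfolding periodic_cf_def per by (rule limI)
qed

lemma periodic_cf_psi: "periodic_cf [2, 2] = 1 + sqrt 2"
proof -
  have per: "(\<lambda>k. [2, 2] ! (k mod length [2, 2 :: nat])) = (\<lambda>_. 2 :: nat)"
    by (rule ext) (auto simp: nth_Cons')
  have "1 + sqrt 2 \<noteq> 0" by (smt (verit) real_sqrt_ge_zero)
  then have "1 + sqrt 2 = real 2 + 1 / (1 + sqrt 2)"
    by (simp add: field_simps)
  then have "cf_convergent (\<lambda>_. 2) \<longlonglongrightarrow> 1 + sqrt 2"
    by (intro cf_convergent_const_tendsto) simp_all
  then show ?thesis unfolding periodic_cf_def per by (rule limI)
qed

end

theory Submission
  imports Defs
begin

text \<open>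
  For a hyperbolic matrix with fixed points \<open>p\<close>, \<open>q\<close> the ratio of cycle integrals is the mean value of
  \<open>f\<close> along the geodesic from \<open>p\<close> to \<open>q\<close>, so it does not depend on the matrix. A Markov irrationality
  is fixed by a product of the blocks \<open>RL\<close> and \<open>RRLL\<close>, where \<open>R\<close> is \<open>\<tau> \<mapsto> \<tau> + 1\<close> and \<open>L\<close> is
  \<open>\<tau> \<mapsto> \<tau> / (\<tau> + 1)\<close>. Both maps send the arc from \<open>e\<^bsup>2\<pi>i/3\<^esup>\<close> to \<open>e\<^bsup>\<pi>i/3\<^esup>\<close> to an arc that starts where
  it ends; deforming the geodesic to the translates of this arc and folding the arc at \<open>i\<close> shows that the
  real part of the value is the mean of \<open>f(e\<^bsup>it\<^esup>)\<close> over \<open>[\<pi>/3, \<pi>/2]\<close> with respect to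
  \<open>2 sin t \<Sum> u / (u\<^sup>2 - 4 cos\<^sup>2 t)\<close>, where \<open>u = x + 1/x\<close> and \<open>x\<close> runs through the forward and backward
  continued fraction tails that the word produces.

  It remains to show that the quotient of the weight of a word by the weight of \<open>\<phi>\<close>, and the quotient of
  the weight of \<open>\<psi>\<close> by that of a word, increase with \<open>t\<close>. The sign of the difference of such a quotient at two
  points is a sum over the blocks of the word, and each block contributes at most \<open>c (y - F y)\<close>, where \<open>y\<close> is
  the tail after the block, \<open>F y\<close> the tail including it, and \<open>c\<close> a constant. Over a period these bounds
  telescope to zero. The tails stay in \<open>[\<phi>, \<psi>]\<close>, the two bounds are attained only at \<open>\<phi>\<close> and at \<open>\<psi>\<close>,
  respectively, and the choices \<open>c = 4\<close> and \<open>c = -12\<close> leave enough room for crude estimates elsewhere.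
\<close>

section \<open>Weights of words\<close>

text \<open>The tail \<open>[a; a, x]\<close>: prefixing \<open>x\<close> by one block of the word.\<close>

definition cf_block :: "nat \<Rightarrow> real \<Rightarrow> real" where
  "cf_block a x = real a + 1 / (real a + 1 / x)"

text \<open>The arguments are the numbers met when two partial quotients \<open>a\<close>,
  \<open>a\<close> are prefixed to \<open>x\<close> one unit at a time, as in the additive continued
  fraction algorithm. Each unit corresponds to one of the maps R and L, hence to one translate of
  the arc.\<close>

definition block_sum :: "(real \<Rightarrow> real) \<Rightarrow> nat \<Rightarrow> real \<Rightarrow> real" where
  "block_sum g a x = (\<Sum>j = 1..a. g (real j + 1 / x) + g (real j + 1 / (real a + 1 / x)))"

text \<open>The first summand belongs to the tail read forwards, starting from \<open>x\<close> at the end of the word, the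
  second to the tail read backwards, starting from \<open>z\<close> in front of it.\<close>

fun path_sum :: "(real \<Rightarrow> real) \<Rightarrow> nat list \<Rightarrow> real \<Rightarrow> real \<Rightarrow> real" where
  "path_sum g [] x z = 0"
| "path_sum g (a # bs) x z =
     block_sum g a (foldr cf_block bs x) + block_sum g a z + path_sum g bs x (cf_block a z)"

section \<open>The interval of continued fraction tails and telescoping over a word\<close>

definition golden :: real where "golden = (1 + sqrt 5) / 2"
definition silver :: real where "silver = 1 + sqrt 2"

lemma sqrt2_bounds: "(7071 / 5000) < sqrt 2" "sqrt 2 < (14143 / 10000)"
  by (rule real_less_rsqrt, simp add: power2_eq_square, rule real_less_lsqrt, simp_all add: power2_eq_square)

lemma golden_bounds: "(809 / 500) < golden" "golden < (16181 / 10000)"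
proof -
  have "(559 / 250) < sqrt 5" by (rule real_less_rsqrt) (simp add: power2_eq_square)
  moreover have "sqrt 5 < (11181 / 5000)" by (rule real_less_lsqrt) (simp_all add: power2_eq_square)
  ultimately show "(809 / 500) < golden" "golden < (16181 / 10000)" by (simp_all add: golden_def)
qed

lemma golden_sq: "golden\<^sup>2 = golden + 1"
  by (simp add: golden_def power2_eq_square field_simps)

lemma silver_sq: "silver\<^sup>2 = 2 * silver + 1"
  by (simp add: silver_def power2_eq_square algebra_simps)

lemma silver_bounds: "(12071 / 5000) < silver" "silver < (24143 / 10000)"
  using sqrt2_bounds by (simp_all add: silver_def)

lemma golden_inverse: "1 / golden = golden - 1"
  unfolding divide_eq_eq using golden_sq golden_bounds by (auto simp: power2_eq_square algebra_simps)

lemma silver_inverse: "1 / silver = silver - 2"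
  unfolding divide_eq_eq using silver_sq silver_bounds by (auto simp: power2_eq_square algebra_simps)

lemma block_sum_1: "block_sum g (Suc 0) x = g (1 + 1 / x) + g (cf_block 1 x)"
  by (simp add: block_sum_def cf_block_def)

lemma block_sum_2:
  "block_sum g 2 x = g (1 + 1 / x) + g (2 + 1 / x) + g (1 + 1 / (2 + 1 / x)) + g (cf_block 2 x)"
  by (simp add: block_sum_def cf_block_def numeral_2_eq_2)

lemma cf_block_mono:
  assumes "0 < x" "x \<le> y"
  shows "cf_block a x \<le> cf_block a y"
proof (cases "a = 0")
  case True then show ?thesis using assms by (simp add: cf_block_def)
next
  case False
  have "1 / y \<le> 1 / x" using assms by (simp add: frac_le)
  moreover have "0 < 1 / y" using assms by simp
  ultimately have "1 / (real a + 1 / x) \<le> 1 / (real a + 1 / y)"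
    using assms by (intro divide_left_mono mult_pos_pos add_nonneg_pos) auto
  then show ?thesis by (simp add: cf_block_def)
qed

lemma cf_block_golden: "cf_block 1 golden = golden"
  using golden_inverse by (simp add: cf_block_def)

lemma cf_block_silver: "cf_block 2 silver = silver"
  using silver_inverse by (simp add: cf_block_def)

text \<open>Each \<open>cf_block a\<close> is monotone, \<open>cf_block 1\<close> fixes
  \<open>golden\<close>, \<open>cf_block 2\<close> fixes \<open>silver\<close>, and
  \<open>cf_block 1\<close> lies pointwise below \<open>cf_block 2\<close>. So both maps preserve
  the interval between the two fixed points.\<close>

lemma cf_block_range:
  assumes "a \<in> {1, 2}" "golden \<le> x" "x \<le> silver"
  shows "golden \<le> cf_block a x" "cf_block a x \<le> silver"
proof -
  have x: "0 < x" using assms golden_bounds by linarith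
  have less: "cf_block 1 y \<le> cf_block 2 y" if "y > 0" for y
  proof -
    have "1 / (1 + 1 / y) \<le> 1" using that by (simp add: field_simps)
    moreover have "0 \<le> 1 / (2 + 1 / y)" using that by simp
    ultimately show ?thesis unfolding cf_block_def of_nat_1 of_nat_numeral by linarith
  qed
  have "golden \<le> cf_block 1 x"
    using cf_block_mono[of golden x 1] assms golden_bounds cf_block_golden by simp
  with less[OF x] assms(1) show "golden \<le> cf_block a x" by auto
  have "cf_block 2 x \<le> silver"
    using cf_block_mono[of x silver 2] assms x cf_block_silver by simp
  with less[OF x] assms(1) show "cf_block a x \<le> silver" by auto
qed

lemma foldr_cf_block_range:
  assumes "set bs \<subseteq> {1, 2}" "golden \<le> x" "x \<le> silver"
  shows "golden \<le> foldr cf_block bs x \<and> foldr cf_block bs x \<le> silver"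
  using assms by (induction bs) (auto intro!: cf_block_range)

text \<open>The forward tails run from \<open>x\<close> to \<open>foldr cf_block bs x\<close> and
  the backward tails from \<open>z\<close> to \<open>fold cf_block bs z\<close>, so the block bounds
  telescope along both. If \<open>x\<close> and \<open>z\<close> are fixed by the word, the
  right-hand side is zero.\<close>

lemma path_sum_telescope:
  assumes ineq: "\<And>a y. a \<in> {1, 2} \<Longrightarrow> golden \<le> y \<Longrightarrow> y \<le> silver \<Longrightarrow> block_sum g a y \<le> c * (y - cf_block a y)"
    and "set bs \<subseteq> {1, 2}" "golden \<le> x" "x \<le> silver" "golden \<le> z" "z \<le> silver"
  shows "path_sum g bs x z \<le> c * (x - foldr cf_block bs x) + c * (z - fold cf_block bs z)"
  using assms(2-)
proof (induction bs arbitrary: z)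
  case (Cons a bs)
  let ?y = "foldr cf_block bs x"
  have a: "a \<in> {1, 2}" and bs: "set bs \<subseteq> {1, 2}" using Cons.prems by auto
  have y: "golden \<le> ?y" "?y \<le> silver" using foldr_cf_block_range[OF bs] Cons.prems by auto
  have "path_sum g bs x (cf_block a z) \<le>
      c * (x - ?y) + c * (cf_block a z - fold cf_block bs (cf_block a z))"
    by (intro Cons.IH bs Cons.prems cf_block_range[OF a])
  moreover have "block_sum g a ?y \<le> c * (?y - cf_block a ?y)" by (rule ineq[OF a y])
  moreover have "block_sum g a z \<le> c * (z - cf_block a z)" using ineq[OF a] Cons.prems by blast
  ultimately show ?case by (simp add: algebra_simps)
qed simp

lemma block_sum_linear:
  "block_sum (\<lambda>x. c * g x + d * h x) a x = c * block_sum g a x + d * block_sum h a x"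
  unfolding block_sum_def sum_distrib_left sum.distrib[symmetric] by (simp add: algebra_simps)

text \<open>The case \<open>d = 0\<close> is homogeneity; this accounts for summands such as
  \<open>0 * q v\<close> in later applications.\<close>

lemma path_sum_linear:
  "path_sum (\<lambda>x. c * g x + d * h x) bs x z = c * path_sum g bs x z + d * path_sum h bs x z"
  by (induction bs arbitrary: z) (simp_all add: block_sum_linear algebra_simps)

lemma block_sum_mono:
  assumes "a > 0" "x > 0" "\<And>y. y > 1 \<Longrightarrow> g y \<le> h y"
  shows "block_sum g a x \<le> block_sum h a x"
  unfolding block_sum_def
proof (intro sum_mono add_mono assms(3))
  fix j assume "j \<in> {1..a}"
  then have "real j \<ge> 1" by simp
  moreover have "1 / x > 0" "1 / (real a + 1 / x) > 0" using assms by (auto intro: add_pos_pos)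
  ultimately show "real j + 1 / x > 1" "real j + 1 / (real a + 1 / x) > 1" by linarith+
qed

section \<open>The kernel and the block estimate against the golden ratio\<close>

definition kern :: "real \<Rightarrow> real \<Rightarrow> real" where
  "kern s x = (x + 1 / x) / ((x + 1 / x)\<^sup>2 - s)"

lemma add_inverse_mono:
  fixes x y :: real
  assumes "1 \<le> x" "x \<le> y"
  shows "x + 1 / x \<le> y + 1 / y"
proof -
  have "y + 1 / y - (x + 1 / x) = (y - x) * (x * y - 1) / (x * y)"
    using assms by (simp add: field_simps)
  moreover have "x * y \<ge> 1" using assms mult_mono[of 1 x 1 y] by simp
  ultimately have "y + 1 / y - (x + 1 / x) \<ge> 0" using assms by simp
  then show ?thesis by simp
qed

lemma add_inverse_ge_2: "(x::real) \<ge> 1 \<Longrightarrow> x + 1 / x \<ge> 2"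
  using add_inverse_mono[of 1 x] by simp

lemma kern_inverse: "kern s (1 / x) = kern s x"
  by (simp add: kern_def add.commute)

lemma kern_pos:
  assumes "x \<ge> 1" "s \<le> 1"
  shows "kern s x > 0"
proof -
  have u: "x + 1 / x \<ge> 2" by (rule add_inverse_ge_2[OF assms(1)])
  then have "(x + 1 / x)\<^sup>2 \<ge> 2\<^sup>2" by (intro power_mono) auto
  then show ?thesis using u assms unfolding kern_def by (intro divide_pos_pos) auto
qed

text \<open>The value at \<open>s = s' = 1\<close> of the expression bounded in \<open>low_ratio_bound\<close>. For \<open>u\<^sup>2 < 5\<close> the quotient
  \<open>(5 - s) / (u\<^sup>2 - s)\<close> increases and for \<open>u\<^sup>2 > 5\<close> it decreases in \<open>s\<close>, so this is the worst case for both signs of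
  \<open>5 - u\<^sup>2\<close>.\<close>

definition qlow :: "real \<Rightarrow> real" where
  "qlow u = 16 * u * (5 - u\<^sup>2) / (u\<^sup>2 - 1)\<^sup>2"

lemma low_ratio_bound:
  fixes u s s' :: real
  assumes u: "u \<ge> 2" and s: "0 \<le> s" "s \<le> 1" "0 \<le> s'" "s' \<le> 1"
  shows "u * (5 - u\<^sup>2) * ((5 - s) * (5 - s') / ((u\<^sup>2 - s) * (u\<^sup>2 - s'))) \<le> qlow u"
proof -
  have u2: "u\<^sup>2 \<ge> 4" using power_mono[of 2 u 2] u by simp
  define r where "r = (\<lambda>s. (5 - s) / (u\<^sup>2 - s))"
  have q: "qlow u = u * (5 - u\<^sup>2) * (r 1 * r 1)"
    by (simp add: qlow_def r_def power2_eq_square)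
  have l: "(5 - s) * (5 - s') / ((u\<^sup>2 - s) * (u\<^sup>2 - s')) = r s * r s'" by (simp add: r_def)
  have pos: "r s \<ge> 0" if "s \<le> 1" for s using that u2 by (simp add: r_def)
  have d: "r 1 - r s = (1 - s) * (5 - u\<^sup>2) / ((u\<^sup>2 - 1) * (u\<^sup>2 - s))" if "s \<le> 1" for s
    using that u2 by (simp add: r_def field_simps)
  show ?thesis
  proof (cases "u\<^sup>2 \<le> 5")
    case True
    then have le: "r s \<le> r 1" if "s \<le> 1" for s 
    proof -
      have "r 1 - r s \<ge> 0" unfolding d[OF that] using that True u2
        by (intro divide_nonneg_nonneg mult_nonneg_nonneg) auto
      then show ?thesis by simp
    qed
    have "r s * r s' \<le> r 1 * r 1" using le pos s by (intro mult_mono) auto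
    then show ?thesis unfolding q l using True u by (intro mult_left_mono) auto
  next
    case False
    then have le: "r 1 \<le> r s" if "s \<le> 1" for s
    proof -
      have "(1 - s) * (5 - u\<^sup>2) \<le> 0" using that False by (simp add: mult_nonneg_nonpos)
      then have "r 1 - r s \<le> 0" unfolding d[OF that] using that u2 by (intro divide_nonpos_nonneg) auto
      then show ?thesis by simp
    qed
    have "r 1 * r 1 \<le> r s * r s'" using le pos s by (intro mult_mono) auto
    then show ?thesis unfolding q l using False u
      by (intro mult_left_mono_neg) (auto simp: mult_nonneg_nonpos)
  qed
qed

text \<open>Both sides vanish at \<open>golden\<close>: they share the factor 1 + x - x^2, which
  comes from 5 - u^2 on the left and from \<open>y - cf_block 1 y\<close> on the right. Once it is
  split off, the remaining quotient is at most 4 by crude bounds on x between sqrt 2 and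
  \<open>golden\<close>.\<close>

lemma qlow_first:
  assumes "golden \<le> y" "y \<le> silver"
  defines "x \<equiv> 1 + 1 / y"
  shows "qlow (x + 1 / x) \<le> 4 * (y - cf_block 1 y)"
proof -
  define u where "u = x + 1 / x"
  have y0: "y > 0" using assms golden_bounds by linarith
  have x1: "x > 1" using y0 by (simp add: x_def)
  have "1 / y \<le> 1 / golden" using assms golden_bounds y0 by (intro divide_left_mono) auto
  also note golden_inverse
  finally have xg: "x \<le> golden" by (simp add: x_def)
  have "1 / silver \<le> 1 / y" using assms y0 by (intro divide_left_mono) auto
  then have xs: "x \<ge> silver - 1" unfolding silver_inverse by (simp add: x_def)
  have xb: "x \<ge> (7071 / 5000)" "x \<le> (16181 / 10000)" using xg xs golden_bounds silver_bounds by linarith+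
  have fac: "0 \<le> 1 + x - x\<^sup>2"
  proof -
    have "1 + x - x\<^sup>2 = (golden - x) * (x + golden - 1)"
      using golden_sq by (simp add: power2_eq_square algebra_simps)
    then show ?thesis using xg x1 golden_bounds by (auto intro!: mult_nonneg_nonneg)
  qed
  have Y: "y = 1 / (x - 1)" using y0 by (simp add: x_def)
  have rhs: "y - cf_block 1 y = (1 + x - x\<^sup>2) / (x * (x - 1))"
  proof -
    have "cf_block 1 y = 1 + 1 / x" by (simp add: cf_block_def x_def)
    then show ?thesis unfolding Y using x1 by (simp add: field_simps power2_eq_square)
  qed
  have u5: "5 - u\<^sup>2 = (1 + x - x\<^sup>2) * (x\<^sup>2 + x - 1) / x\<^sup>2"
    unfolding u_def using x1 by (simp add: field_simps power2_eq_square)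
  have ulo: "u \<ge> (53 / 25)" 
    using add_inverse_mono[of "7071 / 5000" x] xb by (simp add: u_def)
  have uhi: "u \<le> (56 / 25)"
    using add_inverse_mono[of x "16181 / 10000"] xb x1 by (simp add: u_def)
  have "u\<^sup>2 \<ge> (53 / 25)\<^sup>2" using ulo by (intro power_mono) auto
  then have "u\<^sup>2 - 1 \<ge> (349 / 100)" by (simp add: power2_eq_square)
  then have u12: "(u\<^sup>2 - 1)\<^sup>2 \<ge> 12" using power_mono[of "(349 / 100)" "u\<^sup>2 - 1" 2] by (simp add: power2_eq_square)
  have c1: "(x\<^sup>2 + x - 1) * (x - 1) \<le> 2 * x * (6181 / 10000)"
    using fac xb by (intro mult_mono) auto
  have c2: "16 * u * ((x\<^sup>2 + x - 1) * (x - 1)) \<le> 16 * (56 / 25) * (2 * x * (6181 / 10000))"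
    by (rule mult_mono[OF _ c1]) (use uhi ulo x1 in \<open>auto intro!: mult_nonneg_nonneg simp: power2_eq_square add_increasing\<close>)
  also have "\<dots> \<le> 4 * x * 12" using x1 by simp
  also have "\<dots> \<le> 4 * x * (u\<^sup>2 - 1)\<^sup>2" using u12 x1 by simp
  finally have c3: "16 * u * ((x\<^sup>2 + x - 1) * (x - 1)) / ((u\<^sup>2 - 1)\<^sup>2 * x) \<le> 4"
    using u12 x1 by (subst pos_divide_le_eq) (auto simp: mult_ac intro!: mult_pos_pos)
  have "qlow u = (16 * u * ((x\<^sup>2 + x - 1) * (x - 1)) / ((u\<^sup>2 - 1)\<^sup>2 * x)) * (y - cf_block 1 y)"
    unfolding qlow_def rhs u5 using x1 by (simp add: power2_eq_square mult_ac)
  also have "\<dots> \<le> 4 * (y - cf_block 1 y)"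
    by (rule mult_right_mono[OF c3]) (unfold rhs, use fac x1 in simp)
  finally show ?thesis by (simp add: u_def)
qed

lemma qlow_nonpos: "u\<^sup>2 \<ge> 5 \<Longrightarrow> u \<ge> 0 \<Longrightarrow> qlow u \<le> 0"
  unfolding qlow_def by (intro divide_nonpos_nonneg) (auto simp: mult_nonneg_nonpos)

lemma qlow_le_low:
  assumes "(21 / 10) \<le> u" shows "qlow u \<le> (7 / 4)"
proof -
  have "u\<^sup>2 \<ge> (21 / 10)\<^sup>2" using assms by (intro power_mono) auto
  then have p: "(u\<^sup>2 - 1)\<^sup>2 > 0" by (simp add: power2_eq_square)
  define d where "d = u - (21 / 10)"
  have d: "d \<ge> 0" "u = d + (21 / 10)" using assms by (auto simp: d_def)
  \<comment> \<open>Expanded at u = 21/10 the polynomial has only nonnegative coefficients.\<close>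
  have "(7 / 4) * (u\<^sup>2 - 1)\<^sup>2 - 16 * u * (5 - u\<^sup>2) \<ge> 0"
    unfolding d(2) using d(1) by (simp add: power2_eq_square algebra_simps)
  then show ?thesis unfolding qlow_def using p by (simp add: pos_divide_le_eq)
qed

lemma qlow_le_high:
  assumes "(14 / 5) \<le> u" "u \<le> (3001 / 1000)" shows "qlow u \<le> - (13 / 5)"
proof -
  have "u\<^sup>2 \<ge> (14 / 5)\<^sup>2" using assms by (intro power_mono) auto
  then have p: "(u\<^sup>2 - 1)\<^sup>2 > 0" by (simp add: power2_eq_square)
  have "(13 / 5) * (u\<^sup>2 - 1)\<^sup>2 \<le> 16 * u * (u\<^sup>2 - 5)"
  proof -
    define d where "d = u - 14 / 5"
    have d: "d \<ge> 0" "d \<le> 201 / 1000" "u = d + 14 / 5" using assms by (auto simp: d_def)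
    \<comment> \<open>Higher powers of \<open>d\<close> are bounded by lower ones through
      \<open>d \<le> 201 / 1000\<close>, which leaves linear arithmetic in the powers.\<close>
    have d2: "d * d \<le> d * (201 / 1000)" using d by (intro mult_left_mono) auto
    have dd: "0 \<le> d * d" "0 \<le> d * (d * d)" using d by auto
    have d3: "d * (d * d) \<le> d * (d * (201 / 1000))" using d d2 by (intro mult_left_mono) auto
    have d4: "d * (d * (d * d)) \<le> d * (d * (d * (201 / 1000)))" using d d3 by (intro mult_left_mono) auto
    show ?thesis unfolding d(3) using d(1) dd d2 d3 d4 by (simp add: power2_eq_square algebra_simps)
  qed
  then show ?thesis unfolding qlow_def using p by (simp add: pos_divide_le_eq algebra_simps)
qed

lemma inverse_range:
  assumes "golden \<le> y" "y \<le> silver"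
  shows "silver - 2 \<le> 1 / y" "1 / y \<le> golden - 1"
proof -
  have y: "0 < y" using assms golden_bounds by linarith
  have "1 / y \<le> 1 / golden" using assms y golden_bounds by (intro divide_left_mono) auto
  then show "1 / y \<le> golden - 1" unfolding golden_inverse .
  have "1 / silver \<le> 1 / y" using assms y by (intro divide_left_mono) auto
  then show "silver - 2 \<le> 1 / y" unfolding silver_inverse .
qed

lemma add_inverse_bounds:
  fixes x l h :: real
  assumes "1 \<le> l" "l \<le> x" "x \<le> h"
  shows "l + 1 / l \<le> x + 1 / x" "x + 1 / x \<le> h + 1 / h"
  using assms by (auto intro!: add_inverse_mono)

text \<open>The first point 1 + 1/y is handled by \<open>qlow_first\<close>. For
  \<open>a = 1\<close> the other point is at least \<open>golden\<close>, so its u satisfies u^2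
  \<ge> 5 and its term is nonpositive. For \<open>a = 2\<close> the other three terms add up to at
  most -69/20, which pays for replacing \<open>cf_block 1 y\<close> by \<open>cf_block 2 y\<close>
  on the right.\<close>

lemma qlow_block:
  assumes a: "a \<in> {1, 2}" and y: "golden \<le> y" "y \<le> silver"
  shows "block_sum (\<lambda>x. qlow (x + 1 / x)) a y \<le> 4 * (y - cf_block a y)"
proof -
  have y0: "0 < y" using y golden_bounds by linarith
  note first = qlow_first[OF y]
  have i: "414 / 1000 \<le> 1 / y" "1 / y \<le> 619 / 1000"
    using inverse_range[OF y] silver_bounds golden_bounds by linarith+
  show ?thesis
  proof (cases "a = 1")
    case True
    let ?x = "cf_block 1 y"
    have g: "golden \<le> ?x" using cf_block_range[of 1 y] y by simp
    have "golden + 1 / golden \<le> ?x + 1 / ?x" using g golden_bounds by (intro add_inverse_mono) auto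
    then have "2 * golden - 1 \<le> ?x + 1 / ?x" unfolding golden_inverse by simp
    then have u: "sqrt 5 \<le> ?x + 1 / ?x" by (simp add: golden_def field_simps)
    then have "(sqrt 5)\<^sup>2 \<le> (?x + 1 / ?x)\<^sup>2" by (intro power_mono) auto
    moreover have "0 \<le> sqrt 5" by simp
    ultimately have "qlow (?x + 1 / ?x) \<le> 0" using u by (intro qlow_nonpos) (simp, linarith)
    then show ?thesis using first True by (simp add: block_sum_1)
  next
    case False
    then have a2: "a = 2" using a by simp
    define p where "p = 1 / (2 + 1 / y)"
    have pl: "p \<ge> 38 / 100" and ph: "p \<le> 415 / 1000"
      unfolding p_def using i by (auto simp: field_simps)
    have h1: "qlow ((2 + 1 / y) + 1 / (2 + 1 / y)) \<le> - (13 / 5)"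
      using add_inverse_bounds[of "24 / 10" "2 + 1 / y" "2619 / 1000"] i by (intro qlow_le_high) auto
    have h2: "qlow (cf_block 2 y + 1 / cf_block 2 y) \<le> - (13 / 5)"
      using add_inverse_bounds[of "238 / 100" "2 + p" "2415 / 1000"] pl ph
      by (intro qlow_le_high) (auto simp: cf_block_def p_def)
    have h3: "qlow ((1 + p) + 1 / (1 + p)) \<le> 7 / 4"
      using add_inverse_bounds[of "138 / 100" "1 + p" "2"] pl ph by (intro qlow_le_low) auto
    \<comment> \<open>With the factor 4 this costs at most 16/5, less than the available
      69/20.\<close>
    have d: "cf_block 2 y - cf_block 1 y \<le> 4 / 5"
    proof -
      have "1 / (1 + 1 / y) \<ge> 617 / 1000" using i by (simp add: field_simps)
      then show ?thesis using ph unfolding cf_block_def p_def by simp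
    qed
    show ?thesis using first h1 h2 h3 d unfolding a2 block_sum_2 p_def by simp
  qed
qed

section \<open>The block estimate against the silver ratio\<close>

text \<open>\<open>qup2\<close> and \<open>qup0\<close> are \<open>qup s s'\<close> at \<open>s = s' = 1\<close> and at \<open>s = s' = 0\<close>. The normalisation of \<open>qup\<close> makes its value
  independent of \<open>s\<close> and \<open>s'\<close> at \<open>u\<^sup>2 = 8\<close> and \<open>u\<^sup>2 = 9/2\<close>, the two values of \<open>u\<close> that occur for \<open>1 + \<surd>2\<close>.\<close>

definition qup2 :: "real \<Rightarrow> real" where
  "qup2 u = 7 * u * (43 - 8 * u\<^sup>2) / (u\<^sup>2 - 1)\<^sup>2"

definition qup0 :: "real \<Rightarrow> real" where
  "qup0 u = 6 * (72 - 13 * u\<^sup>2) / u ^ 3"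

definition qup :: "real \<Rightarrow> real \<Rightarrow> real \<Rightarrow> real" where
  "qup s s' u = u * (4 * (8 - u\<^sup>2) / ((8 - s) * (8 - s')) + 3 * (9 / 2 - u\<^sup>2) / ((9 / 2 - s) * (9 / 2 - s')))
     / ((u\<^sup>2 - s) * (u\<^sup>2 - s')) * ((8 - s) * (8 - s') * ((9 / 2 - s) * (9 / 2 - s'))) * (2 / 7)"

text \<open>In the affine coordinate \<open>e\<close>, equal to 0 at u^2 = 9/2 and to 1 at u^2 = 8,
  and with \<open>y s\<close> = (8 - s)/(9/2 - s), the quantity becomes \<open>u * r s s'\<close>.
  The function \<open>r\<close> is monotone in \<open>y s\<close>, in a direction given by the sign
  of \<open>e * (1 - e)\<close>. Hence the minimum is at s = s' = 1 between the two special values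
  of u^2 and at s = s' = 0 outside them.\<close>

lemma up_ratio_bound:
  fixes u s s' :: real
  assumes u: "u \<ge> 2" and s: "0 \<le> s" "s \<le> 1" "0 \<le> s'" "s' \<le> 1"
  shows "9 / 2 \<le> u\<^sup>2 \<Longrightarrow> u\<^sup>2 \<le> 8 \<Longrightarrow> qup2 u \<le> qup s s' u"
    and "u\<^sup>2 \<le> 9 / 2 \<or> 8 \<le> u\<^sup>2 \<Longrightarrow> qup0 u \<le> qup s s' u"
proof -
  have u2: "u\<^sup>2 \<ge> 4" using power_mono[of 2 u 2] u by simp
  define e where "e = (u\<^sup>2 - 9 / 2) * (2 / 7)"
  define k where "k = e * (1 - e)"
  define y where "y = (\<lambda>s. (8 - s) / (9 / 2 - s) :: real)"
  define r where "r = (\<lambda>s s'. (4 * (1 - e) - 3 * e * (y s * y s')) / ((1 - e + e * y s) * (1 - e + e * y s')))"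
  have D: "1 - e + e * y s = (u\<^sup>2 - s) / (9 / 2 - s)" if "s \<le> 1" for s
    using that by (simp add: e_def y_def field_simps)
  have Dp: "1 - e + e * y s > 0" if "s \<le> 1" for s unfolding D[OF that] using that u2 by simp
  have ys: "16 / 9 \<le> y s" "y s \<le> 2" "y 1 = 2" "y 0 = 16 / 9" if "0 \<le> s" "s \<le> 1" for s
    using that by (auto simp: y_def field_simps)
  have q: "qup s s' u = u * r s s'" if "s \<le> 1" "s' \<le> 1" for s s'
  proof -
    have gen: "u * (4 * A / (a * a') + 3 * B / (b * b')) / (c * c') * (a * a' * (b * b')) * (2 / 7) =
        u * ((4 * (2 / 7 * A) + 3 * (2 / 7 * B) * ((a / b) * (a' / b'))) / ((c / b) * (c' / b')))"
      if "a > 0" "a' > 0" "b > 0" "b' > 0" "c > 0" "c' > 0" for A B a a' b b' c c' :: real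
      using that by (simp add: field_simps)
    have e: "1 - e = 2 / 7 * (8 - u\<^sup>2)" "3 * e = - (3 * (2 / 7 * (9 / 2 - u\<^sup>2)))" by (simp_all add: e_def field_simps)
    have "qup s s' u = u * ((4 * (2 / 7 * (8 - u\<^sup>2)) + 3 * (2 / 7 * (9 / 2 - u\<^sup>2)) * (y s * y s')) /
        (((u\<^sup>2 - s) / (9 / 2 - s)) * ((u\<^sup>2 - s') / (9 / 2 - s'))))"
      unfolding qup_def y_def by (rule gen) (use that u2 in auto)
    also have "\<dots> = u * r s s'" unfolding r_def D[OF that(1)] D[OF that(2)] unfolding e by simp
    finally show ?thesis .
  qed
  \<comment> \<open>Because of this symmetry, monotonicity in the first argument is enough.\<close>
  have sym: "r s s' = r s' s" for s s' by (simp add: r_def mult.commute)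
  have diff: "r s s' - r t s' = (y t - y s) * (k * (4 + 3 * y s')) /
     ((1 - e + e * y s) * (1 - e + e * y t) * (1 - e + e * y s'))" if "s \<le> 1" "s' \<le> 1" "t \<le> 1" for s s' t
    unfolding r_def k_def using Dp[OF that(1)] Dp[OF that(2)] Dp[OF that(3)]
    by (simp add: divide_simps) (simp add: algebra_simps)
  have r11: "u * r 1 1 = qup2 u"
  proof -
    have gen: "u * (4 * A / (7 * 7) + 3 * B / (7 / 2 * (7 / 2))) / C * (7 * 7 * (7 / 2 * (7 / 2))) * (2 / 7) =
      14 * u * (A + 3 * B) / C" for A B C :: real by (simp add: algebra_simps add_divide_distrib)
    have "u * r 1 1 = qup 1 1 u" by (rule q[symmetric]) auto
    also have "\<dots> = 14 * u * ((8 - u\<^sup>2) + 3 * (9 / 2 - u\<^sup>2)) / ((u\<^sup>2 - 1) * (u\<^sup>2 - 1))"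
      unfolding qup_def gen[symmetric] by simp
    also have "14 * u * ((8 - u\<^sup>2) + 3 * (9 / 2 - u\<^sup>2)) = 7 * u * (43 - 8 * u\<^sup>2)"
      by (simp add: algebra_simps)
    also have "\<dots> / ((u\<^sup>2 - 1) * (u\<^sup>2 - 1)) = qup2 u" unfolding qup2_def by (simp add: power2_eq_square)
    finally show ?thesis .
  qed
  have r00: "u * r 0 0 = qup0 u"
    using q[of 0 0] u by (simp add: qup_def qup0_def divide_simps power2_eq_square power3_eq_cube)
  show "qup2 u \<le> qup s s' u" if "9 / 2 \<le> u\<^sup>2" "u\<^sup>2 \<le> 8"
  proof -
    have e: "0 \<le> k" using that by (simp add: e_def k_def)
    have step: "r 1 t' \<le> r t t'" if "0 \<le> t" "t \<le> 1" "0 \<le> t'" "t' \<le> 1" for t t'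
    proof -
      have "0 \<le> r t t' - r 1 t'"
        unfolding diff[OF that(2,4) order.refl]
        using e ys[OF that(1,2)] ys[OF that(3,4)] Dp[OF that(2)] Dp[OF that(4)] Dp[of 1]
        by (intro divide_nonneg_nonneg mult_nonneg_nonneg) auto
      then show ?thesis by simp
    qed
    have "r 1 1 \<le> r s s'"
      using step[of s' 1] step[of s s'] s sym[of 1 s'] by simp
    then show ?thesis unfolding r11[symmetric] q[OF s(2,4)] using u by simp
  qed
  show "qup0 u \<le> qup s s' u" if "u\<^sup>2 \<le> 9 / 2 \<or> 8 \<le> u\<^sup>2"
  proof -
    have e: "k \<le> 0" using that by (auto simp: e_def k_def mult_nonneg_nonpos mult_nonpos_nonneg)
    have step: "r 0 t' \<le> r t t'" if "0 \<le> t" "t \<le> 1" "0 \<le> t'" "t' \<le> 1" for t t'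
    proof -
      have "(y 0 - y t) * (k * (4 + 3 * y t')) \<ge> 0"
        using e ys[OF that(1,2)] ys[OF that(3,4)]
        by (intro mult_nonpos_nonpos mult_nonpos_nonneg) auto
      then have "0 \<le> r t t' - r 0 t'"
        unfolding diff[OF that(2,4) zero_le_one]
        by (rule divide_nonneg_nonneg) (use Dp[OF that(2)] Dp[OF that(4)] Dp[of 0] in \<open>auto intro!: mult_nonneg_nonneg\<close>)
      then show ?thesis by simp
    qed
    have "r 0 0 \<le> r s s'"
      using step[of s' 0] step[of s s'] s sym[of 0 s'] by simp
    then show ?thesis unfolding r00[symmetric] q[OF s(2,4)] using u by simp
  qed
qed

text \<open>At 3/2 sqrt 2, the value of x + 1/x at x = sqrt 2, \<open>qup2\<close> equals 6 sqrt 2.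
  The factorisation isolates this zero of the difference, so that the remaining factor can be
  bounded crudely.\<close>

lemma qup2_sqrt2:
  assumes "u\<^sup>2 \<noteq> 1"
  shows "6 * sqrt 2 - qup2 u =
    (u - 3 / 2 * sqrt 2) * (6 * sqrt 2 * u ^ 3 + 74 * u\<^sup>2 + 99 * sqrt 2 * u - 4) / (u\<^sup>2 - 1)\<^sup>2"
proof -
  define t where "t = sqrt 2"
  have t: "t * t = 2" by (simp add: t_def)
  have t': "t * (t * x) = 2 * x" for x using t by (simp add: mult.assoc[symmetric])
  have "6 * t * (u\<^sup>2 - 1)\<^sup>2 - 7 * u * (43 - 8 * u\<^sup>2) =
      (u - 3 / 2 * t) * (6 * t * u ^ 3 + 74 * u\<^sup>2 + 99 * t * u - 4)"
    by (simp add: algebra_simps power2_eq_square power3_eq_cube t t')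
  then show ?thesis unfolding qup2_def t_def[symmetric]

    using assms by (simp only: diff_divide_eq_iff power_not_zero right_minus_eq not_False_eq_True)
qed

text \<open>The analogue at u = 2 sqrt 2, the value of x + 1/x at \<open>silver\<close>, where
  \<open>qup0\<close> equals -6 sqrt 2. The four points of a block at \<open>silver\<close> thus
  contribute 6 sqrt 2 and -6 sqrt 2 twice each, with sum zero.\<close>

lemma qup0_sqrt2:
  assumes "u \<noteq> 0"
  shows "- 6 * sqrt 2 - qup0 u = (u - 2 * sqrt 2) * (54 * u + 108 * sqrt 2 - 6 * sqrt 2 * u\<^sup>2) / u ^ 3"
proof -
  define t where "t = sqrt 2"
  have t: "t * t = 2" by (simp add: t_def)
  have t': "t * (t * x) = 2 * x" for x using t by (simp add: mult.assoc[symmetric])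
  have "- 6 * t * u ^ 3 - 6 * (72 - 13 * u\<^sup>2) = (u - 2 * t) * (54 * u + 108 * t - 6 * t * u\<^sup>2)"
    by (simp add: algebra_simps power2_eq_square power3_eq_cube t t')
  then show ?thesis unfolding qup0_def t_def[symmetric] using assms by (simp add: field_simps)
qed

lemma qup0_ge:
  assumes "0 < u" "u \<le> 3 / 2 * sqrt 2" shows "6 * sqrt 2 \<le> qup0 u"
proof -
  have "u\<^sup>2 \<le> (3 / 2 * sqrt 2)\<^sup>2" using assms by (intro power_mono) auto
  then have a: "u\<^sup>2 \<le> 9 / 2" by (simp add: power_mult_distrib power2_eq_square)
  have "u ^ 3 \<le> (3 / 2 * sqrt 2) ^ 3" using assms by (intro power_mono) auto
  then have b: "u ^ 3 \<le> 27 / 4 * sqrt 2" by (simp add: power_mult_distrib power3_eq_cube)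
  have "6 * sqrt 2 * u ^ 3 \<le> 6 * sqrt 2 * (27 / 4 * sqrt 2)" using b by (intro mult_left_mono) auto
  \<comment> \<open>Both estimates are sharp at u^2 = 9/2, where they meet in the value 81.\<close>
  also have "\<dots> \<le> 6 * (72 - 13 * u\<^sup>2)" using a by simp
  finally show ?thesis unfolding qup0_def using assms by (simp add: pos_le_divide_eq)
qed

lemma qup2_ge:
  assumes "2 \<le> u" "u \<le> 2 * sqrt 2" shows "- 6 * sqrt 2 \<le> qup2 u"
proof -
  define v where "v = u\<^sup>2 - 1"
  have "u\<^sup>2 \<le> (2 * sqrt 2)\<^sup>2" using assms by (intro power_mono) auto
  then have v7: "v \<le> 7" by (simp add: v_def power_mult_distrib)
  have "2\<^sup>2 \<le> u\<^sup>2" using assms by (intro power_mono) auto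
  then have v3: "3 \<le> v" by (simp add: v_def)
  \<comment> \<open>The factor 7 - v vanishes at u^2 = 8, where the bound is attained.\<close>
  have "0 \<le> (7 - v) * (35 - 3 * v)" using v7 by (intro mult_nonneg_nonneg) auto
  then have "7 * (8 * v - 35) \<le> 3 * v\<^sup>2" by (simp add: algebra_simps power2_eq_square)
  then have a: "u * (7 * (8 * v - 35)) \<le> u * (3 * v\<^sup>2)" using assms by (intro mult_left_mono) auto
  also have "\<dots> \<le> (2 * sqrt 2) * (3 * v\<^sup>2)" using assms by (intro mult_right_mono) auto
  finally have "- 6 * sqrt 2 * v\<^sup>2 \<le> 7 * u * (43 - 8 * u\<^sup>2)" by (simp add: v_def algebra_simps)
  then show ?thesis unfolding qup2_def v_def[symmetric] using v3 by (simp add: pos_le_divide_eq)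
qed

text \<open>A bound that is linear in the deviation \<open>h\<close> of 1/y from its value sqrt 2 -
  1 at \<open>silver\<close>. The slope is 57/100 * 58: the first factor bounds the growth of u, the
  second the cofactor in \<open>qup2_sqrt2\<close>.\<close>

lemma qup2_first:
  assumes y: "golden \<le> y" "y \<le> silver"
  defines "x \<equiv> 1 + 1 / y"
  shows "6 * sqrt 2 - 3306 / 100 * (1 / y - (sqrt 2 - 1)) \<le> qup2 (x + 1 / x)"
proof -
  define h u where "h = 1 / y - (sqrt 2 - 1)" and "u = x + 1 / x"
  have h: "0 \<le> h" using inverse_range[OF y] by (simp add: h_def silver_def)
  have xh: "x = sqrt 2 + h" by (simp add: x_def h_def)
  have xb: "x \<le> 16181 / 10000" using inverse_range[OF y] golden_bounds by (simp add: x_def)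
  have x1: "7071 / 5000 \<le> x" using xh h sqrt2_bounds by linarith
  have "u - 3 / 2 * sqrt 2 = h * (1 - 1 / (sqrt 2 * x))"
  proof -
    have s: "1 / sqrt 2 = sqrt 2 / 2" by (simp add: field_simps)
    have "u - 3 / 2 * sqrt 2 = h + (1 / x - 1 / sqrt 2)" unfolding u_def s by (simp add: xh)
    also have "1 / x - 1 / sqrt 2 = - h / (sqrt 2 * x)" using x1 by (simp add: xh field_simps)
    finally show ?thesis by (simp add: right_diff_distrib)
  qed
  also have "\<dots> \<le> h * (57 / 100)"
  proof (rule mult_left_mono[OF _ h])
    have "sqrt 2 * x \<le> 14143 / 10000 * (16181 / 10000)"
      using sqrt2_bounds xb x1 by (intro mult_mono) auto
    then have "43 / 100 * (sqrt 2 * x) \<le> 1" by simp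
    then have "43 / 100 \<le> 1 / (sqrt 2 * x)" using x1 by (simp add: pos_le_divide_eq)
    then show "1 - 1 / (sqrt 2 * x) \<le> 57 / 100" by simp
  qed
  finally have u1: "u - 3 / 2 * sqrt 2 \<le> h * (57 / 100)" .
  have ul: "21213 / 10000 \<le> u" using add_inverse_mono[of "7071 / 5000" x] x1 by (simp add: u_def)
  have uv: "(21213 / 10000)\<^sup>2 \<le> u\<^sup>2" using ul by (intro power_mono) auto
  then have u2: "u\<^sup>2 > 4" by (simp add: power2_eq_square)
  define d where "d = u - 21213 / 10000"
  have d: "0 \<le> d" "u = 21213 / 10000 + d" using ul by (auto simp: d_def)
  have "6 * sqrt 2 * u ^ 3 \<le> 6 * (14143 / 10000) * u ^ 3" "99 * sqrt 2 * u \<le> 99 * (14143 / 10000) * u"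
    using sqrt2_bounds ul by (auto intro!: mult_right_mono)
  moreover have "6 * (14143 / 10000) * u ^ 3 + 74 * u\<^sup>2 + 99 * (14143 / 10000) * u - 4 \<le> 58 * (u\<^sup>2 - 1)\<^sup>2"
  proof -
    \<comment> \<open>Expanded at the lower bound 21213/10000 of u, the difference has only positive
      coefficients.\<close>
    have "58 * (u\<^sup>2 - 1)\<^sup>2 - (6 * (14143 / 10000) * u ^ 3 + 74 * u\<^sup>2 + 99 * (14143 / 10000) * u - 4) =
      4316776040152639 / 1250000000000000 + 576964460243349 / 500000000000 * d + 2643934363 / 2000000 * d ^ 2 + 2418279 / 5000 * d ^ 3 + 58 * d ^ 4"
      unfolding d(2) by (simp add: power2_eq_square power3_eq_cube power4_eq_xxxx field_simps)
    also have "\<dots> \<ge> 0" using d(1) by (intro add_nonneg_nonneg) auto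
    finally show ?thesis by simp
  qed
  ultimately have c: "6 * sqrt 2 * u ^ 3 + 74 * u\<^sup>2 + 99 * sqrt 2 * u - 4 \<le> 58 * (u\<^sup>2 - 1)\<^sup>2" by linarith
  have c0: "0 \<le> 6 * sqrt 2 * u ^ 3 + 74 * u\<^sup>2 + 99 * sqrt 2 * u - 4"
  proof -
    have "0 \<le> 6 * sqrt 2 * u ^ 3" "0 \<le> 99 * sqrt 2 * u" using ul by auto
    then show ?thesis using u2 by linarith
  qed
  have "(u - 3 / 2 * sqrt 2) * (6 * sqrt 2 * u ^ 3 + 74 * u\<^sup>2 + 99 * sqrt 2 * u - 4) \<le> (h * (57 / 100)) * (58 * (u\<^sup>2 - 1)\<^sup>2)"
    using u1 c c0 h by (intro mult_mono) auto
  then have "6 * sqrt 2 - qup2 u \<le> h * (57 / 100) * 58"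
    using u2 by (subst qup2_sqrt2) (auto simp: pos_divide_le_eq mult_ac)
  then show ?thesis unfolding u_def h_def by argo
qed

text \<open>The companion of \<open>qup2_first\<close> for the point 2 + 1/y. Here the slope is
  85/100 * 11, from the growth of u and from the cofactor in \<open>qup0_sqrt2\<close>.\<close>

lemma qup0_first:
  assumes y: "golden \<le> y" "y \<le> silver"
  defines "x \<equiv> 2 + 1 / y"
  shows "- 6 * sqrt 2 - 935 / 100 * (1 / y - (sqrt 2 - 1)) \<le> qup0 (x + 1 / x)"
proof -
  define h u where "h = 1 / y - (sqrt 2 - 1)" and "u = x + 1 / x"
  have h: "0 \<le> h" using inverse_range[OF y] by (simp add: h_def silver_def)
  have xh: "x = silver + h" by (simp add: x_def h_def silver_def)
  have xb: "x \<le> 26181 / 10000" using inverse_range[OF y] golden_bounds by (simp add: x_def)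
  have x1: "12071 / 5000 \<le> x" using xh h silver_bounds by linarith
  have "u - 2 * sqrt 2 = h * (1 - 1 / (silver * x))"
  proof -
    have s: "silver + 1 / silver = 2 * sqrt 2" unfolding silver_inverse by (simp add: silver_def)
    have "u - 2 * sqrt 2 = h + (1 / x - 1 / silver)" unfolding s[symmetric] u_def by (simp add: xh)
    also have "1 / x - 1 / silver = - h / (silver * x)" using x1 silver_bounds by (simp add: xh field_simps)
    finally show ?thesis by (simp add: right_diff_distrib)
  qed
  also have "\<dots> \<le> h * (85 / 100)"
  proof (rule mult_left_mono[OF _ h])
    have "silver * x \<le> 24143 / 10000 * (26181 / 10000)"
      using silver_bounds xb x1 by (intro mult_mono) auto
    then have "15 / 100 * (silver * x) \<le> 1" by simp
    then have "15 / 100 \<le> 1 / (silver * x)" using x1 silver_bounds by (simp add: pos_le_divide_eq)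
    then show "1 - 1 / (silver * x) \<le> 85 / 100" by simp
  qed
  finally have u1: "u - 2 * sqrt 2 \<le> h * (85 / 100)" .
  have ul: "28 / 10 \<le> u" using add_inverse_mono[of "12071 / 5000" x] x1 by (simp add: u_def)
  have uh: "u \<le> 31 / 10" using add_inverse_mono[of x "26181 / 10000"] x1 xb by (simp add: u_def)
  define d where "d = u - 28 / 10"
  have d: "0 \<le> d" "u = 28 / 10 + d" using ul by (auto simp: d_def)
  have s2: "6 * (7071 / 5000) * u\<^sup>2 \<le> 6 * sqrt 2 * u\<^sup>2" "6 * sqrt 2 * u\<^sup>2 \<le> 6 * (14143 / 10000) * u\<^sup>2"
    using sqrt2_bounds by (intro mult_right_mono; simp)+
  have "54 * u + 108 * (14143 / 10000) - 6 * (7071 / 5000) * u\<^sup>2 \<le> 11 * u ^ 3"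
  proof -
    have "11 * u ^ 3 - (54 * u + 108 * (14143 / 10000) - 6 * (7071 / 5000) * u\<^sup>2) =
      253223 / 62500 + 788241 / 3125 * d + 252213 / 2500 * d ^ 2 + 11 * d ^ 3"
      unfolding d(2) by (simp add: power2_eq_square power3_eq_cube field_simps)
    also have "\<dots> \<ge> 0" using d(1) by (intro add_nonneg_nonneg) auto
    finally show ?thesis by simp
  qed
  then have c: "54 * u + 108 * sqrt 2 - 6 * sqrt 2 * u\<^sup>2 \<le> 11 * u ^ 3"
    using s2 sqrt2_bounds by linarith
  have "u\<^sup>2 \<le> (31 / 10)\<^sup>2" using uh ul by (intro power_mono) auto
  then have c0: "0 \<le> 54 * u + 108 * sqrt 2 - 6 * sqrt 2 * u\<^sup>2"
    using s2 sqrt2_bounds ul unfolding power2_eq_square by argo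
  have "(u - 2 * sqrt 2) * (54 * u + 108 * sqrt 2 - 6 * sqrt 2 * u\<^sup>2) \<le> (h * (85 / 100)) * (11 * u ^ 3)"
    using u1 c c0 h by (intro mult_mono) auto
  then have "- 6 * sqrt 2 - qup0 u \<le> h * (85 / 100) * 11"
    using ul by (subst qup0_sqrt2) (auto simp: pos_divide_le_eq mult_ac)
  then show ?thesis unfolding u_def h_def by argo
qed

text \<open>Everything is measured by \<open>h\<close>, which vanishes at \<open>silver\<close>. For
  \<open>a = 2\<close> the constants 6 sqrt 2 cancel in pairs and the terms linear in
  \<open>h\<close> are compared with the growth of \<open>cf_block 2 y - y\<close>. For
  \<open>a = 1\<close> the inequality is strict with room to spare, and numerical bounds on the two
  points suffice.\<close>

lemma qup_block:
  assumes a: "a \<in> {1, 2}" and y: "golden \<le> y" "y \<le> silver"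
    and s: "0 \<le> s" "s \<le> 1" "0 \<le> s'" "s' \<le> 1"
  shows "12 * (y - cf_block a y) \<le> block_sum (\<lambda>x. qup s s' (x + 1 / x)) a y"
proof -
  define Y h where "Y = 1 / y" and "h = 1 / y - (sqrt 2 - 1)"
  have y0: "0 < y" using y golden_bounds by linarith
  have r: "silver - 2 \<le> Y" "Y \<le> golden - 1" using inverse_range[OF y] by (auto simp: Y_def)
  have i: "4142 / 10000 \<le> Y" "Y \<le> 6181 / 10000" using r silver_bounds golden_bounds by linarith+
  have yY: "y = 1 / Y" by (simp add: Y_def)
  have first: "6 * sqrt 2 - 3306 / 100 * h \<le> qup s s' ((1 + Y) + 1 / (1 + Y))"
  proof -
    have u: "sqrt 2 + 1 / sqrt 2 \<le> (1 + Y) + 1 / (1 + Y)" "(1 + Y) + 1 / (1 + Y) \<le> golden + 1 / golden"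
      using r i by (auto intro!: add_inverse_mono simp: silver_def)
    have "1 / sqrt 2 = sqrt 2 / 2" by (simp add: field_simps)
    then have ul: "3 / 2 * sqrt 2 \<le> (1 + Y) + 1 / (1 + Y)" using u(1) by simp
    have uh: "(1 + Y) + 1 / (1 + Y) \<le> 28 / 10" using u(2) golden_bounds unfolding golden_inverse by linarith
    have "(3 / 2 * sqrt 2)\<^sup>2 \<le> ((1 + Y) + 1 / (1 + Y))\<^sup>2" using ul by (intro power_mono) auto
    moreover have "((1 + Y) + 1 / (1 + Y))\<^sup>2 \<le> (28 / 10)\<^sup>2" using uh i by (intro power_mono) auto
    ultimately have "qup2 ((1 + Y) + 1 / (1 + Y)) \<le> qup s s' ((1 + Y) + 1 / (1 + Y))"
      using ul sqrt2_bounds by (intro up_ratio_bound s) (auto simp: power_mult_distrib power2_eq_square)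
    then show ?thesis using qup2_first[OF y] unfolding Y_def h_def by linarith
  qed
  show ?thesis
  proof (cases "a = 1")
    case True
    define x u where "x = cf_block 1 y" and "u = x + 1 / x"
    have xY: "x = 1 + 1 / (1 + Y)" by (simp add: x_def cf_block_def Y_def)
    have x: "1618 / 1000 \<le> x" "x \<le> 17072 / 10000"
      using i unfolding xY by (auto simp: field_simps)
    have u: "2236 / 1000 \<le> u" "u \<le> 2293 / 1000"
      using add_inverse_bounds[of "1618 / 1000" x "17072 / 10000"] x by (simp_all add: u_def)
    have uu: "(2236 / 1000)\<^sup>2 \<le> u\<^sup>2" "u\<^sup>2 \<le> (2293 / 1000)\<^sup>2" using u by (auto intro: power_mono)
    have "8 / 10 \<le> qup2 u"
    proof -
      have 1: "2236 / 1000 * (934 / 1000) \<le> u * (43 - 8 * u\<^sup>2)"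
        using u uu by (intro mult_mono) (auto simp: power2_eq_square)
      have "(u\<^sup>2 - 1)\<^sup>2 \<le> (4258 / 1000)\<^sup>2" using uu by (intro power_mono) (auto simp: power2_eq_square)
      then have "8 / 10 * (u\<^sup>2 - 1)\<^sup>2 \<le> 7 * u * (43 - 8 * u\<^sup>2)" using 1 by (simp add: power2_eq_square)
      moreover have "(u\<^sup>2 - 1)\<^sup>2 > 0" using uu by (simp add: power2_eq_square)
      ultimately show ?thesis unfolding qup2_def by (simp add: pos_le_divide_eq)
    qed
    also have "\<dots> \<le> qup s s' u" using u uu by (intro up_ratio_bound s) (auto simp: power2_eq_square)
    finally have q: "8 / 10 \<le> qup s s' u" .
    have yx: "y - x = 1 / (Y * (1 + Y)) - 1" 
    proof -
      have "1 / Y - 1 / (1 + Y) = 1 / (Y * (1 + Y))" using i by (simp add: field_simps)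
      then show ?thesis unfolding xY yY by simp
    qed
    \<comment> \<open>The polynomial is expanded at the left end of the range of \<open>Y\<close>.
      Its negative quadratic and cubic terms are absorbed through
      \<open>d \<le> 204 / 1000\<close>.\<close>
    define d where "d = Y - 4142 / 10000"
    have d: "0 \<le> d" "d \<le> 204 / 1000" "Y = 4142 / 10000 + d" using i by (auto simp: d_def)
    have dd: "0 \<le> d * d" "d * d \<le> 204 / 1000 * d" using d by (simp, intro mult_right_mono)
    have d3: "d * (d * d) \<le> 204 / 1000 * (d * d)" using d dd by (intro mult_right_mono) auto
    \<comment> \<open>The constant 212852/10000 is 12 + 8/10 + 6 * 7071/5000: the -1 in
      \<open>yx\<close> times -12, the bound for the second point, and a lower bound for 6 sqrt
      2.\<close>
    have "(212852 / 10000 - 3306 / 100 * (Y - 4142 / 10000)) * (Y * (1 + Y)) - 12 =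
        29253353733 / 62500000000 + 24440724827 / 1250000000 * d - 4895213 / 125000 * d ^ 2 - 1653 / 50 * d ^ 3"
      unfolding d(3) by (simp add: power2_eq_square power3_eq_cube field_simps)
    then have "12 \<le> (212852 / 10000 - 3306 / 100 * (Y - 4142 / 10000)) * (Y * (1 + Y))"
      using d(1) dd d3 unfolding power2_eq_square power3_eq_cube mult.assoc by linarith
    then have "12 / (Y * (1 + Y)) \<le> 212852 / 10000 - 3306 / 100 * (Y - 4142 / 10000)"
      using i by (simp add: pos_divide_le_eq)
    moreover have "h \<le> Y - 4142 / 10000" using sqrt2_bounds by (simp add: h_def Y_def)
    ultimately have "12 * (y - x) \<le> 6 * sqrt 2 - 3306 / 100 * h + 8 / 10"
      unfolding yx using sqrt2_bounds by argo
    then show ?thesis using first q True by (simp add: block_sum_1 Y_def x_def u_def)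
  next
    case False
    then have a2: "a = 2" using a by simp
    have h0: "0 \<le> h" using r by (simp add: h_def Y_def silver_def)
    have second: "- 6 * sqrt 2 - 935 / 100 * h \<le> qup s s' ((2 + Y) + 1 / (2 + Y))"
    proof -
      have "silver + 1 / silver \<le> (2 + Y) + 1 / (2 + Y)"
        using r silver_bounds by (intro add_inverse_mono) auto
      then have ul: "2 * sqrt 2 \<le> (2 + Y) + 1 / (2 + Y)" unfolding silver_inverse by (simp add: silver_def)
      then have "(2 * sqrt 2)\<^sup>2 \<le> ((2 + Y) + 1 / (2 + Y))\<^sup>2" by (intro power_mono) auto
      then have "qup0 ((2 + Y) + 1 / (2 + Y)) \<le> qup s s' ((2 + Y) + 1 / (2 + Y))"
        using ul sqrt2_bounds by (intro up_ratio_bound s) (auto simp: power_mult_distrib)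
      then show ?thesis using qup0_first[OF y] unfolding Y_def h_def by linarith
    qed
    define p where "p = 1 / (2 + Y)"
    have pr: "p \<le> 1 / silver" unfolding p_def using r i silver_bounds by (intro divide_left_mono) auto
    then have ph: "p \<le> silver - 2" unfolding silver_inverse .
    have pl: "38 / 100 \<le> p" unfolding p_def using i by (simp add: field_simps)
    have third: "6 * sqrt 2 \<le> qup s s' ((1 + p) + 1 / (1 + p))"
    proof -
      have "(1 + p) + 1 / (1 + p) \<le> sqrt 2 + 1 / sqrt 2"
        using ph pl by (intro add_inverse_mono) (auto simp: silver_def)
      moreover have "1 / sqrt 2 = sqrt 2 / 2" by (simp add: field_simps)
      ultimately have uh: "(1 + p) + 1 / (1 + p) \<le> 3 / 2 * sqrt 2" by simp
      have ul: "2 \<le> (1 + p) + 1 / (1 + p)" using pl by (intro add_inverse_ge_2) auto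
      have "((1 + p) + 1 / (1 + p))\<^sup>2 \<le> (3 / 2 * sqrt 2)\<^sup>2" using uh ul by (intro power_mono) auto
      then have "qup0 ((1 + p) + 1 / (1 + p)) \<le> qup s s' ((1 + p) + 1 / (1 + p))"
        using ul by (intro up_ratio_bound s) (auto simp: power_mult_distrib power2_eq_square)
      then show ?thesis using qup0_ge[OF _ uh] ul by linarith
    qed
    have fourth: "- 6 * sqrt 2 \<le> qup s s' ((2 + p) + 1 / (2 + p))"
    proof -
      have "(2 + p) + 1 / (2 + p) \<le> silver + 1 / silver"
        using ph pl by (intro add_inverse_mono) auto
      then have uh: "(2 + p) + 1 / (2 + p) \<le> 2 * sqrt 2" unfolding silver_inverse by (simp add: silver_def)
      have ul: "22 / 10 \<le> (2 + p) + 1 / (2 + p)" 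
      proof -
        have "0 < 1 / (2 + p)" using pl by simp
        then show ?thesis using pl by linarith
      qed
      have "((2 + p) + 1 / (2 + p))\<^sup>2 \<le> (2 * sqrt 2)\<^sup>2" using uh ul by (intro power_mono) auto
      moreover have "(22 / 10)\<^sup>2 \<le> ((2 + p) + 1 / (2 + p))\<^sup>2" using ul by (intro power_mono) auto
      ultimately have "qup2 ((2 + p) + 1 / (2 + p)) \<le> qup s s' ((2 + p) + 1 / (2 + p))"
        using ul by (intro up_ratio_bound s) (auto simp: power_mult_distrib power2_eq_square)
      then show ?thesis using qup2_ge[OF _ uh] ul by linarith
    qed
    \<comment> \<open>The two linear losses add up to 42.41 h, and 12 times this growth is at least
      43.2 h.\<close>
    have "36 / 10 * h \<le> cf_block 2 y - y"
    proof -
      have "cf_block 2 y - y = 2 * (Y\<^sup>2 + 2 * Y - 1) / (Y * (2 + Y))"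
        using i unfolding cf_block_def yY by (simp add: field_simps power2_eq_square)
      also have "Y\<^sup>2 + 2 * Y - 1 = h * (Y + 1 + sqrt 2)"
        by (simp add: h_def Y_def[symmetric] power2_eq_square algebra_simps)
      finally have e: "cf_block 2 y - y = h * (2 * (Y + 1 + sqrt 2) / (Y * (2 + Y)))" by simp
      have "Y * (2 + Y) \<le> Y * (26181 / 10000)" using i by (intro mult_left_mono) auto
      then have "36 / 10 * (Y * (2 + Y)) \<le> 2 * (Y + 1 + sqrt 2)"
        using i sqrt2_bounds by argo
      then have k: "36 / 10 \<le> 2 * (Y + 1 + sqrt 2) / (Y * (2 + Y))" using i by (simp add: pos_le_divide_eq)
      show ?thesis unfolding e using mult_left_mono[OF k h0] by (simp only: mult.commute)
    qed
    then show ?thesis using first second third fourth h0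
      unfolding a2 block_sum_2 cf_block_def p_def Y_def by simp
  qed
qed

section \<open>Monotonicity of the quotients of weights\<close>

text \<open>At \<open>golden\<close> one has u^2 = 5, so 1/(5 - s) is proportional to the weight of
  \<open>golden\<close> and the left side compares its quotient with the kernel at two parameters.
  The identity rests on (5 - s)(u^2 - s') - (5 - s')(u^2 - s) = (s - s')(5 - u^2).\<close>

lemma kern_low:
  assumes "x \<ge> 1" "s \<le> 1" "s' \<le> 1"
  defines "u \<equiv> x + 1 / x"
  shows "(5 - s) * kern s x - (5 - s') * kern s' x =
    (s - s') / ((5 - s) * (5 - s')) * (u * (5 - u\<^sup>2) * ((5 - s) * (5 - s') / ((u\<^sup>2 - s) * (u\<^sup>2 - s'))))"
proof -
  have "u \<ge> 2" unfolding u_def by (rule add_inverse_ge_2[OF assms(1)])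
  then have "u\<^sup>2 \<ge> 4" using power_mono[of 2 u 2] by simp
  then show ?thesis using assms(2,3) unfolding kern_def u_def[symmetric]
    by (simp add: divide_simps) (simp add: algebra_simps)
qed

text \<open>The analogue for \<open>silver\<close>, whose blocks meet only the points
  \<open>silver\<close> and sqrt 2, with u^2 = 8 and u^2 = 9/2. The function \<open>g\<close> is a
  quarter of its weight, and each of its two terms gives one summand of \<open>qup\<close>.\<close>

lemma kern_up:
  assumes "x \<ge> 1" "s \<le> 1" "s' \<le> 1"
  defines "g \<equiv> \<lambda>s. kern s silver + kern s (sqrt 2)"
  shows "g s' * kern s x - g s * kern s' x =
    (s - s') * (7 / 4 * sqrt 2 / ((8 - s) * (8 - s') * ((9 / 2 - s) * (9 / 2 - s')))) * qup s s' (x + 1 / x)"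
proof -
  define u where "u = x + 1 / x"
  have "u \<ge> 2" unfolding u_def by (rule add_inverse_ge_2[OF assms(1)])
  then have u2: "u\<^sup>2 \<ge> 4" using power_mono[of 2 u 2] by simp
  have k1: "kern s silver = 2 * sqrt 2 / (8 - s)" for s
  proof -
    have "silver + 1 / silver = 2 * sqrt 2" unfolding silver_inverse by (simp add: silver_def)
    then show ?thesis by (simp add: kern_def power_mult_distrib)
  qed
  have k2: "kern s (sqrt 2) = 3 / 2 * sqrt 2 / (9 / 2 - s)" for s
  proof -
    have "sqrt 2 + 1 / sqrt 2 = 3 / 2 * sqrt 2" by (simp add: field_simps)
    then show ?thesis unfolding kern_def by (simp only:) (simp add: power_mult_distrib power2_eq_square)
  qed
  have gen': "u * t * (2 * (d * A / (P * R)) + 3 / 2 * (d * B / (Q * R))) =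
     d * (7 / 4 * t / (P * Q)) * (u * (4 * A / P + 3 * B / Q) / R * (P * Q) * (2 / 7))"
    if "P \<noteq> 0" "Q \<noteq> 0" "R \<noteq> 0" for d t A B P Q R :: real
    using that by (simp add: field_simps)
  have gen: "(2 * t / a' + 3 / 2 * t / b') * (u / c) - (2 * t / a + 3 / 2 * t / b) * (u / c') =
     (s - s') * (7 / 4 * t / (a * a' * (b * b'))) * (u * (4 * A / (a * a') + 3 * B / (b * b')) / (c * c') * (a * a' * (b * b')) * (2 / 7))"
    if "a > 0" "a' > 0" "b > 0" "b' > 0" "c > 0" "c' > 0" "a * c' - a' * c = (s - s') * A" "b * c' - b' * c = (s - s') * B"
    for a a' b b' c c' t A B :: real
  proof -
    have "(2 * t / a' + 3 / 2 * t / b') * (u / c) - (2 * t / a + 3 / 2 * t / b) * (u / c') =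
      u * t * (2 * (1 / (a' * c) - 1 / (a * c')) + 3 / 2 * (1 / (b' * c) - 1 / (b * c')))"
      by (simp add: algebra_simps)
    also have "1 / (a' * c) - 1 / (a * c') = (a * c' - a' * c) / (a * a' * (c * c'))" using that by (simp add: field_simps)
    also have "1 / (b' * c) - 1 / (b * c') = (b * c' - b' * c) / (b * b' * (c * c'))" using that by (simp add: field_simps)
    also have "u * t * (2 * ((a * c' - a' * c) / (a * a' * (c * c'))) + 3 / 2 * ((b * c' - b' * c) / (b * b' * (c * c')))) =
      (s - s') * (7 / 4 * t / (a * a' * (b * b'))) * (u * (4 * A / (a * a') + 3 * B / (b * b')) / (c * c') * (a * a' * (b * b')) * (2 / 7))"
      unfolding that(7,8) by (rule gen') (use that in auto)
    finally show ?thesis .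
  qed
  have kx: "kern s x = u / (u\<^sup>2 - s)" for s by (simp add: kern_def u_def)
  show ?thesis unfolding g_def k1 k2 qup_def u_def[symmetric] kx
    by (rule gen) (use assms(2,3) u2 in \<open>auto simp: field_simps\<close>)
qed

text \<open>All arguments that occur in the sum are at least 1, which is the range where
  \<open>kern_low\<close> and \<open>kern_up\<close> hold.\<close>

lemma path_sum_cong:
  assumes "set bs \<subseteq> {1..}" "0 < x" "0 < z" "\<And>y. 1 \<le> y \<Longrightarrow> g y = h y"
  shows "path_sum g bs x z = path_sum h bs x z"
proof -
  have pos: "0 < cf_block a y" if "0 < y" "a \<ge> 1" for a y
    unfolding cf_block_def using that by (intro add_pos_nonneg) auto
  have posr: "0 < foldr cf_block bs x" if "set bs \<subseteq> {1..}" for bs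
    using that by (induction bs) (auto simp: assms(2) intro!: pos)
  have blk: "block_sum g a y = block_sum h a y" if "0 < y" for a y
    unfolding block_sum_def using that
    by (intro sum.cong refl arg_cong2[where f = "(+)"] assms(4)) (auto intro!: add_increasing2)
  show ?thesis using assms(1,3)
    by (induction bs arbitrary: z) (auto simp: blk posr pos)
qed

lemma path_sum_pos:
  assumes "set bs \<subseteq> {1..}" "bs \<noteq> []" "0 < x" "0 < z" "\<And>y. 1 \<le> y \<Longrightarrow> 0 < g y"
  shows "0 < path_sum g bs x z"
proof -
  have pos: "0 < cf_block a y" if "0 < y" "a \<ge> 1" for a y
    unfolding cf_block_def using that by (intro add_pos_nonneg) auto
  have posr: "0 < foldr cf_block bs x" if "set bs \<subseteq> {1..}" for bs
    using that by (induction bs) (auto simp: assms(3) intro!: pos)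
  have blk: "0 < block_sum g a y" if "0 < y" "a \<ge> 1" for a y
    unfolding block_sum_def using that
    by (intro sum_pos add_pos_pos assms(5)) (auto intro!: add_increasing2)
  have nonneg: "0 \<le> path_sum g bs x z" if "set bs \<subseteq> {1..}" "0 < z" for bs z
    using that
  proof (induction bs arbitrary: z)
    case (Cons a bs)
    then have "0 \<le> path_sum g bs x (cf_block a z)" by (intro Cons.IH pos) auto
    with Cons.prems show ?case by (auto intro!: add_nonneg_nonneg less_imp_le[OF blk] posr)
  qed simp
  obtain a cs where bs: "bs = a # cs" using assms(2) by (cases bs) auto
  have "0 < block_sum g a z" "0 < block_sum g a (foldr cf_block cs x)" "0 \<le> path_sum g cs x (cf_block a z)"
    using assms(1,4) bs by (auto intro!: blk posr nonneg pos)
  then show ?thesis by (simp add: bs)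
qed

lemma golden_weight: "path_sum (kern s) [1] golden golden = 4 * sqrt 5 / (5 - s)"
proof -
  have "golden + 1 / golden = sqrt 5" unfolding golden_inverse by (simp add: golden_def field_simps)
  then have "kern s golden = sqrt 5 / (5 - s)" by (simp add: kern_def)
  moreover have "1 + 1 / golden = golden" unfolding golden_inverse by simp
  ultimately show ?thesis using cf_block_golden by (simp add: block_sum_1)
qed

lemma silver_weight: "path_sum (kern s) [2] silver silver = 4 * (kern s silver + kern s (sqrt 2))"
proof -
  have "2 + 1 / silver = silver" "1 + 1 / silver = sqrt 2" unfolding silver_inverse by (simp_all add: silver_def)
  then show ?thesis using cf_block_silver by (simp add: block_sum_2)
qed

text \<open>The difference of the two sides is, up to a nonnegative factor, a path sum of the
  functions estimated blockwise above. Since \<open>x\<close> and \<open>z\<close> are fixed by the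
  word, the telescoped bound is zero and gives the sign.\<close>

lemma weight_ratio:
  assumes bs: "set bs \<subseteq> {1, 2}" and x: "golden \<le> x" "x \<le> silver" "foldr cf_block bs x = x"
    and z: "golden \<le> z" "z \<le> silver" "fold cf_block bs z = z"
    and s: "0 \<le> s'" "s' \<le> s" "s \<le> 1"
  defines "K \<equiv> \<lambda>s. path_sum (kern s) bs x z"
  shows "K s * path_sum (kern s') [1] golden golden \<le> K s' * path_sum (kern s) [1] golden golden"
    and "K s' * path_sum (kern s) [2] silver silver \<le> K s * path_sum (kern s') [2] silver silver"
proof -
  have pos: "0 < x" "0 < z" "set bs \<subseteq> {1..}" using x z golden_bounds bs by auto
  define q where "q = (\<lambda>x. let u = x + 1 / x in u * (5 - u\<^sup>2) * ((5 - s) * (5 - s') / ((u\<^sup>2 - s) * (u\<^sup>2 - s'))))"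
  have "path_sum q bs x z \<le> 4 * (x - foldr cf_block bs x) + 4 * (z - fold cf_block bs z)"
  proof (rule path_sum_telescope[OF _ bs x(1,2) z(1,2)])
    fix a :: nat and y assume a: "a \<in> {1, 2}" and y: "golden \<le> y" "y \<le> silver"
    have "block_sum q a y \<le> block_sum (\<lambda>x. qlow (x + 1 / x)) a y"
    proof (rule block_sum_mono)
      fix v :: real assume "1 < v"
      then have "2 \<le> v + 1 / v" by (intro add_inverse_ge_2) auto
      then show "q v \<le> qlow (v + 1 / v)"
        unfolding q_def Let_def using s by (intro low_ratio_bound) auto
    qed (use a y golden_bounds in auto)
    also have "\<dots> \<le> 4 * (y - cf_block a y)" by (rule qlow_block[OF a y])
    finally show "block_sum q a y \<le> 4 * (y - cf_block a y)" .
  qed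
  then have q0: "path_sum q bs x z \<le> 0" using x z by simp
  have "(5 - s) * K s - (5 - s') * K s' = path_sum (\<lambda>v. (5 - s) * kern s v + (- (5 - s')) * kern s' v) bs x z"
    unfolding K_def path_sum_linear by (simp add: algebra_simps)
  also have "\<dots> = path_sum (\<lambda>v. (s - s') / ((5 - s) * (5 - s')) * q v + 0 * q v) bs x z"
  proof (rule path_sum_cong[OF pos(3,1,2)])
    fix v :: real assume "1 \<le> v"
    then have "(5 - s) * kern s v - (5 - s') * kern s' v = (s - s') / ((5 - s) * (5 - s')) * q v"
      unfolding q_def Let_def using s by (intro kern_low) auto
    then show "(5 - s) * kern s v + (- (5 - s')) * kern s' v = (s - s') / ((5 - s) * (5 - s')) * q v + 0 * q v"
      by (simp only: mult_minus_left mult_zero_left add_0_right diff_conv_add_uminus)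
  qed
  also have "\<dots> = (s - s') / ((5 - s) * (5 - s')) * path_sum q bs x z"
    unfolding path_sum_linear by simp
  also have "\<dots> \<le> 0" using q0 s by (intro mult_nonneg_nonpos) auto
  finally have "(5 - s) * K s \<le> (5 - s') * K s'" by simp
  then have "4 * sqrt 5 * ((5 - s) * K s) / ((5 - s) * (5 - s')) \<le> 4 * sqrt 5 * ((5 - s') * K s') / ((5 - s) * (5 - s'))"
    using s by (intro divide_right_mono mult_left_mono) auto
  then show "K s * path_sum (kern s') [1] golden golden \<le> K s' * path_sum (kern s) [1] golden golden"
    unfolding golden_weight using s by (simp add: mult_ac)
  define p where "p = (\<lambda>v. qup s s' (v + 1 / v))"
  \<comment> \<open>Telescoping yields upper bounds, so it is applied to \<open>- p\<close> with
    constant -12 to bound \<open>p\<close> from below.\<close>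
  have "path_sum (\<lambda>v. (-1) * p v + 0 * p v) bs x z \<le> (-12) * (x - foldr cf_block bs x) + (-12) * (z - fold cf_block bs z)"
  proof (rule path_sum_telescope[OF _ bs x(1,2) z(1,2)])
    fix a :: nat and y assume a: "a \<in> {1, 2}" and y: "golden \<le> y" "y \<le> silver"
    show "block_sum (\<lambda>v. (-1) * p v + 0 * p v) a y \<le> - 12 * (y - cf_block a y)"
      unfolding block_sum_linear using qup_block[OF a y, of s s'] s by (simp add: p_def)
  qed
  then have p0: "0 \<le> path_sum p bs x z" unfolding path_sum_linear using x z by simp
  define g where "g = (\<lambda>s. kern s silver + kern s (sqrt 2))"
  define c where "c = (s - s') * (7 / 4 * sqrt 2 / ((8 - s) * (8 - s') * ((9 / 2 - s) * (9 / 2 - s'))))"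
  have "g s' * K s - g s * K s' = path_sum (\<lambda>v. g s' * kern s v + (- g s) * kern s' v) bs x z"
    unfolding K_def path_sum_linear by simp
  also have "\<dots> = path_sum (\<lambda>v. c * p v + 0 * p v) bs x z"
  proof (rule path_sum_cong[OF pos(3,1,2)])
    fix v :: real assume "1 \<le> v"
    then have "g s' * kern s v - g s * kern s' v = c * p v"
      unfolding g_def c_def p_def using s by (intro kern_up) auto
    then show "g s' * kern s v + (- g s) * kern s' v = c * p v + 0 * p v" by simp
  qed
  also have "\<dots> = c * path_sum p bs x z" unfolding path_sum_linear by simp
  also have "\<dots> \<ge> 0" using p0 s unfolding c_def by (intro mult_nonneg_nonneg divide_nonneg_nonneg) auto
  finally show "K s' * path_sum (kern s) [2] silver silver \<le> K s * path_sum (kern s') [2] silver silver"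
    unfolding silver_weight g_def by (simp add: algebra_simps)
qed

section \<open>Integrals along geodesics\<close>

text \<open>When \<open>p\<close> is the repelling and \<open>q\<close> the attracting fixed point,
  the bracket is sqrt D / Q(\<tau>, 1) split into partial fractions. In this shape it makes sense
  for any two real endpoints.\<close>

definition geodesic_form :: "(complex \<Rightarrow> complex) \<Rightarrow> real \<Rightarrow> real \<Rightarrow> complex \<Rightarrow> complex" where
  "geodesic_form f p q \<tau> = f \<tau> * (1 / (\<tau> - of_real p) - 1 / (\<tau> - of_real q))"

definition geodesic_integral :: "(complex \<Rightarrow> complex) \<Rightarrow> real \<Rightarrow> real \<Rightarrow> complex \<Rightarrow> complex \<Rightarrow> complex" where
  "geodesic_integral f p q a b = contour_integral (linepath a b) (geodesic_form f p q)"

definition modular_invariant :: "(complex \<Rightarrow> complex) \<Rightarrow> bool" where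
  "modular_invariant f \<longleftrightarrow> f holomorphic_on upper_half_plane \<and>
     (\<forall>A::int^2^2. det A = 1 \<longrightarrow> (\<forall>\<tau>\<in>upper_half_plane. f (moebius_map A \<tau>) = f \<tau>))"

lemma modular_invariant_const: "modular_invariant (\<lambda>_. c)"
  by (simp add: modular_invariant_def)

lemma uhp_minus_real_nonzero: "\<tau> \<in> upper_half_plane \<Longrightarrow> \<tau> - of_real p \<noteq> 0"
  by (auto simp: upper_half_plane_def complex_eq_iff)

lemma convex_uhp: "convex upper_half_plane" and open_uhp: "open upper_half_plane"
  unfolding upper_half_plane_def by (auto simp: convex_halfspace_Im_gt open_halfspace_Im_gt)

lemma geodesic_integral_primitive_iff:
  assumes G: "\<And>\<tau>. \<tau> \<in> upper_half_plane \<Longrightarrow> (G has_field_derivative geodesic_form f p q \<tau>) (at \<tau>)"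
    and "a \<in> upper_half_plane" "b \<in> upper_half_plane"
  shows "geodesic_integral f p q a b = G b - G a"
proof -
  have "closed_segment a b \<subseteq> upper_half_plane" using assms convex_uhp by (simp add: closed_segment_subset)
  then have "(geodesic_form f p q has_contour_integral (G (pathfinish (linepath a b)) - G (pathstart (linepath a b)))) (linepath a b)"
    by (intro contour_integral_primitive[of upper_half_plane]) (auto intro: G has_field_derivative_at_within)
  then show ?thesis by (simp add: geodesic_integral_def contour_integral_unique)
qed

lemma geodesic_form_primitive:
  assumes "f holomorphic_on upper_half_plane"
  obtains G where "\<And>\<tau>. \<tau> \<in> upper_half_plane \<Longrightarrow> (G has_field_derivative geodesic_form f p q \<tau>) (at \<tau>)"
proof -
  have "geodesic_form f p q holomorphic_on upper_half_plane"
    unfolding geodesic_form_def [abs_def]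
    by (intro holomorphic_intros assms uhp_minus_real_nonzero)
  from holomorphic_convex_primitive'[OF convex_uhp open_uhp this] show ?thesis
    using that open_uhp by (metis at_within_open)
qed

lemma geodesic_integral_add:
  assumes "f holomorphic_on upper_half_plane"
    "a \<in> upper_half_plane" "b \<in> upper_half_plane" "c \<in> upper_half_plane"
  shows "geodesic_integral f p q a c = geodesic_integral f p q a b + geodesic_integral f p q b c"
proof -
  obtain G where G: "\<And>\<tau>. \<tau> \<in> upper_half_plane \<Longrightarrow> (G has_field_derivative geodesic_form f p q \<tau>) (at \<tau>)"
    by (rule geodesic_form_primitive[OF assms(1)]) blast
  show ?thesis using assms by (simp add: geodesic_integral_primitive_iff[OF G])
qed

lemma geodesic_integral_refl [simp]: "geodesic_integral f p q a a = 0"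
  by (simp add: geodesic_integral_def)

lemma geodesic_integral_swap: "geodesic_integral f q p a b = - geodesic_integral f p q a b"
proof -
  have "geodesic_form f q p = (\<lambda>\<tau>. - geodesic_form f p q \<tau>)"
    by (auto simp: geodesic_form_def algebra_simps)
  then show ?thesis by (simp add: geodesic_integral_def contour_integral_neg)
qed

section \<open>Moebius invariance of the geodesic integral\<close>

definition moebius_denom :: "int^2^2 \<Rightarrow> 'a::field \<Rightarrow> 'a" where
  "moebius_denom A z = of_int (A$2$1) * z + of_int (A$2$2)"

lemma moebius_denom_of_real: "moebius_denom A (of_real x :: complex) = of_real (moebius_denom A x)"
  by (simp add: moebius_denom_def)

lemma moebius_map_of_real: "moebius_map A (of_real x :: complex) = of_real (moebius_map A x)"
  by (simp add: moebius_map_def)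

lemma moebius_map_diff:
  fixes z w :: "'a::field"
  assumes "det A = 1" "moebius_denom A z \<noteq> 0" "moebius_denom A w \<noteq> 0"
  shows "moebius_map A z - moebius_map A w = (z - w) / (moebius_denom A z * moebius_denom A w)"
proof -
  define a b c d where "a = (of_int (A$1$1) :: 'a)" and "b = (of_int (A$1$2) :: 'a)"
    and "c = (of_int (A$2$1) :: 'a)" and "d = (of_int (A$2$2) :: 'a)"
  have det: "a * d - b * c = 1" unfolding a_def b_def c_def d_def by (rule det_2_of_int[OF assms(1)])
  have dz: "c * z + d \<noteq> 0" "c * w + d \<noteq> 0"
    using assms(2,3) by (simp_all add: moebius_denom_def c_def d_def)
  have "(a * z + b) * (c * w + d) - (a * w + b) * (c * z + d) = (a * d - b * c) * (z - w)" by algebra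
  then have "(a * z + b) / (c * z + d) - (a * w + b) / (c * w + d) = (z - w) / ((c * z + d) * (c * w + d))"
    using dz det by (simp add: diff_frac_eq)
  then show ?thesis by (simp add: moebius_map_def moebius_denom_def a_def b_def c_def d_def)
qed

lemma moebius_map_mult:
  fixes z :: "'a::field"
  assumes "moebius_denom B z \<noteq> 0"
  shows "moebius_map (A ** B) z = moebius_map A (moebius_map B z)"
    and "moebius_denom (A ** B) z = moebius_denom A (moebius_map B z) * moebius_denom B z"
proof -
  define a b c d where "a = (of_int (A$1$1) :: 'a)" and "b = (of_int (A$1$2) :: 'a)"
    and "c = (of_int (A$2$1) :: 'a)" and "d = (of_int (A$2$2) :: 'a)"
  define a' b' c' d' where "a' = (of_int (B$1$1) :: 'a)" and "b' = (of_int (B$1$2) :: 'a)"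
    and "c' = (of_int (B$2$1) :: 'a)" and "d' = (of_int (B$2$2) :: 'a)"
  note defs = a_def b_def c_def d_def a'_def b'_def c'_def d'_def
  have e: "of_int ((A ** B)$1$1) = a * a' + b * c'" "of_int ((A ** B)$1$2) = a * b' + b * d'"
    "of_int ((A ** B)$2$1) = c * a' + d * c'" "of_int ((A ** B)$2$2) = c * b' + d * d'"
    by (simp_all add: defs matrix_matrix_mult_def sum_2)
  have nz: "c' * z + d' \<noteq> 0" using assms by (simp add: moebius_denom_def defs)
  have B: "moebius_map B z = (a' * z + b') / (c' * z + d')" by (simp add: moebius_map_def defs)
  show den: "moebius_denom (A ** B) z = moebius_denom A (moebius_map B z) * moebius_denom B z"
    unfolding B unfolding moebius_denom_def e unfolding defs[symmetric] using nz
    by (simp add: field_simps)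
  have "(a * a' + b * c') * z + (a * b' + b * d') = (a * moebius_map B z + b) * (c' * z + d')"
    unfolding B using nz by (simp add: field_simps)
  then show "moebius_map (A ** B) z = moebius_map A (moebius_map B z)"
    using den nz unfolding moebius_map_def[of "A ** B"] moebius_map_def[of A] e
    unfolding moebius_denom_def e unfolding defs[symmetric] by simp
qed

lemma moebius_denom_uhp:
  "det A = 1 \<Longrightarrow> \<tau> \<in> upper_half_plane \<Longrightarrow> moebius_denom A \<tau> \<noteq> (0::complex)"
  unfolding moebius_denom_def by (rule moebius_denominator_nonzero)

text \<open>Under the substitution each pole transforms up to a correction term c/(c\<tau> + d),
  where (c, d) is the lower row of \<open>A\<close>. The correction is the same for both poles and
  cancels in their difference.\<close>

lemma geodesic_form_moebius:
  assumes f: "modular_invariant f" and det: "det A = 1" and \<tau>: "\<tau> \<in> upper_half_plane"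
    and den: "moebius_denom A p \<noteq> 0" "moebius_denom A q \<noteq> 0"
  shows "geodesic_form f (moebius_map A p) (moebius_map A q) (moebius_map A \<tau>) * (1 / (moebius_denom A \<tau>)\<^sup>2)
    = geodesic_form f p q \<tau>"
proof -
  define D where "D = moebius_denom A \<tau>"
  have D: "D \<noteq> 0" unfolding D_def by (rule moebius_denom_uhp[OF det \<tau>])
  have frac: "1 / (moebius_map A \<tau> - of_real (moebius_map A r)) * (1 / D\<^sup>2) =
      1 / (\<tau> - of_real r) - of_int (A$2$1) / D" if r: "moebius_denom A r \<noteq> 0" for r
  proof -
    define E where "E = (of_real (moebius_denom A r) :: complex)"
    have E: "E \<noteq> 0" using r by (simp add: E_def)
    have "moebius_map A \<tau> - of_real (moebius_map A r) = (\<tau> - of_real r) / (D * E)"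
      using moebius_map_diff[OF det, of \<tau> "of_real r"] D E
      by (simp add: D_def E_def moebius_denom_of_real moebius_map_of_real)
    then have "1 / (moebius_map A \<tau> - of_real (moebius_map A r)) * (1 / D\<^sup>2) = E / ((\<tau> - of_real r) * D)"
      using D by (simp add: power2_eq_square)
    also have "E = D - of_int (A$2$1) * (\<tau> - of_real r)"
      by (simp add: D_def E_def moebius_denom_def algebra_simps)
    also have "(D - of_int (A$2$1) * (\<tau> - of_real r)) / ((\<tau> - of_real r) * D) = 1 / (\<tau> - of_real r) - of_int (A$2$1) / D"
      using D uhp_minus_real_nonzero[OF \<tau>] by (simp add: diff_divide_distrib)
    finally show ?thesis .
  qed
  have "f (moebius_map A \<tau>) = f \<tau>" using f det \<tau> by (simp add: modular_invariant_def)
  then have "geodesic_form f (moebius_map A p) (moebius_map A q) (moebius_map A \<tau>) * (1 / D\<^sup>2) =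
      f \<tau> * (1 / (moebius_map A \<tau> - of_real (moebius_map A p)) * (1 / D\<^sup>2) -
        1 / (moebius_map A \<tau> - of_real (moebius_map A q)) * (1 / D\<^sup>2))"
    unfolding geodesic_form_def by (simp only: left_diff_distrib mult.assoc)
  also have "\<dots> = geodesic_form f p q \<tau>"
    unfolding frac[OF den(1)] frac[OF den(2)] geodesic_form_def by simp
  finally show ?thesis unfolding D_def .
qed

lemma geodesic_integral_moebius:
  assumes f: "modular_invariant f" and det: "det A = 1"
    and ab: "a \<in> upper_half_plane" "b \<in> upper_half_plane"
    and den: "moebius_denom A p \<noteq> 0" "moebius_denom A q \<noteq> 0"
  shows "geodesic_integral f (moebius_map A p) (moebius_map A q) (moebius_map A a) (moebius_map A b) =
    geodesic_integral f p q a b"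
proof -
  have hol: "f holomorphic_on upper_half_plane" using f by (simp add: modular_invariant_def)
  obtain G where G: "\<And>\<tau>. \<tau> \<in> upper_half_plane \<Longrightarrow>
      (G has_field_derivative geodesic_form f (moebius_map A p) (moebius_map A q) \<tau>) (at \<tau>)"
    by (rule geodesic_form_primitive[OF hol]) blast
  have inH: "moebius_map A \<tau> \<in> upper_half_plane" if "\<tau> \<in> upper_half_plane" for \<tau>
    by (rule moebius_in_upper_half_plane[OF det that])
  have "((\<lambda>\<tau>. G (moebius_map A \<tau>)) has_field_derivative geodesic_form f p q \<tau>) (at \<tau>)"
    if \<tau>: "\<tau> \<in> upper_half_plane" for \<tau>
    using DERIV_chain2[OF G[OF inH[OF \<tau>]] moebius_map_has_field_derivative[OF det]]
      moebius_denom_uhp[OF det \<tau>] geodesic_form_moebius[OF f det \<tau> den]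
    by (simp add: moebius_denom_def)
  from geodesic_integral_primitive_iff[OF this ab] geodesic_integral_primitive_iff[OF G inH[OF ab(1)] inH[OF ab(2)]]
  show ?thesis by simp
qed

lemma geodesic_integral_period:
  assumes f: "modular_invariant f" and det: "det A = 1"
    and fixed: "fixes_point A p" "fixes_point A q"
    and ab: "a \<in> upper_half_plane" "b \<in> upper_half_plane"
  shows "geodesic_integral f p q a (moebius_map A a) = geodesic_integral f p q b (moebius_map A b)"
proof -
  have hol: "f holomorphic_on upper_half_plane" using f by (simp add: modular_invariant_def)
  note H = ab moebius_in_upper_half_plane[OF det ab(1)] moebius_in_upper_half_plane[OF det ab(2)]
  have "geodesic_integral f p q (moebius_map A a) (moebius_map A b) = geodesic_integral f p q a b"
    using geodesic_integral_moebius[OF f det ab, of p q] fixed by (simp add: fixes_point_def moebius_denom_def)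
  moreover have "geodesic_integral f p q a (moebius_map A b) =
      geodesic_integral f p q a (moebius_map A a) + geodesic_integral f p q (moebius_map A a) (moebius_map A b)"
    "geodesic_integral f p q a (moebius_map A b) =
      geodesic_integral f p q a b + geodesic_integral f p q b (moebius_map A b)"
    using H by (auto intro!: geodesic_integral_add[OF hol])
  ultimately show ?thesis by simp
qed

text \<open>Subtracting the linear function with the right slope makes \<open>g\<close> periodic, hence bounded.\<close>

lemma mean_of_two_periods:
  fixes g :: "real \<Rightarrow> complex"
  assumes cont: "continuous_on UNIV g" and ab: "a \<noteq> 0" "b \<noteq> 0"
    and per: "\<And>u. g (u + a) - g u = c" "\<And>u. g (u + b) - g u = d"
  shows "c / of_real a = d / of_real b"
proof -
  have bdd: "\<exists>B. \<forall>u. norm (g u - of_real u * (c / of_real a)) \<le> B"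
    if a: "a \<noteq> 0" and per: "\<And>u. g (u + a) - g u = c" for a c
  proof -
    define h where "h = (\<lambda>u. g u - of_real u * (c / of_real a))"
    have h: "h (u + a) = h u" for u
    proof -
      have "g (u + a) = g u + c" using per[of u] by (simp add: algebra_simps)
      then show ?thesis using a by (simp add: h_def field_simps)
    qed
    have hn: "h (u + of_int n * a) = h u" for u n
    proof (induction n rule: int_induct[where k = 0])
      case (step1 i)
      then show ?case using h[of "u + of_int i * a"] by (simp add: algebra_simps)
    next
      case (step2 i)
      then show ?case using h[of "u + of_int (i - 1) * a"] by (simp add: algebra_simps)
    qed simp
    have "compact (h ` {-\<bar>a\<bar>..\<bar>a\<bar>})"
      unfolding h_def by (intro compact_continuous_image continuous_intros continuous_on_subset[OF cont]) auto
    then obtain B where B: "\<And>u. u \<in> {-\<bar>a\<bar>..\<bar>a\<bar>} \<Longrightarrow> norm (h u) \<le> B"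
      by (meson bounded_iff compact_imp_bounded image_eqI)
    have "norm (h u) \<le> B" for u
    proof -
      define n where "n = \<lfloor>u / a\<rfloor>"
      have "0 \<le> u / a - of_int n" "u / a - of_int n \<le> 1" unfolding n_def by linarith+
      then have "\<bar>(u / a - of_int n) * a\<bar> \<le> 1 * \<bar>a\<bar>" unfolding abs_mult by (intro mult_right_mono) auto
      moreover have "(u / a - of_int n) * a = u + of_int (- n) * a" using a by (simp add: field_simps)
      ultimately have "u + of_int (- n) * a \<in> {-\<bar>a\<bar>..\<bar>a\<bar>}" by auto
      from B[OF this] show ?thesis unfolding hn .
    qed
    then show ?thesis unfolding h_def by blast
  qed
  obtain B where B: "\<And>u. norm (g u - of_real u * (c / of_real a)) \<le> B" using bdd[OF ab(1) per(1)] by blast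
  obtain C where C: "\<And>u. norm (g u - of_real u * (d / of_real b)) \<le> C" using bdd[OF ab(2) per(2)] by blast
  define e where "e = c / of_real a - d / of_real b"
  have bnd: "\<bar>u\<bar> * norm e \<le> B + C" for u :: real
  proof -
    have "of_real u * e = (g u - of_real u * (d / of_real b)) - (g u - of_real u * (c / of_real a))"
      by (simp add: e_def algebra_simps)
    moreover have "norm ((g u - of_real u * (d / of_real b)) - (g u - of_real u * (c / of_real a))) \<le> C + B"
      by (intro norm_triangle_le_diff add_mono B C)
    ultimately have "norm (of_real u * e) \<le> C + B" by (simp only:)
    then show ?thesis by (simp add: norm_mult)
  qed
  have "norm e = 0"
  proof (rule ccontr)
    assume "norm e \<noteq> 0"
    then have "norm e > 0" by simp
    have "0 \<le> B + C" using bnd[of 0] by simp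
    then have "\<bar>(B + C + 1) / norm e\<bar> * norm e = B + C + 1" using \<open>norm e > 0\<close> by simp
    then show False using bnd[of "(B + C + 1) / norm e"] by simp
  qed
  then show ?thesis by (simp add: e_def)
qed

section \<open>Hyperbolic matrices with a common fixed point\<close>

lemma hyperbolic_fixes_iff:
  assumes "hyperbolic A"
  shows "fixes_point A x \<longleftrightarrow>
    of_int (A$2$1) * x\<^sup>2 + of_int (A$2$2 - A$1$1) * x - of_int (A$1$2) = 0"
proof -
  have c: "real_of_int (A$2$1) \<noteq> 0" using hyperbolic_lower_left_nonzero[OF assms] by simp
  have d: "real_of_int (A$1$1) * of_int (A$2$2) - of_int (A$1$2) * of_int (A$2$1) = 1"
    by (rule det_2_of_int[OF hyperbolic_det[OF assms]])
  have "(of_int (A$2$1) * x + of_int (A$2$2))\<^sup>2 - of_int (A$1$1 + A$2$2) * (of_int (A$2$1) * x + of_int (A$2$2)) + 1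
    = of_int (A$2$1) * (of_int (A$2$1) * x\<^sup>2 + of_int (A$2$2 - A$1$1) * x - of_int (A$1$2))"
    using d by (simp add: power2_eq_square) algebra
  then show ?thesis unfolding fixes_point_iff[OF assms] using c by simp
qed

text \<open>The denominator cx + d is a root of the monic polynomial u^2 - tu + 1, with t the trace.
  A rational root would be 1 or -1, which forces \<bar>t\<bar> = 2.\<close>

lemma hyperbolic_fixed_irrational:
  assumes A: "hyperbolic A" and x: "fixes_point A x"
  shows "x \<notin> \<rat>"
proof
  assume "x \<in> \<rat>"
  define u t where "u = of_int (A$2$1) * x + of_int (A$2$2)" and "t = A$1$1 + A$2$2"
  have "u \<in> \<rat>" unfolding u_def using \<open>x \<in> \<rat>\<close> by (intro Rats_add Rats_mult) auto
  have u: "u\<^sup>2 - of_int t * u + 1 = 0"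
    using fixes_point_iff[OF A, of x] x by (simp add: u_def t_def)
  from \<open>u \<in> \<rat>\<close> obtain m n where mn: "u = of_int m / of_int n" "n > 0" "coprime m n"
    by (metis Rats_cases' of_int_of_nat_eq)
  have "(of_int m)\<^sup>2 - of_int t * of_int m * of_int n + (of_int n)\<^sup>2 = (u\<^sup>2 - of_int t * u + 1) * (of_int n)\<^sup>2"
  proof -
    have "of_int m = u * of_int n" using mn by simp
    then show ?thesis by (simp only:) (simp add: power2_eq_square algebra_simps)
  qed
  then have "real_of_int (m\<^sup>2 - t * m * n + n\<^sup>2) = 0" using u by simp
  then have e: "m\<^sup>2 - t * m * n + n\<^sup>2 = 0" by (simp only: of_int_eq_0_iff)
  then have "m\<^sup>2 = n * (t * m - n)" "n\<^sup>2 = m * (t * n - m)" by (simp_all add: power2_eq_square algebra_simps)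
  then have "n dvd m\<^sup>2" "m dvd n\<^sup>2" by (metis dvd_triv_left)+
  moreover have "coprime n (m\<^sup>2)" "coprime m (n\<^sup>2)" using mn(3) by (simp_all add: coprime_commute)
  ultimately have "is_unit n" "is_unit m" by (metis coprime_absorb_left)+
  then have "n = 1" "m = 1 \<or> m = -1" using mn(2) by (auto simp: zdvd1_eq)
  then have "\<bar>t\<bar> = 2" using e by auto
  moreover have "\<bar>t\<bar> > 2" using A by (simp add: hyperbolic_def trace_def sum_2 t_def)
  ultimately show False by simp
qed

text \<open>Both fixed point equations are integral quadratics with the irrational root
  \<open>p\<close>. They are therefore proportional and share the second root.\<close>

lemma hyperbolic_common_fixed_points:
  assumes A: "hyperbolic A" and B: "hyperbolic B"
    and p: "fixes_point A p" "fixes_point B p" and q: "fixes_point B q"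
  shows "fixes_point A q"
proof -
  have irr: "p \<notin> \<rat>" by (rule hyperbolic_fixed_irrational[OF A p(1)])
  define a b c where "a = A$2$1" and "b = A$2$2 - A$1$1" and "c = - A$1$2"
  define a' b' c' where "a' = B$2$1" and "b' = B$2$2 - B$1$1" and "c' = - B$1$2"
  have pA: "of_int a * p\<^sup>2 + of_int b * p + of_int c = 0"
    using p(1) by (simp add: hyperbolic_fixes_iff[OF A] a_def b_def c_def)
  have pB: "of_int a' * p\<^sup>2 + of_int b' * p + of_int c' = 0"
    using p(2) by (simp add: hyperbolic_fixes_iff[OF B] a'_def b'_def c'_def)
  have qB: "of_int a' * q\<^sup>2 + of_int b' * q + of_int c' = 0"
    using q by (simp add: hyperbolic_fixes_iff[OF B] a'_def b'_def c'_def)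
  have a': "a' \<noteq> 0" using hyperbolic_lower_left_nonzero[OF B] by (simp add: a'_def)
  have lin: "of_int (a' * b - a * b') * p = real_of_int (a * c' - a' * c)"
    using pA pB by simp algebra
  have "a' * b - a * b' = 0"
  proof (rule ccontr)
    assume "a' * b - a * b' \<noteq> 0"
    then have "p = of_int (a * c' - a' * c) / of_int (a' * b - a * b')"
      using lin by (simp add: eq_divide_eq mult.commute del: of_int_diff of_int_mult)
    then have "p \<in> \<rat>" by (simp del: of_int_diff of_int_mult)
    then show False using irr by simp
  qed
  then have e1: "a' * b = a * b'" by simp
  have "real_of_int (a * c' - a' * c) = 0" unfolding lin[symmetric] using e1 by simp
  then have e2: "a * c' = a' * c" by (simp only: of_int_eq_0_iff right_minus_eq)
  have f1: "real_of_int a' * of_int b = of_int a * of_int b'" using e1 by (metis of_int_mult)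
  have f2: "real_of_int a * of_int c' = of_int a' * of_int c" using e2 by (metis of_int_mult)
  have "of_int a' * (of_int a * q\<^sup>2 + of_int b * q + of_int c) = of_int a * (of_int a' * q\<^sup>2 + of_int b' * q + of_int c')"
    using f1 f2 by algebra
  then have "of_int a * q\<^sup>2 + of_int b * q + of_int c = 0" using qB a' by simp
  then show ?thesis by (simp add: hyperbolic_fixes_iff[OF A] a_def b_def c_def)
qed

text \<open>The constant is 1 or -1, according to which of \<open>p\<close> and \<open>q\<close> is
  repelling. It does not depend on \<open>f\<close>, so it cancels in the quotient that defines
  \<open>val\<close>.\<close>

lemma cycle_integral_eq_geodesic_integral:
  assumes A: "hyperbolic A" and pq: "fixes_point A p" "fixes_point A q" "p \<noteq> q"
  obtains \<sigma> :: complex where "\<sigma> \<noteq> 0"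
    "\<And>f. f holomorphic_on upper_half_plane \<Longrightarrow>
      cycle_integral f A = \<sigma> * geodesic_integral f p q \<i> (moebius_map A \<i>)"
proof -
  obtain w w' where w: "repelling_fixed_point A w" "attracting_fixed_point A w'" "w \<noteq> w'"
    "\<And>x. repelling_fixed_point A x \<longleftrightarrow> x = w" "\<And>x. attracting_fixed_point A x \<longleftrightarrow> x = w'"
    by (rule hyperbolic_fixed_points[OF A]) blast
  have det: "det A = 1" by (rule hyperbolic_det[OF A])
  have c: "real_of_int (A$2$1) \<noteq> 0" using hyperbolic_lower_left_nonzero[OF A] by simp
  have only: "x = w \<or> x = w'" if "fixes_point A x" for x
  proof -
    let ?P = "\<lambda>x. of_int (A$2$1) * x\<^sup>2 + of_int (A$2$2 - A$1$1) * x - real_of_int (A$1$2)"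
    have r: "?P w = 0" "?P w' = 0" "?P x = 0"
      using w(1,2) that unfolding repelling_fixed_point_def attracting_fixed_point_def hyperbolic_fixes_iff[OF A] by auto
    then have "of_int (A$2$2 - A$1$1) = - of_int (A$2$1) * (w + w')" "- real_of_int (A$1$2) = of_int (A$2$1) * (w * w')"
      using quadratic_coeffs_from_roots[of "of_int (A$2$1)" w "of_int (A$2$2 - A$1$1)" "- of_int (A$1$2)" w'] w(3)
      by simp_all
    then have "?P x = of_int (A$2$1) * ((x - w) * (x - w'))" by algebra
    then show ?thesis using r c by simp
  qed
  obtain a b e where Q: "form_of A = (a, b, e)" by (metis prod_cases3)
  have "is_form_of A (a, b, e)" using is_form_of_form_of[OF A] Q by simp
  then have roots: "of_int a * w\<^sup>2 + of_int b * w + of_int e = 0" "of_int a * w'\<^sup>2 + of_int b * w' + of_int e = 0"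
    and sg: "sgn (real_of_int a) = sgn (w - w')"
    by (simp_all add: is_form_of_def w(4,5))
  note co = quadratic_coeffs_from_roots[OF roots w(3)]
  have "real_of_int (b\<^sup>2 - 4 * a * e) = (of_int a * (w - w'))\<^sup>2"
    using co unfolding of_int_diff of_int_mult of_int_power of_int_numeral by algebra
  \<comment> \<open>The sign condition in the choice of the form selects the square root of the
    discriminant.\<close>
  moreover have pos: "of_int a * (w - w') > 0"
    using sg w(3) by (auto simp: sgn_if zero_less_mult_iff split: if_splits)
  ultimately have D: "sqrt (real_of_int (b\<^sup>2 - 4 * a * e)) = of_int a * (w - w')" by simp
  have a0: "a \<noteq> 0" using pos by auto
  have integrand: "cycle_integrand f A \<tau> = geodesic_form f w w' \<tau>" if \<tau>: "\<tau> \<in> upper_half_plane" for f \<tau>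
  proof -
    have nz: "\<tau> - of_real w \<noteq> 0" "\<tau> - of_real w' \<noteq> 0" using uhp_minus_real_nonzero[OF \<tau>] by auto
    have cb: "of_int b = - of_int a * (of_real w + of_real w' :: complex)" "of_int e = of_int a * (of_real w * of_real w' :: complex)"
      using co by (metis of_real_add of_real_minus of_real_mult of_real_of_int_eq, metis of_real_mult of_real_of_int_eq)
    have "eval_form (form_of A) \<tau> 1 = of_int a * ((\<tau> - of_real w) * (\<tau> - of_real w'))"
      by (simp add: Q cb power2_eq_square algebra_simps)
    then have "cycle_integrand f A \<tau> = f \<tau> * (of_int a * (of_real w - of_real w')) / (of_int a * ((\<tau> - of_real w) * (\<tau> - of_real w')))"
      unfolding cycle_integrand_def using D by (simp add: Q)
    also have "\<dots> = f \<tau> * ((of_real w - of_real w') / ((\<tau> - of_real w) * (\<tau> - of_real w')))"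
      using a0 by simp
    also have "(of_real w - of_real w') / ((\<tau> - of_real w) * (\<tau> - of_real w')) = 1 / (\<tau> - of_real w) - 1 / (\<tau> - of_real w')"
      using nz by (simp add: field_simps)
    finally show ?thesis by (simp add: geodesic_form_def)
  qed
  have i: "\<i> \<in> upper_half_plane" by (simp add: upper_half_plane_def)
  have "closed_segment \<i> (moebius_map A \<i>) \<subseteq> upper_half_plane"
    using i moebius_in_upper_half_plane[OF det i] convex_uhp by (simp add: closed_segment_subset)
  then have cy: "cycle_integral f A = geodesic_integral f w w' \<i> (moebius_map A \<i>)" for f
    unfolding cycle_integral_def geodesic_integral_def
    by (intro contour_integral_eq integrand) auto
  have "(p = w \<and> q = w') \<or> (p = w' \<and> q = w)" using only[OF pq(1)] only[OF pq(2)] pq(3) by auto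
  then show ?thesis
  proof
    assume "p = w \<and> q = w'" then show ?thesis using that[of 1] cy by simp
  next
    assume "p = w' \<and> q = w"
    then show ?thesis using that[of "-1"] cy geodesic_integral_swap[of _ w w'] by simp
  qed
qed

text \<open>The coordinate (\<tau> - p)/(\<tau> - q) sends the geodesic to half of the imaginary
  axis, and its logarithm is the parameter \<open>u\<close> up to a constant. There the form becomes
  f du, and a matrix fixing both ends multiplies the coordinate by a positive number, hence
  translates \<open>u\<close>.\<close>

lemma geodesic_param:
  assumes pq: "p \<noteq> (q::real)"
  obtains \<gamma> :: "real \<Rightarrow> complex" where
    "\<And>u. \<gamma> u \<in> upper_half_plane"
    "\<And>f G u. (G has_field_derivative geodesic_form f p q (\<gamma> u)) (at (\<gamma> u)) \<Longrightarrow>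
        ((\<lambda>u. G (\<gamma> u)) has_vector_derivative f (\<gamma> u)) (at u)"
    "\<And>A. hyperbolic A \<Longrightarrow> fixes_point A p \<Longrightarrow> fixes_point A q \<Longrightarrow>
        \<exists>l. l \<noteq> 0 \<and> (\<forall>u. moebius_map A (\<gamma> u) = \<gamma> (u + l))"
proof -
  \<comment> \<open>The sign chooses the half of the imaginary axis that corresponds to the upper
    half plane.\<close>
  define \<sigma> where "\<sigma> = sgn (p - q)"
  have \<sigma>: "\<sigma> \<noteq> 0" "\<sigma> * (p - q) > 0" "\<sigma> * \<sigma> = 1" using pq by (auto simp: \<sigma>_def sgn_if)
  define \<zeta> where "\<zeta> = (\<lambda>u. \<i> * of_real (\<sigma> * exp u))"
  define \<gamma> where "\<gamma> = (\<lambda>u. (of_real p - \<zeta> u * of_real q) / (1 - \<zeta> u))"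
  have \<zeta>1: "1 - \<zeta> u \<noteq> 0" for u by (auto simp: \<zeta>_def complex_eq_iff)
  have \<zeta>0: "\<zeta> u \<noteq> 0" for u using \<sigma> by (auto simp: \<zeta>_def)
  have Pp: "\<gamma> u - of_real p = \<zeta> u * of_real (p - q) / (1 - \<zeta> u)" for u
    using \<zeta>1[of u] by (simp add: \<gamma>_def field_simps)
  have Pq: "\<gamma> u - of_real q = of_real (p - q) / (1 - \<zeta> u)" for u
    using \<zeta>1[of u] by (simp add: \<gamma>_def field_simps)
  have H: "\<gamma> u \<in> upper_half_plane" for u
  proof -
    have "Im (\<gamma> u) = \<sigma> * exp u * (p - q) / (1 + (\<sigma> * exp u)\<^sup>2)"
      by (simp add: \<gamma>_def \<zeta>_def Im_divide algebra_simps)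
    moreover have "\<sigma> * exp u * (p - q) > 0" using mult_pos_pos[OF \<sigma>(2) exp_gt_zero[of u]] by (simp only: mult_ac)
    ultimately show ?thesis by (auto simp: upper_half_plane_def intro!: divide_pos_pos add_pos_nonneg)
  qed
  have deriv: "(\<gamma> has_vector_derivative (\<zeta> u * of_real (p - q) / (1 - \<zeta> u)\<^sup>2)) (at u)" for u
  proof -
    have z: "(\<zeta> has_vector_derivative \<zeta> u) (at u)"
      unfolding \<zeta>_def by (auto intro!: derivative_eq_intros)
    have "((\<lambda>z. (of_real p - z * of_real q) / (1 - z)) has_field_derivative (of_real (p - q) / (1 - \<zeta> u)\<^sup>2)) (at (\<zeta> u))"
      using \<zeta>1[of u] by (auto intro!: derivative_eq_intros simp: power2_eq_square algebra_simps)
    from field_vector_diff_chain_at[OF z this] show ?thesis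
      by (simp add: \<gamma>_def o_def)
  qed
  show ?thesis
  proof (rule that[of \<gamma>])
    show "\<gamma> u \<in> upper_half_plane" for u by (rule H)
    fix f G u assume "(G has_field_derivative geodesic_form f p q (\<gamma> u)) (at (\<gamma> u))"
    from field_vector_diff_chain_at[OF deriv this]
    have "((\<lambda>u. G (\<gamma> u)) has_vector_derivative (\<zeta> u * of_real (p - q) / (1 - \<zeta> u)\<^sup>2) * geodesic_form f p q (\<gamma> u)) (at u)"
      by (simp add: o_def)
    moreover have "(\<zeta> u * of_real (p - q) / (1 - \<zeta> u)\<^sup>2) * geodesic_form f p q (\<gamma> u) = f (\<gamma> u)"
    proof -
      define k z where "k = (of_real (p - q) :: complex)" and "z = \<zeta> u"
      have nz: "k \<noteq> 0" "z \<noteq> 0" "1 - z \<noteq> 0" using pq \<zeta>0 \<zeta>1 by (auto simp: k_def z_def)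
      have "z * k / (1 - z)\<^sup>2 * (1 / (z * k / (1 - z)) - 1 / (k / (1 - z))) = 1"
        using nz by (simp add: divide_simps power2_eq_square) (simp add: algebra_simps)
      then have "f (\<gamma> u) * (z * k / (1 - z)\<^sup>2 * (1 / (z * k / (1 - z)) - 1 / (k / (1 - z)))) = f (\<gamma> u)"
        by (simp only: mult_1_right)
      then show ?thesis unfolding geodesic_form_def Pp Pq k_def z_def by (simp only: mult.left_commute)
    qed
    ultimately show "((\<lambda>u. G (\<gamma> u)) has_vector_derivative f (\<gamma> u)) (at u)" by simp
  next
    fix A :: "int^2^2" assume A: "hyperbolic A" and fp: "fixes_point A p" "fixes_point A q"
    have det: "det A = 1" by (rule hyperbolic_det[OF A])
    define dp dq where "dp = moebius_denom A p" and "dq = moebius_denom A q"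
    have c: "real_of_int (A$2$1) \<noteq> 0" using hyperbolic_lower_left_nonzero[OF A] by simp
    have dne: "dp \<noteq> dq" using c pq by (simp add: dp_def dq_def moebius_denom_def)
    \<comment> \<open>The denominators at the two fixed points are the eigenvalues of
      \<open>A\<close>, with product \<open>det A\<close>.\<close>
    have prod: "dp * dq = 1"
    proof -
      have d: "real_of_int (A$1$1) * of_int (A$2$2) - of_int (A$1$2) * of_int (A$2$1) = 1"
        by (rule det_2_of_int[OF det])
      have "of_int (A$2$1) * p\<^sup>2 + of_int (A$2$2 - A$1$1) * p + - real_of_int (A$1$2) = 0"
        "of_int (A$2$1) * q\<^sup>2 + of_int (A$2$2 - A$1$1) * q + - real_of_int (A$1$2) = 0"
        using fp unfolding hyperbolic_fixes_iff[OF A] by simp_all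
      from quadratic_coeffs_from_roots[OF this pq] d show ?thesis
        unfolding dp_def dq_def moebius_denom_def by simp algebra
    qed
    define \<mu> where "\<mu> = dq / dp"
    have dp0: "dp \<noteq> 0" "dq \<noteq> 0" using prod by auto
    have \<mu>: "\<mu> = dq\<^sup>2" using prod dp0 by (simp add: \<mu>_def field_simps power2_eq_square)
    have \<mu>0: "\<mu> > 0" unfolding \<mu> using dp0 by simp
    have \<mu>1: "\<mu> \<noteq> 1" using dne dp0 by (simp add: \<mu>_def)
    have "moebius_map A (\<gamma> u) = \<gamma> (u + ln \<mu>)" for u
    proof -
      define D where "D = moebius_denom A (\<gamma> u)"
      have D: "D \<noteq> 0" unfolding D_def by (rule moebius_denom_uhp[OF det H])
      have m: "moebius_map A (\<gamma> u) - of_real r = (\<gamma> u - of_real r) / (D * of_real (moebius_denom A r))"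
        if "fixes_point A r" for r
      proof -
        have "moebius_denom A r \<noteq> 0" "moebius_map A r = r"
          using that by (auto simp: fixes_point_def moebius_denom_def)
        then show ?thesis using moebius_map_diff[OF det, of "\<gamma> u" "of_real r"] D
          by (simp add: D_def moebius_denom_of_real moebius_map_of_real)
      qed
      define T where "T = moebius_map A (\<gamma> u)"
      have Tq: "T - of_real q \<noteq> 0"
        unfolding T_def by (rule uhp_minus_real_nonzero[OF moebius_in_upper_half_plane[OF det H]])
      have "\<zeta> (u + ln \<mu>) = \<zeta> u * of_real \<mu>" using \<mu>0 by (simp add: \<zeta>_def exp_add)
      also have "\<dots> * (T - of_real q) = T - of_real p"
        unfolding T_def m[OF fp(1)] m[OF fp(2)] Pp Pq dp_def[symmetric] dq_def[symmetric] \<mu>_def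
        using D dp0 by simp
      finally have "\<zeta> (u + ln \<mu>) * (T - of_real q) = T - of_real p" .
      then have "T * (1 - \<zeta> (u + ln \<mu>)) = of_real p - \<zeta> (u + ln \<mu>) * of_real q" by (simp add: algebra_simps)
      then have "T = \<gamma> (u + ln \<mu>)" unfolding \<gamma>_def using \<zeta>1[of "u + ln \<mu>"] by (simp add: eq_divide_eq)
      then show ?thesis by (simp add: T_def)
    qed
    then show "\<exists>l. l \<noteq> 0 \<and> (\<forall>u. moebius_map A (\<gamma> u) = \<gamma> (u + l))"
      using \<mu>0 \<mu>1 by (intro exI[of _ "ln \<mu>"]) simp
  qed
qed

text \<open>The matrix chosen in \<open>val\<close> and the given \<open>B\<close> both translate
  the same geodesic. The primitive of the form along it has constant increments over both
  translation lengths, so \<open>mean_of_two_periods\<close> equates the two quotients.\<close>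

lemma val_eq_geodesic_integral:
  assumes f: "modular_invariant f" and B: "hyperbolic B" "fixes_point B p" "fixes_point B q" and pq: "p \<noteq> q"
    and \<tau>: "\<tau> \<in> upper_half_plane"
  shows "val f p = geodesic_integral f p q \<tau> (moebius_map B \<tau>) / geodesic_integral (\<lambda>_. 1) p q \<tau> (moebius_map B \<tau>)"
    and "geodesic_integral (\<lambda>_. 1) p q \<tau> (moebius_map B \<tau>) \<in> \<real> - {0}"
proof -
  define A where "A = (SOME A. hyperbolic A \<and> fixes_point A p)"
  have "hyperbolic A \<and> fixes_point A p" unfolding A_def by (rule someI[of _ B]) (use B in auto)
  then have A: "hyperbolic A" "fixes_point A p" by auto
  have Aq: "fixes_point A q" by (rule hyperbolic_common_fixed_points[OF A(1) B(1) A(2) B(2,3)])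
  obtain \<gamma> :: "real \<Rightarrow> complex" where \<gamma>: "\<And>u. \<gamma> u \<in> upper_half_plane"
    "\<And>f G u. (G has_field_derivative geodesic_form f p q (\<gamma> u)) (at (\<gamma> u)) \<Longrightarrow>
        ((\<lambda>u. G (\<gamma> u)) has_vector_derivative f (\<gamma> u)) (at u)"
    "\<And>A. hyperbolic A \<Longrightarrow> fixes_point A p \<Longrightarrow> fixes_point A q \<Longrightarrow>
        \<exists>l. l \<noteq> 0 \<and> (\<forall>u. moebius_map A (\<gamma> u) = \<gamma> (u + l))"
    by (rule geodesic_param[OF pq]) blast
  obtain a where a: "a \<noteq> 0" "\<And>u. moebius_map A (\<gamma> u) = \<gamma> (u + a)" using \<gamma>(3)[OF A Aq] by blast
  obtain b where b: "b \<noteq> 0" "\<And>u. moebius_map B (\<gamma> u) = \<gamma> (u + b)" using \<gamma>(3)[OF B] by blast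
  \<comment> \<open>The parameter \<open>u\<close> is arbitrary here, which gives the same increment
    from every starting point.\<close>
  have per: "geodesic_integral f p q \<tau> (moebius_map C \<tau>) = g (u + l) - g u"
    if f: "modular_invariant f" and C: "hyperbolic C" "fixes_point C p" "fixes_point C q" and l: "\<And>u. moebius_map C (\<gamma> u) = \<gamma> (u + l)"
      and g: "\<And>u. g u = G (\<gamma> u)" and G: "\<And>\<tau>. \<tau> \<in> upper_half_plane \<Longrightarrow> (G has_field_derivative geodesic_form f p q \<tau>) (at \<tau>)"
      and \<tau>: "\<tau> \<in> upper_half_plane"
    for f C l g G u \<tau>
  proof -
    have "geodesic_integral f p q \<tau> (moebius_map C \<tau>) = geodesic_integral f p q (\<gamma> u) (\<gamma> (u + l))"
      using geodesic_integral_period[OF f hyperbolic_det[OF C(1)] C(2,3) \<tau> \<gamma>(1)[of u]] l by simp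
    also have "\<dots> = G (\<gamma> (u + l)) - G (\<gamma> u)" by (rule geodesic_integral_primitive_iff[OF G \<gamma>(1) \<gamma>(1)])
    finally show ?thesis unfolding g .
  qed
  \<comment> \<open>Along the geodesic a primitive for the constant 1 is \<open>u\<close> plus a
    constant, so the integral is the translation length.\<close>
  have one: "geodesic_integral (\<lambda>_. 1) p q \<tau> (moebius_map C \<tau>) = of_real l"
    if C: "hyperbolic C" "fixes_point C p" "fixes_point C q" and l: "\<And>u. moebius_map C (\<gamma> u) = \<gamma> (u + l)"
      and \<tau>: "\<tau> \<in> upper_half_plane" for C l \<tau>
  proof -
    obtain G where G: "\<And>\<tau>. \<tau> \<in> upper_half_plane \<Longrightarrow> (G has_field_derivative geodesic_form (\<lambda>_. 1) p q \<tau>) (at \<tau>)"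
      by (rule geodesic_form_primitive[of "\<lambda>_. 1" p q]) auto
    define k where "k = (\<lambda>u. G (\<gamma> u) - of_real u)"
    have "(k has_vector_derivative 0) (at u)" for u
      unfolding k_def using \<gamma>(2)[OF G[OF \<gamma>(1)]] by (auto intro!: derivative_eq_intros)
    then have "k (0 + l) = k 0"
      using has_vector_derivative_zero_constant[of UNIV k] by (metis UNIV_I convex_UNIV)
    then show ?thesis using per[OF modular_invariant_const C l refl G \<tau>, of 0] by (simp add: k_def algebra_simps)
  qed
  have hol: "f holomorphic_on upper_half_plane" using f by (simp add: modular_invariant_def)
  obtain G where G: "\<And>\<tau>. \<tau> \<in> upper_half_plane \<Longrightarrow> (G has_field_derivative geodesic_form f p q \<tau>) (at \<tau>)"
    by (rule geodesic_form_primitive[OF hol]) blast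
  have i: "\<i> \<in> upper_half_plane" by (simp add: upper_half_plane_def)
  have cont: "continuous_on UNIV (\<lambda>u. G (\<gamma> u))"
    using \<gamma>(2)[OF G[OF \<gamma>(1)]] by (intro continuous_at_imp_continuous_on) (auto intro: has_vector_derivative_continuous)
  have mean: "geodesic_integral f p q \<i> (moebius_map A \<i>) / of_real a = geodesic_integral f p q \<tau> (moebius_map B \<tau>) / of_real b"
    by (rule mean_of_two_periods[OF cont a(1) b(1)])
      (use per[OF f A Aq a(2) refl G i] per[OF f B b(2) refl G \<tau>] in auto)
  obtain \<sigma> :: complex where \<sigma>: "\<sigma> \<noteq> 0" "\<And>f. f holomorphic_on upper_half_plane \<Longrightarrow>
      cycle_integral f A = \<sigma> * geodesic_integral f p q \<i> (moebius_map A \<i>)"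
    by (rule cycle_integral_eq_geodesic_integral[OF A Aq pq]) blast
  have "val f p = cycle_integral f A / cycle_integral (\<lambda>_. 1) A"
    unfolding val_def A_def[symmetric] by simp
  also have "\<dots> = geodesic_integral f p q \<i> (moebius_map A \<i>) / of_real a"
    using \<sigma> hol one[OF A Aq a(2) i] by (simp add: holomorphic_on_const)
  finally show "val f p = geodesic_integral f p q \<tau> (moebius_map B \<tau>) / geodesic_integral (\<lambda>_. 1) p q \<tau> (moebius_map B \<tau>)"
    unfolding mean one[OF B b(2) \<tau>] .
  show "geodesic_integral (\<lambda>_. 1) p q \<tau> (moebius_map B \<tau>) \<in> \<real> - {0}"
    unfolding one[OF B b(2) \<tau>] using b(1) by simp
qed

section \<open>The path along the translates of the arc\<close>

text \<open>The first endpoint is negated because the geodesics in question run from a negative to a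
  positive number; both parameters are then positive.\<close>

definition arc_integral :: "(complex \<Rightarrow> complex) \<Rightarrow> real \<Rightarrow> real \<Rightarrow> complex" where
  "arc_integral f y x = geodesic_integral f (- y) x (cis (2 * pi / 3)) (cis (pi / 3))"

definition mat2 :: "int \<Rightarrow> int \<Rightarrow> int \<Rightarrow> int \<Rightarrow> int^2^2" where
  "mat2 a b c d = vector [vector [a, b], vector [c, d]]"

lemma mat2_nth [simp]:
  "mat2 a b c d $ 1 $ 1 = a" "mat2 a b c d $ 1 $ 2 = b" "mat2 a b c d $ 2 $ 1 = c" "mat2 a b c d $ 2 $ 2 = d"
  by (simp_all add: mat2_def)

lemma cis_in_uhp: "0 < t \<Longrightarrow> t < pi \<Longrightarrow> cis t \<in> upper_half_plane"
  by (simp add: upper_half_plane_def sin_gt_zero)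

lemma arc_range: "t \<in> {pi / 3..2 * pi / 3} \<Longrightarrow> 0 < t" "t \<in> {pi / 3..2 * pi / 3} \<Longrightarrow> t < pi"
  unfolding atLeastAtMost_iff using pi_gt_zero by linarith+

lemma arc_cos_bound:
  assumes "t \<in> {pi / 3..pi / 2}" shows "0 \<le> cos t" "cos t \<le> 1 / 2" "(cos t)\<^sup>2 \<le> 1 / 4"
proof -
  show c0: "0 \<le> cos t" using assms pi_gt_zero unfolding atLeastAtMost_iff by (intro cos_ge_zero) linarith+
  have "cos t \<le> cos (pi / 3)" using assms pi_gt_zero unfolding atLeastAtMost_iff by (intro cos_monotone_0_pi_le) linarith+
  then show c1: "cos t \<le> 1 / 2" by (simp add: cos_60)
  show "(cos t)\<^sup>2 \<le> 1 / 4" using power_mono[OF c1 c0, of 2] by (simp add: power2_eq_square)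
qed

lemma arc_endpoints_uhp: "cis (2 * pi / 3) \<in> upper_half_plane" "cis (pi / 3) \<in> upper_half_plane"
  by (auto intro!: cis_in_uhp)

lemma cis_two_thirds: "cis (2 * pi / 3) + 1 = cis (pi / 3)"
  by (simp add: complex_eq_iff cos_120 sin_120 cos_60 sin_60)

text \<open>The path is split at e^(i\<pi>/3), the image of e^(2\<pi>i/3) under R. Pulling the
  second piece back by R restores its starting point and shifts the endpoints of the geodesic by
  one.\<close>

lemma translation_step:
  assumes f: "modular_invariant f" and \<tau>: "\<tau> \<in> upper_half_plane"
  shows "geodesic_integral f (- y) x (cis (2 * pi / 3)) (\<tau> + 1) =
    arc_integral f y x + geodesic_integral f (- (y + 1)) (x - 1) (cis (2 * pi / 3)) \<tau>"
proof -
  let ?R = "mat2 1 1 0 1"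
  have hol: "f holomorphic_on upper_half_plane" using f by (simp add: modular_invariant_def)
  have det: "det ?R = 1" by (simp add: det_2)
  have R: "moebius_map ?R v = v + 1" for v :: "'b::field" by (simp add: moebius_map_def)
  have H: "\<tau> + 1 \<in> upper_half_plane" using \<tau> by (simp add: upper_half_plane_def)
  have "geodesic_integral f (- y) x (cis (pi / 3)) (\<tau> + 1) =
      geodesic_integral f (- (y + 1)) (x - 1) (cis (2 * pi / 3)) \<tau>"
    using geodesic_integral_moebius[OF f det arc_endpoints_uhp(1) \<tau>, of "- (y + 1)" "x - 1"]
    by (simp add: R cis_two_thirds moebius_denom_def)
  then show ?thesis
    using geodesic_integral_add[OF hol arc_endpoints_uhp H] by (simp add: arc_integral_def)
qed

text \<open>L also sends e^(2\<pi>i/3) to e^(i\<pi>/3), so the path is split at the same point. In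
  terms of the reciprocals \<open>X\<close> and \<open>Y\<close> of the endpoints, pulling back by L
  is again a shift by one.\<close>

lemma lower_step:
  assumes f: "modular_invariant f" and \<tau>: "\<tau> \<in> upper_half_plane" and XY: "1 < X" "0 < Y"
  shows "geodesic_integral f (- (1 / Y)) (1 / X) (cis (2 * pi / 3)) (\<tau> / (\<tau> + 1)) =
    arc_integral f (1 / Y) (1 / X) + geodesic_integral f (- (1 / (Y + 1))) (1 / (X - 1)) (cis (2 * pi / 3)) \<tau>"
proof -
  let ?L = "mat2 1 0 1 1"
  have hol: "f holomorphic_on upper_half_plane" using f by (simp add: modular_invariant_def)
  have det: "det ?L = 1" by (simp add: det_2)
  have L: "moebius_map ?L v = v / (v + 1)" for v :: "'b::field" by (simp add: moebius_map_def)
  have H: "\<tau> / (\<tau> + 1) \<in> upper_half_plane" using moebius_in_upper_half_plane[OF det \<tau>] by (simp add: L)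
  have r: "cis (2 * pi / 3) / (cis (2 * pi / 3) + 1) = cis (pi / 3)"
    unfolding cis_two_thirds cis_divide by (simp add: diff_divide_distrib[symmetric])
  have p: "- (1 / (Y + 1)) + 1 = Y / (Y + 1)" using XY by (simp add: field_simps)
  have q: "1 / (X - 1) + 1 = X / (X - 1)" using XY by (simp add: field_simps)
  have "moebius_map ?L (- (1 / (Y + 1))) = - (1 / Y)" "moebius_map ?L (1 / (X - 1)) = 1 / X"
    unfolding L p q using XY by simp_all
  moreover have "moebius_denom ?L (- (1 / (Y + 1))) \<noteq> 0" "moebius_denom ?L (1 / (X - 1)) \<noteq> 0"
    unfolding moebius_denom_def mat2_nth of_int_1 mult_1 p q using XY by simp_all
  ultimately have "geodesic_integral f (- (1 / Y)) (1 / X) (cis (pi / 3)) (\<tau> / (\<tau> + 1)) =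
      geodesic_integral f (- (1 / (Y + 1))) (1 / (X - 1)) (cis (2 * pi / 3)) \<tau>"
    using geodesic_integral_moebius[OF f det arc_endpoints_uhp(1) \<tau>, of "- (1 / (Y + 1))" "1 / (X - 1)"]
    by (simp add: L r)
  then show ?thesis
    using geodesic_integral_add[OF hol arc_endpoints_uhp H] by (simp add: arc_integral_def)
qed

text \<open>\<open>block_matrix a\<close> is \<open>R\<^sup>a L\<^sup>a\<close>.\<close>

definition block_matrix :: "nat \<Rightarrow> int^2^2" where
  "block_matrix a = mat2 (1 + int a ^ 2) (int a) (int a) 1"

lemma det_block_matrix: "det (block_matrix a) = 1"
  by (simp add: block_matrix_def det_2 power2_eq_square)

lemma uhp_plus_one: "\<tau> \<in> upper_half_plane \<Longrightarrow> \<tau> + 1 \<in> upper_half_plane"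
  by (simp add: upper_half_plane_def)

lemma uhp_lower: "\<tau> \<in> upper_half_plane \<Longrightarrow> \<tau> / (\<tau> + 1) \<in> upper_half_plane"
  using moebius_in_upper_half_plane[of "mat2 1 0 1 1" \<tau>] by (simp add: det_2 moebius_map_def)

lemma block_step_1:
  assumes f: "modular_invariant f" and \<tau>: "\<tau> \<in> upper_half_plane" and xz: "0 < x" "0 < z"
  shows "geodesic_integral f (- (1 / z)) (cf_block 1 x) (cis (2 * pi / 3)) (moebius_map (block_matrix 1) \<tau>) =
    arc_integral f (1 / z) (cf_block 1 x) + arc_integral f (1 + 1 / z) (1 / (1 + 1 / x)) +
    geodesic_integral f (- (1 / cf_block 1 z)) x (cis (2 * pi / 3)) \<tau>"
proof -
  have nz: "\<tau> + 1 \<noteq> 0" using \<tau> by (auto simp: upper_half_plane_def complex_eq_iff)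
  have m: "moebius_map (block_matrix 1) \<tau> = \<tau> / (\<tau> + 1) + 1"
    using nz by (simp add: moebius_map_def block_matrix_def divide_simps)
  have "geodesic_integral f (- (1 / z)) (cf_block 1 x) (cis (2 * pi / 3)) (\<tau> / (\<tau> + 1) + 1) =
    arc_integral f (1 / z) (cf_block 1 x) + geodesic_integral f (- (1 / z + 1)) (cf_block 1 x - 1) (cis (2 * pi / 3)) (\<tau> / (\<tau> + 1))"
    by (rule translation_step[OF f uhp_lower[OF \<tau>]])
  moreover have "geodesic_integral f (- (1 / (1 / (1 + 1 / z)))) (1 / (1 + 1 / x)) (cis (2 * pi / 3)) (\<tau> / (\<tau> + 1)) =
    arc_integral f (1 / (1 / (1 + 1 / z))) (1 / (1 + 1 / x)) +
    geodesic_integral f (- (1 / (1 / (1 + 1 / z) + 1))) (1 / (1 + 1 / x - 1)) (cis (2 * pi / 3)) \<tau>"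
    by (rule lower_step[OF f \<tau>]) (use xz in \<open>auto intro!: divide_pos_pos add_pos_pos\<close>)
  ultimately show ?thesis unfolding m by (simp add: cf_block_def add.commute)
qed

text \<open>Two translation steps followed by two lower steps, one for each letter of RRLL. The
  remaining integral has \<open>x\<close> and the backward tail \<open>cf_block 2 z\<close> in place
  of \<open>cf_block 2 x\<close> and \<open>z\<close>.\<close>

lemma block_step_2:
  assumes f: "modular_invariant f" and \<tau>: "\<tau> \<in> upper_half_plane" and xz: "0 < x" "0 < z"
  shows "geodesic_integral f (- (1 / z)) (cf_block 2 x) (cis (2 * pi / 3)) (moebius_map (block_matrix 2) \<tau>) =
    arc_integral f (1 / z) (cf_block 2 x) + arc_integral f (1 + 1 / z) (1 + 1 / (2 + 1 / x)) +
    arc_integral f (2 + 1 / z) (1 / (2 + 1 / x)) + arc_integral f (1 / (1 + 1 / (2 + 1 / z))) (1 / (1 + 1 / x)) +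
    geodesic_integral f (- (1 / cf_block 2 z)) x (cis (2 * pi / 3)) \<tau>"
proof -
  define \<tau>1 \<tau>2 where "\<tau>1 = \<tau> / (\<tau> + 1)" and "\<tau>2 = \<tau>1 / (\<tau>1 + 1)"
  have H: "\<tau>1 \<in> upper_half_plane" "\<tau>2 \<in> upper_half_plane" "\<tau>2 + 1 \<in> upper_half_plane"
    unfolding \<tau>1_def \<tau>2_def by (intro uhp_lower uhp_plus_one \<tau>)+
  have nz: "\<tau> + 1 \<noteq> 0" "2 * \<tau> + 1 \<noteq> 0" using \<tau> by (auto simp: upper_half_plane_def complex_eq_iff)
  have "\<tau>2 = \<tau> / (2 * \<tau> + 1)"
  proof -
    have "\<tau>1 + 1 = (2 * \<tau> + 1) / (\<tau> + 1)" unfolding \<tau>1_def using nz by (simp add: field_simps)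
    then show ?thesis unfolding \<tau>2_def \<tau>1_def using nz by simp
  qed
  then have m: "moebius_map (block_matrix 2) \<tau> = \<tau>2 + 1 + 1"
    unfolding moebius_map_def block_matrix_def using nz(2) by (simp add: field_simps)
  let ?X = "2 + 1 / x" and ?Y = "1 / (2 + 1 / z)"
  have pos: "1 / x > 0" "1 / z > 0" "?Y > 0" using xz by (auto intro!: divide_pos_pos add_pos_pos)
  have "geodesic_integral f (- (1 / z)) (cf_block 2 x) (cis (2 * pi / 3)) (\<tau>2 + 1 + 1) =
    arc_integral f (1 / z) (cf_block 2 x) +
    geodesic_integral f (- (1 / z + 1)) (cf_block 2 x - 1) (cis (2 * pi / 3)) (\<tau>2 + 1)"
    by (rule translation_step[OF f H(3)])
  moreover have "geodesic_integral f (- (1 / z + 1)) (cf_block 2 x - 1) (cis (2 * pi / 3)) (\<tau>2 + 1) =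
    arc_integral f (1 / z + 1) (cf_block 2 x - 1) +
    geodesic_integral f (- (1 / z + 1 + 1)) (cf_block 2 x - 1 - 1) (cis (2 * pi / 3)) \<tau>2"
    by (rule translation_step[OF f H(2)])
  moreover have "geodesic_integral f (- (1 / ?Y)) (1 / ?X) (cis (2 * pi / 3)) \<tau>2 =
    arc_integral f (1 / ?Y) (1 / ?X) + geodesic_integral f (- (1 / (?Y + 1))) (1 / (?X - 1)) (cis (2 * pi / 3)) \<tau>1"
    unfolding \<tau>2_def by (rule lower_step[OF f H(1)]; use pos in linarith)
  moreover have "geodesic_integral f (- (1 / (?Y + 1))) (1 / (?X - 1)) (cis (2 * pi / 3)) \<tau>1 =
    arc_integral f (1 / (?Y + 1)) (1 / (?X - 1)) +
    geodesic_integral f (- (1 / (?Y + 1 + 1))) (1 / (?X - 1 - 1)) (cis (2 * pi / 3)) \<tau>"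
    unfolding \<tau>1_def by (rule lower_step[OF f \<tau>]; use pos in linarith)
  moreover have "cf_block 2 x - 1 = 1 + 1 / ?X" "1 / z + 1 + 1 = 1 / ?Y" "1 / z + 1 = 1 + 1 / z"
    "cf_block 2 x - 1 - 1 = 1 / ?X" "?X - 1 = 1 + 1 / x" "?X - 1 - 1 = 1 / x" "?Y + 1 = 1 + ?Y" "?Y + 1 + 1 = cf_block 2 z"
    "1 / (1 / x) = x" "1 / ?Y = 2 + 1 / z"
    by (simp_all add: cf_block_def)
  ultimately show ?thesis unfolding m by (simp only: add.assoc)
qed

section \<open>Folding the arc at i\<close>

lemma has_integral_reflect_pi:
  fixes h :: "real \<Rightarrow> real"
  assumes "(h has_integral I) {a..b}"
  shows "((\<lambda>t. h (pi - t)) has_integral I) {pi - b..pi - a}"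
proof -
  have "((\<lambda>t. h (- t)) has_integral I) {- b..- a}" using assms by (simp add: has_integral_reflect_real)
  then have "(((\<lambda>t. h (- t)) \<circ> (+) (- pi)) has_integral I) {pi - b..pi - a}"
    unfolding has_integral_shift_Icc_real by simp
  then show ?thesis by (simp add: o_def)
qed

lemma has_integral_fold_pi:
  fixes h :: "real \<Rightarrow> real"
  assumes h: "(h has_integral I) {a..pi - a}" and a: "a \<le> pi / 2"
  shows "((\<lambda>t. h t + h (pi - t)) has_integral I) {a..pi / 2}"
proof -
  have int: "h integrable_on {a..pi - a}" using h by blast
  have 1: "h integrable_on {a..pi / 2}" "h integrable_on {pi / 2..pi - a}"
    by (rule integrable_on_subinterval[OF int], use a in auto)+
  have "((\<lambda>t. h (pi - t)) has_integral integral {pi / 2..pi - a} h) {a..pi / 2}"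
    using has_integral_reflect_pi[OF integrable_integral[OF 1(2)]] by simp
  then have "((\<lambda>t. h t + h (pi - t)) has_integral integral {a..pi / 2} h + integral {pi / 2..pi - a} h) {a..pi / 2}"
    by (intro has_integral_add integrable_integral[OF 1(1)])
  moreover have "integral {a..pi / 2} h + integral {pi / 2..pi - a} h = I"
    using Henstock_Kurzweil_Integration.integral_combine[of a "pi / 2" "pi - a" h] a int h by (simp add: integral_unique)
  ultimately show ?thesis by simp
qed

text \<open>The pullback of the geodesic form along e^(it) without the factor \<open>f\<close>. Its
  sign is reversed because the arc runs from 2\<pi>/3 down to \<pi>/3.\<close>

definition arc_kernel :: "real \<Rightarrow> real \<Rightarrow> real \<Rightarrow> complex" where
  "arc_kernel y x t = \<i> * cis t * (1 / (cis t - of_real x) - 1 / (cis t + of_real y))"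

lemma cis_minus_real:
  "\<i> * cis t / (cis t - of_real x) = \<i> * (1 - of_real x * cis t) / of_real (1 - 2 * x * cos t + x\<^sup>2)" if "cis t \<noteq> of_real x"
proof -
  have "(cis t - of_real x) * (cis (- t) - of_real x) = of_real (1 - 2 * x * cos t + x\<^sup>2)"
  proof -
    have "sin t * sin t = 1 - cos t * cos t" using sin_squared_eq[of t] by (simp add: power2_eq_square)
    then show ?thesis by (simp add: complex_eq_iff power2_eq_square algebra_simps)
  qed
  moreover have "cis t * (cis (- t) - of_real x) = 1 - of_real x * cis t"
    by (simp add: right_diff_distrib cis_mult)
  moreover have "cis (- t) - of_real x \<noteq> 0" using that by (auto simp: complex_eq_iff)
  ultimately show ?thesis
    by (metis (no_types, lifting) mult.assoc mult_divide_mult_cancel_right)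
qed

lemma arc_integral_has_integral:
  assumes f: "modular_invariant f"
  shows "((\<lambda>t. f (cis t) * arc_kernel y x t) has_integral arc_integral f y x) {pi / 3..2 * pi / 3}"
proof -
  have hol: "f holomorphic_on upper_half_plane" using f by (simp add: modular_invariant_def)
  obtain G where G: "\<And>\<tau>. \<tau> \<in> upper_half_plane \<Longrightarrow> (G has_field_derivative geodesic_form f (- y) x \<tau>) (at \<tau>)"
    by (rule geodesic_form_primitive[OF hol]) blast
  have "((\<lambda>t. \<i> * cis t * geodesic_form f (- y) x (cis t)) has_integral G (cis (2 * pi / 3)) - G (cis (pi / 3))) {pi / 3..2 * pi / 3}"
  proof (rule fundamental_theorem_of_calculus)
    fix t :: real assume "t \<in> {pi / 3..2 * pi / 3}"
    then have "cis t \<in> upper_half_plane" by (intro cis_in_uhp arc_range)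
    moreover have "(cis has_vector_derivative \<i> * cis t) (at t)" 
      unfolding has_vector_derivative_def by (auto intro!: derivative_eq_intros simp: scaleR_conv_of_real)
    ultimately have "((\<lambda>t. G (cis t)) has_vector_derivative \<i> * cis t * geodesic_form f (- y) x (cis t)) (at t)"
      using field_vector_diff_chain_at[OF _ G] by (simp add: o_def)
    then show "((\<lambda>t. G (cis t)) has_vector_derivative \<i> * cis t * geodesic_form f (- y) x (cis t)) (at t within {pi / 3..2 * pi / 3})"
      by (rule has_vector_derivative_at_within)
  qed simp
  from has_integral_neg[OF this] have "((\<lambda>t. - (\<i> * cis t * geodesic_form f (- y) x (cis t))) has_integral arc_integral f y x) {pi / 3..2 * pi / 3}"
    using geodesic_integral_primitive_iff[OF G arc_endpoints_uhp] by (simp add: arc_integral_def)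
  moreover have "- (\<i> * cis t * geodesic_form f (- y) x (cis t)) = f (cis t) * arc_kernel y x t" for t
    by (simp add: geodesic_form_def arc_kernel_def algebra_simps)
  ultimately show ?thesis by simp
qed

lemma arc_kernel_parts:
  assumes "0 < t" "t < pi"
  shows "Re (arc_kernel y x t) = sin t * (x / (1 - 2 * x * cos t + x\<^sup>2) + y / (1 + 2 * y * cos t + y\<^sup>2))"
    "Im (arc_kernel y x t) = (1 - x * cos t) / (1 - 2 * x * cos t + x\<^sup>2) - (1 + y * cos t) / (1 + 2 * y * cos t + y\<^sup>2)"
proof -
  have ne: "cis t \<noteq> of_real r" for r using sin_gt_zero[OF assms] by (auto simp: complex_eq_iff)
  have "arc_kernel y x t = \<i> * cis t / (cis t - of_real x) - \<i> * cis t / (cis t - of_real (- y))"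
    by (simp add: arc_kernel_def right_diff_distrib)
  also have "\<dots> = \<i> * (1 - of_real x * cis t) / of_real (1 - 2 * x * cos t + x\<^sup>2) -
      \<i> * (1 + of_real y * cis t) / of_real (1 + 2 * y * cos t + y\<^sup>2)"
    unfolding cis_minus_real[OF ne] by simp
  finally have K: "arc_kernel y x t = \<dots>" .
  show "Re (arc_kernel y x t) = sin t * (x / (1 - 2 * x * cos t + x\<^sup>2) + y / (1 + 2 * y * cos t + y\<^sup>2))"
    "Im (arc_kernel y x t) = (1 - x * cos t) / (1 - 2 * x * cos t + x\<^sup>2) - (1 + y * cos t) / (1 + 2 * y * cos t + y\<^sup>2)"
    unfolding K by (simp_all add: Re_divide_of_real Im_divide_of_real distrib_left mult.commute)
qed

text \<open>Replacing t by \<pi> - t changes the sign of c = cos t. The product of the two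
  denominators is x^2 ((x + 1/x)^2 - 4c^2), the denominator of \<open>kern\<close> up to
  x^2.\<close>

lemma kern_fold:
  assumes "0 < x" "\<bar>c\<bar> < 1"
  shows "x / (1 - 2 * x * c + x\<^sup>2) + x / (1 + 2 * x * c + x\<^sup>2) = 2 * kern (4 * c\<^sup>2) x"
proof -
  have p: "1 - 2 * x * c + x\<^sup>2 > 0" "1 + 2 * x * c + x\<^sup>2 > 0"
  proof -
    have "c\<^sup>2 < 1" using assms(2) by (simp add: abs_square_less_1)
    moreover have "1 - 2 * x * c + x\<^sup>2 = (x - c)\<^sup>2 + (1 - c\<^sup>2)" "1 + 2 * x * c + x\<^sup>2 = (x + c)\<^sup>2 + (1 - c\<^sup>2)"
      by (simp_all add: power2_eq_square algebra_simps)
    ultimately show "1 - 2 * x * c + x\<^sup>2 > 0" "1 + 2 * x * c + x\<^sup>2 > 0"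
      using zero_le_power2[of "x - c"] zero_le_power2[of "x + c"] by linarith+
  qed
  have "(x + 1 / x)\<^sup>2 - 4 * c\<^sup>2 = (1 - 2 * x * c + x\<^sup>2) * (1 + 2 * x * c + x\<^sup>2) / x\<^sup>2"
    using assms(1) by (simp add: field_simps power2_eq_square)
  then have "kern (4 * c\<^sup>2) x = (x + 1 / x) * x\<^sup>2 / ((1 - 2 * x * c + x\<^sup>2) * (1 + 2 * x * c + x\<^sup>2))"
    by (simp add: kern_def)
  also have "(x + 1 / x) * x\<^sup>2 = x * (1 + x\<^sup>2)" using assms(1) by (simp add: field_simps power2_eq_square)
  finally show ?thesis using p by (simp add: add_frac_eq) (simp add: algebra_simps)
qed

definition real_on_arc :: "(complex \<Rightarrow> complex) \<Rightarrow> bool" where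
  "real_on_arc f \<longleftrightarrow> (\<forall>t\<in>{pi / 3..2 * pi / 3}. f (cis t) \<in> \<real>)"

text \<open>The inversion \<tau> \<mapsto> -1/\<tau> reflects the arc in the imaginary axis.\<close>

lemma arc_symmetry:
  assumes "modular_invariant f" "0 < t" "t < pi"
  shows "f (cis (pi - t)) = f (cis t)"
proof -
  let ?S = "mat2 0 (-1) 1 0"
  have "moebius_map ?S (cis t) = - (1 / cis t)" by (simp add: moebius_map_def)
  also have "\<dots> = cis (pi - t)" by (simp add: cis_divide[symmetric] field_simps)
  finally have "moebius_map ?S (cis t) = cis (pi - t)" .
  moreover have "det ?S = 1" by (simp add: det_2)
  ultimately show ?thesis
    using assms cis_in_uhp[OF assms(2,3)] unfolding modular_invariant_def by metis
qed

lemma arc_integral_Re: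
  assumes f: "modular_invariant f" "real_on_arc f" and xy: "0 < x" "0 < y"
  shows "((\<lambda>t. Re (f (cis t)) * (2 * sin t * (kern (4 * (cos t)\<^sup>2) x + kern (4 * (cos t)\<^sup>2) y)))
    has_integral Re (arc_integral f y x)) {pi / 3..pi / 2}"
proof -
  define h where "h = (\<lambda>t. Re (f (cis t)) * Re (arc_kernel y x t))"
  have e: "pi - pi / 3 = 2 * pi / 3" by simp
  have "((\<lambda>t. Re (f (cis t) * arc_kernel y x t)) has_integral Re (arc_integral f y x)) {pi / 3..2 * pi / 3}"
    by (rule has_integral_Re[OF arc_integral_has_integral[OF f(1)]])
  moreover have "Re (f (cis t) * arc_kernel y x t) = h t" if "t \<in> {pi / 3..2 * pi / 3}" for t
    using f(2) that by (auto simp: real_on_arc_def h_def complex_is_Real_iff)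
  ultimately have "(h has_integral Re (arc_integral f y x)) {pi / 3..pi - pi / 3}"
    by (simp only: e) (rule has_integral_eq[rotated])
  then have "((\<lambda>t. h t + h (pi - t)) has_integral Re (arc_integral f y x)) {pi / 3..pi / 2}"
    by (intro has_integral_fold_pi) (auto simp: field_simps)
  moreover have "h t + h (pi - t) = Re (f (cis t)) * (2 * sin t * (kern (4 * (cos t)\<^sup>2) x + kern (4 * (cos t)\<^sup>2) y))"
    if t: "t \<in> {pi / 3..pi / 2}" for t
  proof -
    have tp: "0 < t" "t < pi" "0 < pi - t" "pi - t < pi" using t pi_gt_zero unfolding atLeastAtMost_iff by linarith+
    have "sin t > 0" using sin_gt_zero tp by blast
    then have c: "\<bar>cos t\<bar> < 1" using sin_cos_squared_add[of t] by (metis abs_square_less_1 less_add_same_cancel2 zero_less_power)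
    have "h t + h (pi - t) = Re (f (cis t)) * (sin t * ((x / (1 - 2 * x * cos t + x\<^sup>2) + x / (1 + 2 * x * cos t + x\<^sup>2)) +
        (y / (1 - 2 * y * cos t + y\<^sup>2) + y / (1 + 2 * y * cos t + y\<^sup>2))))"
      unfolding h_def arc_symmetry[OF f(1) tp(1,2)] arc_kernel_parts(1)[OF tp(1,2)] arc_kernel_parts(1)[OF tp(3,4)]
      by (simp add: distrib_left)
    then show ?thesis unfolding kern_fold[OF xy(1) c] kern_fold[OF xy(2) c] by (simp add: distrib_left)
  qed
  ultimately show ?thesis by (rule has_integral_eq[rotated])
qed

text \<open>The reflection t \<mapsto> \<pi> - t preserves \<open>f\<close> on the arc, exchanges
  the roles of \<open>x\<close> and \<open>y\<close>, and changes the sign of the imaginary part of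
  the kernel.\<close>

lemma arc_integral_Im:
  assumes f: "modular_invariant f" "real_on_arc f"
  shows "Im (arc_integral f y x) = - Im (arc_integral f x y)"
proof -
  have h: "((\<lambda>t. Re (f (cis t)) * Im (arc_kernel y x t)) has_integral Im (arc_integral f y x)) {pi / 3..2 * pi / 3}" for x y
  proof -
    have "((\<lambda>t. Im (f (cis t) * arc_kernel y x t)) has_integral Im (arc_integral f y x)) {pi / 3..2 * pi / 3}"
      by (rule has_integral_Im[OF arc_integral_has_integral[OF f(1)]])
    moreover have "Im (f (cis t) * arc_kernel y x t) = Re (f (cis t)) * Im (arc_kernel y x t)" if "t \<in> {pi / 3..2 * pi / 3}" for t
      using f(2) that by (auto simp: real_on_arc_def complex_is_Real_iff)
    ultimately show ?thesis by (rule has_integral_eq[rotated])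
  qed
  have e: "pi - 2 * pi / 3 = pi / 3" "pi - pi / 3 = 2 * pi / 3" by simp_all
  have "((\<lambda>t. Re (f (cis (pi - t))) * Im (arc_kernel x y (pi - t))) has_integral Im (arc_integral f x y)) {pi / 3..2 * pi / 3}"
    using has_integral_reflect_pi[OF h[where x = y and y = x]] unfolding e .
  moreover have "Re (f (cis (pi - t))) * Im (arc_kernel x y (pi - t)) = - (Re (f (cis t)) * Im (arc_kernel y x t))"
    if "t \<in> {pi / 3..2 * pi / 3}" for t
  proof -
    have tp: "0 < t" "t < pi" "0 < pi - t" "pi - t < pi" using arc_range[OF that] by auto
    show ?thesis
      unfolding arc_symmetry[OF f(1) tp(1,2)] arc_kernel_parts(2)[OF tp(1,2)] arc_kernel_parts(2)[OF tp(3,4)]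
      by (simp add: algebra_simps)
  qed
  ultimately have "((\<lambda>t. - (Re (f (cis t)) * Im (arc_kernel y x t))) has_integral Im (arc_integral f x y)) {pi / 3..2 * pi / 3}"
    by (rule has_integral_eq[rotated])
  with has_integral_neg[OF h[where x = x and y = y]] have "Im (arc_integral f x y) = - Im (arc_integral f y x)"
    by (rule has_integral_unique[rotated])
  then show ?thesis by simp
qed

section \<open>Matrices and path integrals of words\<close>

definition word_matrix :: "nat list \<Rightarrow> int^2^2" where
  "word_matrix bs = foldr (\<lambda>a M. block_matrix a ** M) bs (mat 1)"

lemma word_matrix_simps [simp]:
  "word_matrix [] = mat 1" "word_matrix (a # bs) = block_matrix a ** word_matrix bs"
  by (simp_all add: word_matrix_def)

lemma det_word_matrix: "det (word_matrix bs) = 1"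
  by (induction bs) (simp_all add: det_mul det_block_matrix)

lemma moebius_map_one [simp]: "moebius_map (mat 1) x = x" "moebius_denom (mat 1) x = 1"
  by (simp_all add: moebius_map_def moebius_denom_def mat_def)

lemma moebius_word_Cons:
  assumes "\<tau> \<in> upper_half_plane"
  shows "moebius_map (word_matrix (a # bs)) \<tau> = moebius_map (block_matrix a) (moebius_map (word_matrix bs) \<tau>)"
  unfolding word_matrix_simps by (rule moebius_map_mult(1)) (rule moebius_denom_uhp[OF det_word_matrix assms])

definition weight :: "real \<Rightarrow> real \<Rightarrow> real" where
  "weight t x = 2 * sin t * kern (4 * (cos t)\<^sup>2) x"

lemma weight_inverse: "weight t (1 / x) = weight t x"
  by (simp add: weight_def kern_inverse)

text \<open>The arcs of a block meet the backward tails beginning with \<open>z\<close>, whereas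
  \<open>block_sum\<close> counts those ending with \<open>cf_block a z\<close>. The last two
  summands correct this shift and telescope along a word.\<close>

lemma block_step_Re:
  assumes f: "modular_invariant f" "real_on_arc f" and a: "a \<in> {1, 2}"
    and \<tau>: "\<tau> \<in> upper_half_plane" and xz: "0 < x" "0 < z"
  shows "((\<lambda>t. Re (f (cis t)) * (block_sum (weight t) a x + block_sum (weight t) a z + weight t z - weight t (cf_block a z)))
    has_integral Re (geodesic_integral f (- (1 / z)) (cf_block a x) (cis (2 * pi / 3)) (moebius_map (block_matrix a) \<tau>)) -
      Re (geodesic_integral f (- (1 / cf_block a z)) x (cis (2 * pi / 3)) \<tau>)) {pi / 3..pi / 2}"
proof -
  have arc: "((\<lambda>t. Re (f (cis t)) * (weight t x + weight t y)) has_integral Re (arc_integral f y x)) {pi / 3..pi / 2}"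
    if "0 < x" "0 < y" for x y
    using arc_integral_Re[OF f that] by (simp add: weight_def distrib_left)
  have pos: "0 < 1 / x" "0 < 1 / z" using xz by auto
  then have pos2: "0 < 1 / (2 + 1 / x)" "0 < 1 / (2 + 1 / z)" "0 < 1 / (1 + 1 / x)" "0 < 1 / (1 + 1 / z)"
    by (auto intro!: divide_pos_pos add_pos_pos simp del: zero_less_divide_1_iff)
  have pos3: "0 < cf_block 1 x" "0 < cf_block 2 x" "0 < cf_block 2 z"
    using pos2 by (simp_all add: cf_block_def add_pos_pos del: zero_less_divide_1_iff)
  show ?thesis
  proof (cases "a = 1")
    case True
    have "((\<lambda>t. Re (f (cis t)) * (weight t (cf_block 1 x) + weight t (1 / z)) +
        Re (f (cis t)) * (weight t (1 / (1 + 1 / x)) + weight t (1 + 1 / z))) has_integral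
        Re (arc_integral f (1 / z) (cf_block 1 x)) + Re (arc_integral f (1 + 1 / z) (1 / (1 + 1 / x)))) {pi / 3..pi / 2}"
      by (intro has_integral_add arc pos2 pos pos3 add_pos_pos zero_less_one)
    moreover have "Re (f (cis t)) * (weight t (cf_block 1 x) + weight t (1 / z)) +
        Re (f (cis t)) * (weight t (1 / (1 + 1 / x)) + weight t (1 + 1 / z)) =
        Re (f (cis t)) * (block_sum (weight t) a x + block_sum (weight t) a z + weight t z - weight t (cf_block a z))" for t
      unfolding weight_inverse by (simp add: True block_sum_1 algebra_simps)
    moreover have "Re (arc_integral f (1 / z) (cf_block 1 x)) + Re (arc_integral f (1 + 1 / z) (1 / (1 + 1 / x))) =
      Re (geodesic_integral f (- (1 / z)) (cf_block a x) (cis (2 * pi / 3)) (moebius_map (block_matrix a) \<tau>)) -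
      Re (geodesic_integral f (- (1 / cf_block a z)) x (cis (2 * pi / 3)) \<tau>)"
      unfolding True block_step_1[OF f(1) \<tau> xz] by simp
    ultimately show ?thesis by simp
  next
    case False
    then have a2: "a = 2" using a by simp
    have "((\<lambda>t. Re (f (cis t)) * (weight t (cf_block 2 x) + weight t (1 / z)) +
        Re (f (cis t)) * (weight t (1 + 1 / (2 + 1 / x)) + weight t (1 + 1 / z)) +
        Re (f (cis t)) * (weight t (1 / (2 + 1 / x)) + weight t (2 + 1 / z)) +
        Re (f (cis t)) * (weight t (1 / (1 + 1 / x)) + weight t (1 / (1 + 1 / (2 + 1 / z))))) has_integral
        Re (arc_integral f (1 / z) (cf_block 2 x)) + Re (arc_integral f (1 + 1 / z) (1 + 1 / (2 + 1 / x))) +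
        Re (arc_integral f (2 + 1 / z) (1 / (2 + 1 / x))) + Re (arc_integral f (1 / (1 + 1 / (2 + 1 / z))) (1 / (1 + 1 / x)))) {pi / 3..pi / 2}"
      by (intro has_integral_add arc pos2 pos pos3 add_pos_pos zero_less_one zero_less_numeral divide_pos_pos)
    moreover have "Re (f (cis t)) * (weight t (cf_block 2 x) + weight t (1 / z)) +
        Re (f (cis t)) * (weight t (1 + 1 / (2 + 1 / x)) + weight t (1 + 1 / z)) +
        Re (f (cis t)) * (weight t (1 / (2 + 1 / x)) + weight t (2 + 1 / z)) +
        Re (f (cis t)) * (weight t (1 / (1 + 1 / x)) + weight t (1 / (1 + 1 / (2 + 1 / z)))) =
        Re (f (cis t)) * (block_sum (weight t) a x + block_sum (weight t) a z + weight t z - weight t (cf_block a z))" for t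
      unfolding weight_inverse by (simp add: a2 block_sum_2 algebra_simps)
    moreover have "Re (arc_integral f (1 / z) (cf_block 2 x)) + Re (arc_integral f (1 + 1 / z) (1 + 1 / (2 + 1 / x))) +
        Re (arc_integral f (2 + 1 / z) (1 / (2 + 1 / x))) + Re (arc_integral f (1 / (1 + 1 / (2 + 1 / z))) (1 / (1 + 1 / x))) =
      Re (geodesic_integral f (- (1 / z)) (cf_block a x) (cis (2 * pi / 3)) (moebius_map (block_matrix a) \<tau>)) -
      Re (geodesic_integral f (- (1 / cf_block a z)) x (cis (2 * pi / 3)) \<tau>)"
      unfolding a2 block_step_2[OF f(1) \<tau> xz] by simp
    ultimately show ?thesis by (simp only:)
  qed
qed

lemma cf_block_pos: "0 < a \<Longrightarrow> 0 < x \<Longrightarrow> real a < cf_block a x"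
  by (simp add: cf_block_def add_pos_pos)

lemma foldr_cf_block_pos: "set bs \<subseteq> {1, 2} \<Longrightarrow> 0 < x \<Longrightarrow> 0 < foldr cf_block bs x"
  by (induction bs) (auto intro: order.strict_trans[OF _ cf_block_pos])

lemma word_step_Re:
  assumes f: "modular_invariant f" "real_on_arc f" and bs: "set bs \<subseteq> {1, 2}"
    and \<tau>: "\<tau> \<in> upper_half_plane" and xz: "0 < x" "0 < z"
  shows "((\<lambda>t. Re (f (cis t)) * (path_sum (weight t) bs x z + weight t z - weight t (fold cf_block bs z)))
    has_integral Re (geodesic_integral f (- (1 / z)) (foldr cf_block bs x) (cis (2 * pi / 3)) (moebius_map (word_matrix bs) \<tau>)) -
      Re (geodesic_integral f (- (1 / fold cf_block bs z)) x (cis (2 * pi / 3)) \<tau>)) {pi / 3..pi / 2}"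
  using bs xz(2)
proof (induction bs arbitrary: z)
  case (Cons a bs)
  let ?y = "foldr cf_block bs x" and ?z = "cf_block a z" and ?\<tau> = "moebius_map (word_matrix bs) \<tau>"
  have a: "a \<in> {1, 2}" and bs: "set bs \<subseteq> {1, 2}" using Cons.prems by auto
  have z: "0 < ?z" using cf_block_pos[of a z] a Cons.prems by auto
  have y: "0 < ?y" by (rule foldr_cf_block_pos[OF bs xz(1)])
  have H: "?\<tau> \<in> upper_half_plane" by (rule moebius_in_upper_half_plane[OF det_word_matrix \<tau>])
  from has_integral_add[OF block_step_Re[OF f a H y Cons.prems(2)] Cons.IH[OF bs z]]
  show ?case unfolding moebius_word_Cons[OF \<tau>] by (simp add: algebra_simps)
qed simp

text \<open>These bounds make the trace at least 3, hence the matrix hyperbolic.\<close>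

lemma word_matrix_entries:
  assumes "set bs \<subseteq> {1..}" "bs \<noteq> []"
  shows "2 \<le> word_matrix bs $ 1 $ 1 \<and> 0 \<le> word_matrix bs $ 1 $ 2 \<and> 0 \<le> word_matrix bs $ 2 $ 1 \<and> 1 \<le> word_matrix bs $ 2 $ 2"
  using assms
proof (induction bs)
  case (Cons a bs)
  define M where "M = word_matrix bs"
  have a: "1 \<le> int a" using Cons.prems by auto
  \<comment> \<open>For the empty tail the matrix is the identity, so only 1 is available for the
    upper left entry; the factor 1 + a^2 restores the bound 2.\<close>
  have M: "1 \<le> M $ 1 $ 1" "0 \<le> M $ 1 $ 2" "0 \<le> M $ 2 $ 1" "1 \<le> M $ 2 $ 2"
    using Cons by (cases "bs = []"; auto simp: M_def mat_def)+
  have e: "word_matrix (a # bs) $ 1 $ 1 = (1 + int a ^ 2) * M $ 1 $ 1 + int a * M $ 2 $ 1"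
    "word_matrix (a # bs) $ 1 $ 2 = (1 + int a ^ 2) * M $ 1 $ 2 + int a * M $ 2 $ 2"
    "word_matrix (a # bs) $ 2 $ 1 = int a * M $ 1 $ 1 + M $ 2 $ 1"
    "word_matrix (a # bs) $ 2 $ 2 = int a * M $ 1 $ 2 + M $ 2 $ 2"
    by (simp_all add: M_def block_matrix_def matrix_matrix_mult_def sum_2)
  have "1 \<le> int a ^ 2" using a by simp
  then have "2 * 1 \<le> (1 + int a ^ 2) * M $ 1 $ 1" using M by (intro mult_mono) auto
  moreover have "0 \<le> int a * M $ 2 $ 1" "0 \<le> int a * M $ 1 $ 2" "0 \<le> int a * M $ 1 $ 1"
    "0 \<le> int a * M $ 2 $ 2" "0 \<le> (1 + int a ^ 2) * M $ 1 $ 2" using M by auto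
  ultimately show ?case unfolding e using M by (intro conjI) linarith+
qed simp

lemma hyperbolic_word_matrix:
  assumes "set bs \<subseteq> {1..}" "bs \<noteq> []"
  shows "hyperbolic (word_matrix bs)"
  using word_matrix_entries[OF assms] det_word_matrix[of bs] by (simp add: hyperbolic_def trace_def sum_2)

text \<open>The block matrix prefixes a block to a positive tail and removes one from the negative
  reciprocal of a tail. The second action makes the repelling side follow the reversed word.\<close>

lemma moebius_block_matrix:
  assumes "0 < a" "0 < (x::real)"
  shows "moebius_map (block_matrix a) x = cf_block a x" "moebius_denom (block_matrix a) x \<noteq> 0"
    "moebius_map (block_matrix a) (- (1 / cf_block a x)) = - (1 / x)" "moebius_denom (block_matrix a) (- (1 / cf_block a x)) \<noteq> 0"
proof -
  define n where "n = real a"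
  have n: "n > 0" using assms by (simp add: n_def)
  have d: "n * x + 1 > 0" using n assms by (simp add: add_pos_pos)
  have cf: "cf_block a x = ((1 + n\<^sup>2) * x + n) / (n * x + 1)"
  proof -
    have "n + 1 / x = (n * x + 1) / x" using assms by (simp add: field_simps)
    then show ?thesis unfolding cf_block_def n_def[symmetric] using d by (simp add: field_simps power2_eq_square)
  qed
  have N: "(1 + n\<^sup>2) * x + n > 0" using n assms by (simp add: add_pos_pos)
  show "moebius_map (block_matrix a) x = cf_block a x" unfolding cf by (simp add: moebius_map_def block_matrix_def n_def)
  show "moebius_denom (block_matrix a) x \<noteq> 0" using d by (simp add: moebius_denom_def block_matrix_def n_def)
  have den: "moebius_denom (block_matrix a) (- (1 / cf_block a x)) = x / ((1 + n\<^sup>2) * x + n)"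
    unfolding cf using N d by (simp add: moebius_denom_def block_matrix_def n_def[symmetric] field_simps power2_eq_square)
  then show "moebius_denom (block_matrix a) (- (1 / cf_block a x)) \<noteq> 0" using N assms by simp
  have "(1 + n\<^sup>2) * (- (1 / cf_block a x)) + n = - 1 / ((1 + n\<^sup>2) * x + n)"
    unfolding cf using N d by (simp add: field_simps power2_eq_square)
  then show "moebius_map (block_matrix a) (- (1 / cf_block a x)) = - (1 / x)"
    using den N assms unfolding moebius_map_def moebius_denom_def
    by (simp add: block_matrix_def n_def[symmetric])
qed

lemma word_matrix_attracting:
  assumes "set bs \<subseteq> {1, 2}" "0 < x"
  shows "moebius_map (word_matrix bs) x = foldr cf_block bs x \<and> moebius_denom (word_matrix bs) x \<noteq> 0"
  using assms(1)
proof (induction bs)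
  case (Cons a bs)
  have y: "0 < foldr cf_block bs x" using Cons.prems assms(2) by (intro foldr_cf_block_pos) auto
  have a: "0 < a" using Cons.prems by auto
  have bs: "set bs \<subseteq> {1, 2}" using Cons.prems by simp
  show ?case using Cons.IH[OF bs] moebius_block_matrix(1,2)[OF a y]
    by (simp add: moebius_map_mult)
qed simp

text \<open>For \<open>z\<close> fixed by \<open>fold cf_block bs\<close> this shows that -1/z is
  the other fixed point: the conjugate of a purely periodic continued fraction is minus the
  reciprocal of the one with reversed period.\<close>

lemma word_matrix_repelling:
  assumes "set bs \<subseteq> {1, 2}" "0 < z"
  shows "moebius_map (word_matrix bs) (- (1 / fold cf_block bs z)) = - (1 / z) \<and>
    moebius_denom (word_matrix bs) (- (1 / fold cf_block bs z)) \<noteq> 0"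
  using assms
proof (induction bs arbitrary: z)
  case (Cons a bs)
  have a: "0 < a" using Cons.prems by auto
  have bs: "set bs \<subseteq> {1, 2}" using Cons.prems by simp
  have z: "0 < cf_block a z" using cf_block_pos[OF a Cons.prems(2)] by simp
  show ?case using Cons.IH[OF bs z] moebius_block_matrix(3,4)[OF a Cons.prems(2)]
    by (simp add: moebius_map_mult)
qed simp

lemma path_sum_weight: "path_sum (weight t) bs x z = 2 * sin t * path_sum (kern (4 * (cos t)\<^sup>2)) bs x z"
  using path_sum_linear[of "2 * sin t" "kern (4 * (cos t)\<^sup>2)" 0 "kern (4 * (cos t)\<^sup>2)" bs x z]
  by (simp add: weight_def [abs_def])

lemma path_sum_weight_pos:
  assumes t: "t \<in> {pi / 3..pi / 2}" and "set bs \<subseteq> {1..}" "bs \<noteq> []" "0 < x" "0 < z"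
  shows "0 < path_sum (weight t) bs x z"
proof -
  have "0 < sin t" using t pi_gt_zero unfolding atLeastAtMost_iff by (intro sin_gt_zero) linarith+
  then show ?thesis
    using assms(2-) arc_cos_bound[OF t] by (intro path_sum_pos) (auto simp: weight_def intro!: mult_pos_pos kern_pos)
qed

section \<open>Markov words\<close>

text \<open>Each step back through the expansion contracts the error by 3/4, since the tails are at
  least 4/3 and the convergents at least 1.\<close>

lemma cf_convergent_tendsto:
  fixes a :: "nat \<Rightarrow> nat" and x :: "nat \<Rightarrow> real"
  assumes a: "\<And>k. 1 \<le> a k" and x: "\<And>k. x k = real (a k) + 1 / x (Suc k)" and ge: "\<And>k. 4 / 3 \<le> x k"
  shows "cf_convergent a \<longlonglongrightarrow> x 0"
proof -
  have ge1: "1 \<le> cf_convergent a n" if "\<And>k. 1 \<le> a k" for a n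
    using that
  proof (induction n arbitrary: a)
    case (Suc n)
    then have "1 \<le> cf_convergent (\<lambda>k. a (Suc k)) n" by (intro Suc.IH Suc.prems)
    moreover have "1 \<le> real (a 0)" using Suc.prems[of 0] by simp
    ultimately show ?case by (simp add: add_increasing2)
  qed simp
  have bound: "\<bar>cf_convergent a n - x 0\<bar> \<le> (3 / 4) ^ n"
    if "\<And>k. 1 \<le> a k" "\<And>k. x k = real (a k) + 1 / x (Suc k)" "\<And>k. 4 / 3 \<le> x k" for a x n
    using that
  proof (induction n arbitrary: a x)
    case 0
    have "\<bar>real (a 0) - x 0\<bar> = \<bar>1 / x 1\<bar>" using "0.prems"(2)[of 0] by simp
    also have "\<dots> \<le> 1" using "0.prems"(3)[of 1] by (simp add: divide_le_eq)
    finally show ?case by simp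
  next
    case (Suc n)
    let ?y = "cf_convergent (\<lambda>k. a (Suc k)) n"
    have y: "1 \<le> ?y" by (rule ge1) (rule Suc.prems)
    have x1: "4 / 3 \<le> x 1" by (rule Suc.prems)
    have "cf_convergent a (Suc n) - x 0 = 1 / ?y - 1 / x 1" using Suc.prems(2)[of 0] by simp
    also have "\<dots> = (x 1 - ?y) / (?y * x 1)" using y x1 by (simp add: field_simps)
    finally have "\<bar>cf_convergent a (Suc n) - x 0\<bar> = \<bar>?y - x 1\<bar> / (?y * x 1)"
      using y x1 by (simp add: abs_mult abs_minus_commute)
    also have "\<dots> \<le> \<bar>?y - x 1\<bar> / (4 / 3)"
    proof (rule divide_left_mono)
      show "4 / 3 \<le> ?y * x 1" using mult_mono[OF y x1] y by simp
    qed (use y x1 in auto)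
    also have "\<dots> \<le> (3 / 4) ^ n / (4 / 3)"
    proof (rule divide_right_mono)
      have "\<bar>?y - x (Suc 0)\<bar> \<le> (3 / 4) ^ n"
        by (rule Suc.IH[where x = "\<lambda>k. x (Suc k)"]) (rule Suc.prems)+
      then show "\<bar>?y - x 1\<bar> \<le> (3 / 4) ^ n" by (simp only: One_nat_def)
    qed simp
    finally show ?case by simp
  qed
  have "(\<lambda>n. (3 / 4 :: real) ^ n) \<longlonglongrightarrow> 0" by (rule LIMSEQ_power_zero) simp
  moreover have "norm (cf_convergent a n - x 0) \<le> (3 / 4) ^ n" for n
    unfolding real_norm_def by (rule bound) (rule a x ge)+
  ultimately have "(\<lambda>n. cf_convergent a n - x 0) \<longlonglongrightarrow> 0"
    by (intro Lim_null_comparison[where f = "\<lambda>n. cf_convergent a n - x 0"] always_eventually allI)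
  then show ?thesis by (simp add: LIM_zero_iff)
qed

definition cf_eval :: "nat list \<Rightarrow> real \<Rightarrow> real" where
  "cf_eval xs x = foldr (\<lambda>a y. real a + 1 / y) xs x"

lemma cf_eval_simps [simp]: "cf_eval [] x = x" "cf_eval (a # xs) x = real a + 1 / cf_eval xs x"
  by (simp_all add: cf_eval_def)

text \<open>The interval is invariant because 1 + 1/3 = 4/3 and 2 + 3/4 \<le> 3.\<close>

lemma cf_eval_range:
  assumes "set xs \<subseteq> {1, 2}" "4 / 3 \<le> x" "x \<le> 3"
  shows "4 / 3 \<le> cf_eval xs x \<and> cf_eval xs x \<le> 3"
  using assms(1)
proof (induction xs)
  case (Cons a xs)
  then have y: "4 / 3 \<le> cf_eval xs x" "cf_eval xs x \<le> 3" by auto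
  then have "1 / 3 \<le> 1 / cf_eval xs x" "1 / cf_eval xs x \<le> 3 / 4" by (simp_all add: divide_le_eq le_divide_eq)
  then show ?case using Cons.prems by auto
qed (use assms in simp)

lemma periodic_cf_eq:
  assumes xs: "set xs \<subseteq> {1, 2}" "xs \<noteq> []" and x: "4 / 3 \<le> x" "x \<le> 3" "cf_eval xs x = x"
  shows "periodic_cf xs = x"
proof -
  let ?n = "length xs"
  define y where "y = (\<lambda>k. cf_eval (drop (k mod ?n) xs) x)"
  have n: "0 < ?n" using xs by simp
  have "cf_convergent (\<lambda>k. xs ! (k mod ?n)) \<longlonglongrightarrow> y 0"
  proof (rule cf_convergent_tendsto)
    fix k
    have k: "k mod ?n < ?n" using n by simp
    then have "xs ! (k mod ?n) \<in> {1, 2}" using xs(1) nth_mem by blast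
    then show "1 \<le> xs ! (k mod ?n)" by auto
    have "y k = real (xs ! (k mod ?n)) + 1 / cf_eval (drop (Suc (k mod ?n)) xs) x"
      unfolding y_def using Cons_nth_drop_Suc[OF k, symmetric] by simp
    also have "cf_eval (drop (Suc (k mod ?n)) xs) x = y (Suc k)"
    \<comment> \<open>At the end of a period the remaining tail is \<open>x\<close>, which by the
      fixed point equation is also the value at the start of the next one.\<close>
    proof (cases "Suc (k mod ?n) = ?n")
      case True
      then have "Suc k mod ?n = 0" by (simp add: mod_Suc)
      then show ?thesis using True x by (simp add: y_def)
    next
      case False
      then have "Suc k mod ?n = Suc (k mod ?n)" by (simp add: mod_Suc)
      then show ?thesis by (simp add: y_def)
    qed
    finally show "y k = real (xs ! (k mod ?n)) + 1 / y (Suc k)" .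
    have "set (drop (k mod ?n) xs) \<subseteq> {1, 2}" by (rule order.trans[OF set_drop_subset xs(1)])
    then show "4 / 3 \<le> y k" unfolding y_def using cf_eval_range[OF _ x(1,2)] by blast
  qed
  then have "periodic_cf xs = y 0" unfolding periodic_cf_def by (rule limI)
  also have "y 0 = x" by (simp add: y_def x(3))
  finally show ?thesis .
qed

text \<open>Both root words of the Markov tree repeat a single letter twice, and concatenation keeps
  the letters in pairs. Every period is therefore a product of blocks \<open>[a, a]\<close>.\<close>

definition double_word :: "nat list \<Rightarrow> nat list" where
  "double_word bs = concat (map (\<lambda>a. [a, a]) bs)"

lemma double_word_append: "double_word (bs @ cs) = double_word bs @ double_word cs"
  by (simp add: double_word_def)

lemma cf_eval_double_word: "cf_eval (double_word bs) x = foldr cf_block bs x"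
  by (induction bs) (simp_all add: double_word_def cf_block_def)

lemma periodic_cf_double_word:
  assumes "set bs \<subseteq> {1, 2}" "bs \<noteq> []" "golden \<le> x" "x \<le> silver" "foldr cf_block bs x = x"
  shows "periodic_cf (double_word bs) = x"
proof (rule periodic_cf_eq)
  show "set (double_word bs) \<subseteq> {1, 2}" "double_word bs \<noteq> []"
    using assms by (auto simp: double_word_def)
  show "4 / 3 \<le> x" "x \<le> 3" using assms golden_bounds silver_bounds by linarith+
qed (use assms in \<open>simp add: cf_eval_double_word\<close>)

lemma markov_vertex_double_word:
  assumes "markov_vertex u v"
  shows "\<exists>bs cs. u = double_word bs \<and> v = double_word cs \<and> set bs \<subseteq> {1, 2} \<and> set cs \<subseteq> {1, 2} \<and> bs \<noteq> []"
  using assms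
proof induction
  case root
  show ?case by (rule exI[of _ "[2]"], rule exI[of _ "[1]"]) (simp add: double_word_def)
next
  case (left u v)
  then obtain bs cs where "u = double_word bs" "v = double_word cs" "set bs \<subseteq> {1, 2}" "set cs \<subseteq> {1, 2}" "bs \<noteq> []" by blast
  then show ?case by (intro exI[of _ "bs @ cs"] exI[of _ cs]) (auto simp: double_word_append)
next
  case (right u v)
  then obtain bs cs where "u = double_word bs" "v = double_word cs" "set bs \<subseteq> {1, 2}" "set cs \<subseteq> {1, 2}" "bs \<noteq> []" by blast
  then show ?case by (intro exI[of _ bs] exI[of _ "bs @ cs"]) (auto simp: double_word_append)
qed

text \<open>The word acts as a continuous map of the interval from \<open>golden\<close> to
  \<open>silver\<close> into itself, so the intermediate value theorem gives a fixed point.\<close>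

lemma cf_block_fixed_point:
  assumes bs: "set bs \<subseteq> {1, 2}"
  obtains x where "golden \<le> x" "x \<le> silver" "foldr cf_block bs x = x"
proof -
  have cont: "continuous_on {golden..silver} (foldr cf_block bs)" using bs
  proof (induction bs)
    case (Cons a bs)
    then have IH: "continuous_on {golden..silver} (foldr cf_block bs)" and a: "0 < a" by auto
    have pos: "0 < foldr cf_block bs x" if "x \<in> {golden..silver}" for x
      using Cons.prems that golden_bounds by (intro foldr_cf_block_pos) auto
    have "real a + 1 / y \<noteq> 0" if "y \<in> {0<..}" for y
      using that a add_pos_pos[of "real a" "1 / y"] by auto
    then have "continuous_on {0<..} (cf_block a)"
      unfolding cf_block_def [abs_def] by (intro continuous_intros) auto
    moreover have "foldr cf_block bs ` {golden..silver} \<subseteq> {0<..}" using pos by auto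
    ultimately have "continuous_on {golden..silver} (\<lambda>x. cf_block a (foldr cf_block bs x))"
      by (intro continuous_on_compose2[OF _ IH])
    then show ?case by (simp add: o_def)
  qed (simp add: id_def)
  have gs: "golden \<le> silver" using golden_bounds silver_bounds by linarith
  define d where "d = (\<lambda>x. foldr cf_block bs x - x)"
  have "\<exists>x\<ge>golden. x \<le> silver \<and> d x = 0"
  proof (rule IVT2')
    show "continuous_on {golden..silver} d" unfolding d_def by (intro continuous_intros cont)
    show "d silver \<le> 0" "0 \<le> d golden"
      using foldr_cf_block_range[OF bs, of silver] foldr_cf_block_range[OF bs, of golden] gs by (auto simp: d_def)
  qed (rule gs)
  then show ?thesis using that by (auto simp: d_def)
qed

section \<open>Comparison of the values\<close>

text \<open>If \<open>m\<close> is the mean of \<open>F\<close> with respect to \<open>k2\<close> and \<open>F c = m\<close>, then \<open>F - m\<close> and \<open>k1/k2 - k1 c/k2 c\<close> have the same sign.\<close>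

lemma weighted_mean_mono:
  fixes F k1 k2 :: "real \<Rightarrow> real"
  assumes ab: "a \<le> b" and F: "continuous_on {a..b} F" "mono_on {a..b} F"
    and int: "(k1 has_integral I1) {a..b}" "(k2 has_integral I2) {a..b}"
      "((\<lambda>t. F t * k1 t) has_integral J1) {a..b}" "((\<lambda>t. F t * k2 t) has_integral J2) {a..b}"
    and pos: "\<And>t. t \<in> {a..b} \<Longrightarrow> 0 < k1 t" "\<And>t. t \<in> {a..b} \<Longrightarrow> 0 < k2 t" "0 < I1" "0 < I2"
    and ratio: "\<And>s t. s \<in> {a..b} \<Longrightarrow> t \<in> {a..b} \<Longrightarrow> s \<le> t \<Longrightarrow> k1 s * k2 t \<le> k1 t * k2 s"
  shows "J2 / I2 \<le> J1 / I1"
proof -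
  define m where "m = J2 / I2"
  have fin: "((\<lambda>t. (F t - m) * k2 t) has_integral 0) {a..b}"
    using has_integral_diff[OF int(4) has_integral_mult_right[OF int(2), of m]] pos(4)
    by (simp add: m_def left_diff_distrib)
  have "F a \<le> m"
  proof -
    have "((\<lambda>t. F a * k2 t) has_integral F a * I2) {a..b}" by (rule has_integral_mult_right[OF int(2)])
    from has_integral_le[OF this int(4)] have "F a * I2 \<le> J2"
      using F(2) pos(2) ab by (auto simp: mono_on_def intro!: mult_right_mono less_imp_le[OF pos(2)])
    then show ?thesis using pos(4) by (simp add: m_def pos_le_divide_eq)
  qed
  moreover have "m \<le> F b"
  proof -
    have "((\<lambda>t. F b * k2 t) has_integral F b * I2) {a..b}" by (rule has_integral_mult_right[OF int(2)])
    from has_integral_le[OF int(4) this] have "J2 \<le> F b * I2"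
      using F(2) pos(2) ab by (auto simp: mono_on_def intro!: mult_right_mono less_imp_le[OF pos(2)])
    then show ?thesis using pos(4) by (simp add: m_def pos_divide_le_eq)
  qed
  ultimately obtain c where c: "c \<in> {a..b}" "F c = m" using IVT'[of F a m b] F(1) ab by auto
  define r where "r = k1 c / k2 c"
  have "0 \<le> (F t - m) * (k1 t - r * k2 t)" if t: "t \<in> {a..b}" for t
  proof (cases "c \<le> t")
    case True
    have "k1 c * k2 t \<le> k1 t * k2 c" using ratio[OF c(1) t True] .
    then have "0 \<le> k1 t - r * k2 t" using pos(2)[OF c(1)] by (simp add: r_def pos_divide_le_eq)
    moreover have "0 \<le> F t - m" using F(2) c t True by (auto simp: mono_on_def)
    ultimately show ?thesis by simp
  next
    case False
    have "k1 t * k2 c \<le> k1 c * k2 t" using ratio[OF t c(1)] False by simp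
    then have "k1 t - r * k2 t \<le> 0" using pos(2)[OF c(1)] by (simp add: r_def pos_le_divide_eq)
    moreover have "F t - m \<le> 0" using F(2) c t False by (auto simp: mono_on_def)
    ultimately show ?thesis by (simp add: mult_nonpos_nonpos)
  qed
  \<comment> \<open>Subtracting \<open>r * k2\<close> does not change the integral, because
    \<open>F - m\<close> has integral zero against \<open>k2\<close>.\<close>
  moreover have "((\<lambda>t. (F t - m) * (k1 t - r * k2 t)) has_integral (J1 - m * I1) - r * 0) {a..b}"
    using has_integral_diff[OF has_integral_diff[OF int(3) has_integral_mult_right[OF int(1), of m]] has_integral_mult_right[OF fin, of r]]
    by (simp add: algebra_simps)
  ultimately have "0 \<le> (J1 - m * I1) - r * 0" by (rule has_integral_nonneg[rotated])
  then have "m * I1 \<le> J1" by simp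
  then show ?thesis using pos(3) by (simp add: m_def[symmetric] pos_le_divide_eq)
qed

section \<open>Values of words and the two inequalities\<close>

text \<open>The value is a mean with density \<open>K\<close>: since \<open>z\<close> is fixed by
  the word, the boundary terms of \<open>word_step_Re\<close> cancel, and the constant function 1
  identifies the denominator with the total mass \<open>I\<close>.\<close>

lemma word_val:
  assumes f: "modular_invariant f" "real_on_arc f" and bs: "set bs \<subseteq> {1, 2}" "bs \<noteq> []"
    and x: "golden \<le> x" "x \<le> silver" "foldr cf_block bs x = x"
    and z: "golden \<le> z" "z \<le> silver" "fold cf_block bs z = z"
  defines "K \<equiv> \<lambda>t. path_sum (weight t) bs x z"
  obtains I where "0 < I" "(K has_integral I) {pi / 3..pi / 2}"
    "((\<lambda>t. Re (f (cis t)) * K t) has_integral Re (val f x) * I) {pi / 3..pi / 2}"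
    "val f x = geodesic_integral f (- (1 / z)) x (cis (2 * pi / 3)) (moebius_map (word_matrix bs) (cis (2 * pi / 3))) / of_real I"
proof -
  let ?B = "word_matrix bs" and ?\<rho> = "cis (2 * pi / 3)"
  have pos: "0 < x" "0 < z" "set bs \<subseteq> {1..}" using x z golden_bounds bs by auto
  have B: "hyperbolic ?B" by (rule hyperbolic_word_matrix[OF pos(3) bs(2)])
  have fx: "fixes_point ?B x"
    using word_matrix_attracting[OF bs(1) pos(1)] x by (simp add: fixes_point_def moebius_denom_def)
  have fz: "fixes_point ?B (- (1 / z))"
    using word_matrix_repelling[OF bs(1) pos(2)] z by (simp add: fixes_point_def moebius_denom_def)
  have ne: "x \<noteq> - (1 / z)" using pos by (metis divide_pos_pos less_irrefl neg_0_less_iff_less order_less_trans zero_less_one)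
  define P where "P = (\<lambda>f. geodesic_integral f (- (1 / z)) x ?\<rho> (moebius_map ?B ?\<rho>))"
  note v = val_eq_geodesic_integral[OF f(1) B fx fz ne arc_endpoints_uhp(1)]
  \<comment> \<open>Exchanging the endpoints changes the sign of both integrals and leaves the
    quotient unchanged.\<close>
  have val: "val f x = P f / P (\<lambda>_. 1)"
    unfolding v(1) P_def geodesic_integral_swap[of _ "- (1 / z)" x] by simp
  define I where "I = Re (P (\<lambda>_. 1))"
  have "P (\<lambda>_. 1) \<in> \<real>" using v(2) unfolding P_def geodesic_integral_swap[of _ "- (1 / z)" x] by auto
  then have I: "P (\<lambda>_. 1) = of_real I" by (simp add: I_def)
  have step: "((\<lambda>t. Re (g (cis t)) * K t) has_integral Re (P g)) {pi / 3..pi / 2}"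
    if "modular_invariant g" "real_on_arc g" for g
    using word_step_Re[OF that bs(1) arc_endpoints_uhp(1) pos(1,2)] x z by (simp add: K_def P_def)
  have KI: "(K has_integral I) {pi / 3..pi / 2}"
    using step[of "\<lambda>_. 1"] by (simp add: modular_invariant_const real_on_arc_def I_def)
  have Kpos: "0 < K t" if "t \<in> {pi / 3..pi / 2}" for t
    unfolding K_def by (rule path_sum_weight_pos[OF that pos(3) bs(2) pos(1,2)])
  have "I \<noteq> 0" using v(2) I unfolding P_def geodesic_integral_swap[of _ "- (1 / z)" x] by auto
  moreover have "0 \<le> I" using has_integral_nonneg[OF KI] Kpos by (simp add: less_imp_le)
  ultimately have I0: "0 < I" by simp
  show ?thesis
  proof (rule that[OF I0 KI])
    show "val f x = geodesic_integral f (- (1 / z)) x ?\<rho> (moebius_map ?B ?\<rho>) / of_real I"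
      using val I by (simp add: P_def)
    have "Re (val f x) * I = Re (P f)" unfolding val I using I0 by (simp add: Re_divide_of_real)
    then show "((\<lambda>t. Re (f (cis t)) * K t) has_integral Re (val f x) * I) {pi / 3..pi / 2}" using step[OF f] by simp
  qed
qed

text \<open>For these two words the arcs occur in pairs with \<open>x\<close> and \<open>y\<close>
  exchanged, or with x = y. By \<open>arc_integral_Im\<close> the imaginary parts cancel or
  vanish.\<close>

lemma val_golden_silver_real:
  assumes f: "modular_invariant f" "real_on_arc f"
  shows "val f golden \<in> \<real>" "val f silver \<in> \<real>"
proof -
  have g0: "0 < golden" "golden \<le> silver" using golden_bounds silver_bounds by linarith+
  have s0: "0 < silver" using silver_bounds by linarith
  let ?\<rho> = "cis (2 * pi / 3)"
  have self: "Im (arc_integral f y y) = 0" for y using arc_integral_Im[OF f, of y y] by simp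
  obtain I where I: "val f golden = geodesic_integral f (- (1 / golden)) golden ?\<rho> (moebius_map (word_matrix [1]) ?\<rho>) / of_real I"
    by (rule word_val[OF f, of "[1]" golden golden]) (use g0 cf_block_golden in auto)
  have "Im (geodesic_integral f (- (1 / golden)) golden ?\<rho> (moebius_map (word_matrix [1]) ?\<rho>)) = 0"
  proof -
    have e: "1 + 1 / golden = golden" "cf_block 1 golden = golden" using golden_inverse cf_block_golden by auto
    show ?thesis using block_step_1[OF f(1) arc_endpoints_uhp(1) g0(1) g0(1)] arc_integral_Im[OF f, of golden "1 / golden"]
      unfolding e by simp
  qed
  then show "val f golden \<in> \<real>" unfolding I by (simp add: complex_is_Real_iff Im_divide_of_real)
  obtain I where I: "val f silver = geodesic_integral f (- (1 / silver)) silver ?\<rho> (moebius_map (word_matrix [2]) ?\<rho>) / of_real I"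
    by (rule word_val[OF f, of "[2]" silver silver]) (use g0 cf_block_silver in auto)
  have "Im (geodesic_integral f (- (1 / silver)) silver ?\<rho> (moebius_map (word_matrix [2]) ?\<rho>)) = 0"
  proof -
    have e: "2 + 1 / silver = silver" "cf_block 2 silver = silver" using silver_inverse cf_block_silver by auto
    show ?thesis using block_step_2[OF f(1) arc_endpoints_uhp(1) s0 s0] arc_integral_Im[OF f, of silver "1 / silver"]
      unfolding e by (simp add: self)
  qed
  then show "val f silver \<in> \<real>" unfolding I by (simp add: complex_is_Real_iff Im_divide_of_real)
qed

lemma val_word_bounds:
  assumes f: "modular_invariant f" "real_on_arc f" "mono_on {pi / 3..pi / 2} (\<lambda>t. Re (f (cis t)))"
    and bs: "set bs \<subseteq> {1, 2}" "bs \<noteq> []"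
    and x: "golden \<le> x" "x \<le> silver" "foldr cf_block bs x = x"
  shows "Re (val f golden) \<le> Re (val f x)" "Re (val f x) \<le> Re (val f silver)"
proof -
  have gs: "golden \<le> silver" using golden_bounds silver_bounds by linarith
  let ?T = "{pi / 3..pi / 2}"
  \<comment> \<open>The backward tail is the fixed point of the reversed word.\<close>
  have "set (rev bs) \<subseteq> {1, 2}" using bs by simp
  then obtain z where z: "golden \<le> z" "z \<le> silver" "fold cf_block bs z = z"
    using cf_block_fixed_point[of "rev bs"] by (metis foldr_conv_fold rev_rev_ident)
  have pos: "0 < x" "0 < z" "0 < golden" "0 < silver" "set bs \<subseteq> {1..}"
    using x z golden_bounds silver_bounds bs by auto
  define W where "W = (\<lambda>bs x z t. path_sum (weight t) bs x z)"
  have Wk: "W bs x z t = 2 * sin t * path_sum (kern (4 * (cos t)\<^sup>2)) bs x z" for bs x z t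
    unfolding W_def by (rule path_sum_weight)
  have hol: "f holomorphic_on upper_half_plane" using f(1) by (simp add: modular_invariant_def)
  have "continuous_on ?T (\<lambda>t. f (cis t))"
  proof (rule continuous_on_compose2[OF holomorphic_on_imp_continuous_on[OF hol]])
    show "cis ` ?T \<subseteq> upper_half_plane"
      by (auto intro!: cis_in_uhp) (use pi_gt_zero in linarith)+
  qed (intro continuous_intros)
  then have cont: "continuous_on ?T (\<lambda>t. Re (f (cis t)))" by (intro continuous_intros)
  have Wpos: "0 < W bs x z t" if "t \<in> ?T" "set bs \<subseteq> {1..}" "bs \<noteq> []" "0 < x" "0 < z" for bs x z t
    unfolding W_def by (rule path_sum_weight_pos[OF that])
  have cosm: "4 * (cos t)\<^sup>2 \<le> 4 * (cos s)\<^sup>2" if "s \<in> ?T" "t \<in> ?T" "s \<le> t" for s t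
  proof -
    have "cos t \<le> cos s" using that pi_gt_zero unfolding atLeastAtMost_iff by (intro cos_monotone_0_pi_le) linarith+
    then show ?thesis using arc_cos_bound[OF that(2)] by (simp add: power_mono)
  qed
  have sinpos: "0 < sin t" if "t \<in> ?T" for t
    using that pi_gt_zero unfolding atLeastAtMost_iff by (intro sin_gt_zero) linarith+
  obtain I where I: "0 < I" "(W bs x z has_integral I) ?T" "((\<lambda>t. Re (f (cis t)) * W bs x z t) has_integral Re (val f x) * I) ?T"
    unfolding W_def by (rule word_val[OF f(1,2) bs x z]) blast
  obtain Ig where Ig: "0 < Ig" "(W [1] golden golden has_integral Ig) ?T"
    "((\<lambda>t. Re (f (cis t)) * W [1] golden golden t) has_integral Re (val f golden) * Ig) ?T"
    unfolding W_def by (rule word_val[OF f(1,2), of "[1]" golden golden]) (use gs cf_block_golden in auto)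
  obtain Is where Is: "0 < Is" "(W [2] silver silver has_integral Is) ?T"
    "((\<lambda>t. Re (f (cis t)) * W [2] silver silver t) has_integral Re (val f silver) * Is) ?T"
    unfolding W_def by (rule word_val[OF f(1,2), of "[2]" silver silver]) (use gs cf_block_silver in auto)
  have T: "pi / 3 \<le> pi / 2" by simp
  have "Re (val f golden) * Ig / Ig \<le> Re (val f x) * I / I"
  proof (rule weighted_mean_mono[OF T cont f(3) I(2) Ig(2) I(3) Ig(3) _ _ I(1) Ig(1)])
    fix s t assume st: "s \<in> ?T" "t \<in> ?T" "s \<le> t"
    have "path_sum (kern (4 * (cos s)\<^sup>2)) bs x z * path_sum (kern (4 * (cos t)\<^sup>2)) [1] golden golden \<le>
        path_sum (kern (4 * (cos t)\<^sup>2)) bs x z * path_sum (kern (4 * (cos s)\<^sup>2)) [1] golden golden"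
      using weight_ratio(1)[OF bs(1) x z _ cosm[OF st]] arc_cos_bound[OF st(1)] by simp
    then have "(2 * sin s * (2 * sin t)) * (path_sum (kern (4 * (cos s)\<^sup>2)) bs x z * path_sum (kern (4 * (cos t)\<^sup>2)) [1] golden golden) \<le>
        (2 * sin s * (2 * sin t)) * (path_sum (kern (4 * (cos t)\<^sup>2)) bs x z * path_sum (kern (4 * (cos s)\<^sup>2)) [1] golden golden)"
      using sinpos st by (intro mult_left_mono) (auto intro!: mult_nonneg_nonneg less_imp_le)
    then show "W bs x z s * W [1] golden golden t \<le> W bs x z t * W [1] golden golden s"
      unfolding Wk by (simp only: mult_ac)
  qed (use Wpos pos bs in auto)
  then show "Re (val f golden) \<le> Re (val f x)" using I(1) Ig(1) by simp
  have "Re (val f x) * I / I \<le> Re (val f silver) * Is / Is"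
  proof (rule weighted_mean_mono[OF T cont f(3) Is(2) I(2) Is(3) I(3) _ _ Is(1) I(1)])
    fix s t assume st: "s \<in> ?T" "t \<in> ?T" "s \<le> t"
    have "path_sum (kern (4 * (cos s)\<^sup>2)) [2] silver silver * path_sum (kern (4 * (cos t)\<^sup>2)) bs x z \<le>
        path_sum (kern (4 * (cos t)\<^sup>2)) [2] silver silver * path_sum (kern (4 * (cos s)\<^sup>2)) bs x z"
      using weight_ratio(2)[OF bs(1) x z _ cosm[OF st]] arc_cos_bound[OF st(1)] by (simp only: mult.commute) simp
    then have "(2 * sin s * (2 * sin t)) * (path_sum (kern (4 * (cos s)\<^sup>2)) [2] silver silver * path_sum (kern (4 * (cos t)\<^sup>2)) bs x z) \<le>
        (2 * sin s * (2 * sin t)) * (path_sum (kern (4 * (cos t)\<^sup>2)) [2] silver silver * path_sum (kern (4 * (cos s)\<^sup>2)) bs x z)"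
      using sinpos st by (intro mult_left_mono) (auto intro!: mult_nonneg_nonneg less_imp_le)
    then show "W [2] silver silver s * W bs x z t \<le> W [2] silver silver t * W bs x z s"
      unfolding Wk by (simp only: mult_ac)
  qed (use Wpos pos bs in auto)
  then show "Re (val f x) \<le> Re (val f silver)" using I(1) Is(1) by simp
qed

lemma markov_irrationality_word:
  assumes "w \<in> markov_irrationalities"
  obtains bs where "set bs \<subseteq> {1, 2}" "bs \<noteq> []" "golden \<le> w" "w \<le> silver" "foldr cf_block bs w = w"
proof -
  obtain bs where bs: "set bs \<subseteq> {1, 2}" "bs \<noteq> []" "w = periodic_cf (double_word bs)"
  proof -
    from assms consider "w = periodic_cf [1, 1]" | "w = periodic_cf [2, 2]"
      | u v where "markov_vertex u v" "w = periodic_cf (u @ v)"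
      unfolding markov_irrationalities_def by blast
    then show ?thesis
    proof cases
      case 1 then show ?thesis using that[of "[1]"] by (simp add: double_word_def)
    next
      case 2 then show ?thesis using that[of "[2]"] by (simp add: double_word_def)
    next
      case 3
      from markov_vertex_double_word[OF 3(1)] obtain bs cs where
        "u = double_word bs" "v = double_word cs" "set bs \<subseteq> {1, 2}" "set cs \<subseteq> {1, 2}" "bs \<noteq> []" by blast
      then show ?thesis using that[of "bs @ cs"] 3 by (simp add: double_word_append)
    qed
  qed
  obtain x where x: "golden \<le> x" "x \<le> silver" "foldr cf_block bs x = x" by (rule cf_block_fixed_point[OF bs(1)])
  have "w = x" unfolding bs(3) by (rule periodic_cf_double_word[OF bs(1,2) x])
  then show ?thesis using that[OF bs(1,2)] x by simp
qed

theorem theorem2p2: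
  fixes f :: "complex \<Rightarrow> complex" and w :: real
  assumes "weakly_holomorphic_modular_function f"
    and "\<And>t. t \<in> {pi / 3 .. 2 * pi / 3} \<Longrightarrow> f (exp (\<i> * of_real t)) \<in> \<real> \<and> 0 \<le> Re (f (exp (\<i> * of_real t)))"
    and "mono_on {pi / 3 .. pi / 2} (\<lambda>t. Re (f (exp (\<i> * of_real t))))"
    and "w \<in> markov_irrationalities"
  shows "val f ((1 + sqrt 5) / 2) \<in> \<real> \<and> val f (1 + sqrt 2) \<in> \<real> \<and>
    Re (val f ((1 + sqrt 5) / 2)) \<le> Re (val f w) \<and> Re (val f w) \<le> Re (val f (1 + sqrt 2))"
proof -
  have f: "modular_invariant f" "real_on_arc f" "mono_on {pi / 3..pi / 2} (\<lambda>t. Re (f (cis t)))"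
    using assms(1-3) by (simp_all add: weakly_holomorphic_modular_function_def modular_invariant_def real_on_arc_def cis_conv_exp)
  obtain bs where "set bs \<subseteq> {1, 2}" "bs \<noteq> []" "golden \<le> w" "w \<le> silver" "foldr cf_block bs w = w"
    by (rule markov_irrationality_word[OF assms(4)])
  from val_word_bounds[OF f this] val_golden_silver_real[OF f(1,2)] show ?thesis
    by (simp add: golden_def silver_def)
qed

end
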